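(* Let $\mathbb{F}$ be a field with $\operatorname{char}\mathbb{F}\neq2$. Let $S_1=V(\mathfrak{g})=\mathbb{F}[y][x^{\pm1};\alpha]$, where $\alpha$ is the $\mathbb{F}$-automorphism of $\mathbb{F}[y]$ with $\alpha(y)=y+1$, and let $\theta_1$ be the $\mathbb{F}$-automorphism of $S_1$ such that $\theta_1(x)=x^{-1}$ and $\theta_1(y)=-y$. Let $T_1$ be the $\mathbb{F}$-algebra generated by $x_1,x_2$ and $x_3$ subject to the relations \begin{align*} x_1x_3&=x_3x_1-x_3-2x_2,\\ x_2x_3&=x_3x_2-x_3^2+4,\\ x_1x_2&=x_2x_1-2x_3x_1+3x_2+2x_3. \end{align*} (i) $T_1$ is an iterated skew polynomial ring $\mathbb{F}[x_3][x_2;\delta][x_1;\sigma,\delta_1]$, where $\delta$ is a derivation of $\mathbb{F}[x_3]$, $\sigma$ is an automorphism of $\mathbb{F}[x_3][x_2;\delta]$ and $\delta_1$ is a $\sigma$-derivation of $\mathbb{F}[x_3][x_2;\delta]$. (ii) Let $p=(4-x_3^2)x_1+x_2^2+3x_3x_2+x_3^2+4$. Then $p$ is a central element of $T_1$ and $T_1/pT_1$ is a domain. (iii) The fixed ring $S_1^{\theta_1}$ is isomorphic to $T_1/pT_1$.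
   Context: In the skew Laurent polynomial ring $R[x^{\pm1};\alpha]$ multiplication is determined by $xr=\alpha(r)x$ for $r\in R$; thus in $S_1$ one has $xy-yx=x$. In a skew polynomial ring $R[z;\sigma,\delta]$ (with $\sigma$ an automorphism and $\delta$ a left $\sigma$-derivation of $R$, i.e. $\delta$ is additive and $\delta(rs)=\sigma(r)\delta(s)+\delta(r)s$) one has $zr=\sigma(r)z+\delta(r)$; $R[z;\delta]$ means $R[z;\mathrm{id}_R,\delta]$. A domain is a not necessarily commutative nonzero ring without zero-divisors. $S_1^{\theta_1}$ is the subring of elements fixed by $\theta_1$; isomorphism is as $\mathbb{F}$-algebras. *)

theory Defs
  imports
    "HOL-Algebra.Algebra"
    "HOL-Library.Poly_Mapping"
    "HOL-Computational_Algebra.Polynomial"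
begin

section \<open>Algebras over a field\<close>

text \<open>
  An algebra over the field \<open>'f\<close> is represented by a record of type \<open>('f, 'a) module\<close>: a (not
  necessarily commutative) ring together with a scalar multiplication.  The quotient is meant for a
  two-sided ideal \<open>I\<close>; it extends the ring \<open>A Quot I\<close> by \<open>c (I + a) = I + c a\<close>.
\<close>

definition algebra_quotient ::
    "('f, 'a) module \<Rightarrow> 'a set \<Rightarrow> ('f, 'a set) module" (infixl "AQuot" 65) where
  "A AQuot I =
    \<lparr>carrier = carrier (A Quot I),
     monoid.mult = monoid.mult (A Quot I),
     one = one (A Quot I),
     ring.zero = ring.zero (A Quot I),
     add = add (A Quot I),
     module.smult = (\<lambda>c C. \<Union>a\<in>C. I +>\<^bsub>A\<^esub> (c \<odot>\<^bsub>A\<^esub> a))\<rparr>"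

definition algebra_iso :: "('f, 'a) module \<Rightarrow> ('f, 'b) module \<Rightarrow> ('a \<Rightarrow> 'b) set" where
  "algebra_iso A B =
    {h \<in> ring_iso A B. \<forall>c. \<forall>a\<in>carrier A. h (c \<odot>\<^bsub>A\<^esub> a) = c \<odot>\<^bsub>B\<^esub> h a}"

text \<open>HOL-Algebra's \<^locale>\<open>domain\<close> is commutative; here commutativity is not required.\<close>

definition nc_domain :: "('a, 'm) ring_scheme \<Rightarrow> bool" where
  "nc_domain R \<longleftrightarrow> ring R \<and> \<one>\<^bsub>R\<^esub> \<noteq> \<zero>\<^bsub>R\<^esub> \<and>
    (\<forall>a\<in>carrier R. \<forall>b\<in>carrier R. a \<otimes>\<^bsub>R\<^esub> b = \<zero>\<^bsub>R\<^esub> \<longrightarrow> a = \<zero>\<^bsub>R\<^esub> \<or> b = \<zero>\<^bsub>R\<^esub>)"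

definition central :: "('a, 'm) ring_scheme \<Rightarrow> 'a \<Rightarrow> bool" where
  "central R p \<longleftrightarrow> p \<in> carrier R \<and> (\<forall>a\<in>carrier R. p \<otimes>\<^bsub>R\<^esub> a = a \<otimes>\<^bsub>R\<^esub> p)"


section \<open>Skew polynomial rings\<close>

definition skew_derivation :: "('a, 'm) ring_scheme \<Rightarrow> ('a \<Rightarrow> 'a) \<Rightarrow> ('a \<Rightarrow> 'a) \<Rightarrow> bool" where
  "skew_derivation R \<sigma> \<delta> \<longleftrightarrow>
    \<delta> \<in> carrier R \<rightarrow> carrier R \<and>
    (\<forall>r\<in>carrier R. \<forall>s\<in>carrier R. \<delta> (r \<oplus>\<^bsub>R\<^esub> s) = \<delta> r \<oplus>\<^bsub>R\<^esub> \<delta> s) \<and>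
    (\<forall>r\<in>carrier R. \<forall>s\<in>carrier R.
      \<delta> (r \<otimes>\<^bsub>R\<^esub> s) = (\<sigma> r \<otimes>\<^bsub>R\<^esub> \<delta> s) \<oplus>\<^bsub>R\<^esub> (\<delta> r \<otimes>\<^bsub>R\<^esub> s))"

text \<open>
  \<open>is_skew_polynomial_ring S R z \<sigma> \<delta>\<close> says \<open>S = R[z; \<sigma>, \<delta>]\<close> for a subring given by its carrier
  \<open>R\<close>: \<open>S\<close> is a free left \<open>R\<close>-module with basis \<open>1, z, z\<^sup>2, \<dots>\<close>, and \<open>z r = \<sigma>(r) z + \<delta>(r)\<close>.
  With \<open>\<sigma> = id\<close> and \<open>\<delta> = 0\<close> it is the ordinary polynomial ring \<open>R[z]\<close>.
\<close>

definition is_skew_polynomial_ring ::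
    "('a, 'm) ring_scheme \<Rightarrow> 'a set \<Rightarrow> 'a \<Rightarrow> ('a \<Rightarrow> 'a) \<Rightarrow> ('a \<Rightarrow> 'a) \<Rightarrow> bool" where
  "is_skew_polynomial_ring S R z \<sigma> \<delta> \<longleftrightarrow>
    ring S \<and> subring R S \<and> z \<in> carrier S \<and>
    \<sigma> \<in> ring_iso (S\<lparr>carrier := R\<rparr>) (S\<lparr>carrier := R\<rparr>) \<and>
    skew_derivation (S\<lparr>carrier := R\<rparr>) \<sigma> \<delta> \<and>
    (\<forall>r\<in>R. z \<otimes>\<^bsub>S\<^esub> r = (\<sigma> r \<otimes>\<^bsub>S\<^esub> z) \<oplus>\<^bsub>S\<^esub> \<delta> r) \<and>
    (\<forall>s\<in>carrier S. \<exists>!c :: nat \<Rightarrow> 'a.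
      range c \<subseteq> R \<and> finite {n. c n \<noteq> \<zero>\<^bsub>S\<^esub>} \<and>
      s = (\<Oplus>\<^bsub>S\<^esub>n\<in>{n. c n \<noteq> \<zero>\<^bsub>S\<^esub>}. c n \<otimes>\<^bsub>S\<^esub> (z [^]\<^bsub>S\<^esub> n)))"


section \<open>Skew Laurent polynomial rings\<close>

definition int_funpow :: "('a \<Rightarrow> 'a) \<Rightarrow> int \<Rightarrow> 'a \<Rightarrow> 'a" where
  "int_funpow \<alpha> i = (if i \<ge> 0 then \<alpha> ^^ nat i else inv_into UNIV \<alpha> ^^ nat (- i))"

text \<open>
  The ring \<open>R[x\<^sup>\<plusminus>\<^sup>1; \<alpha>]\<close> over the ring \<open>R\<close> formed by the type \<open>'r\<close>, for an automorphism \<open>\<alpha>\<close>.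
  The finitely supported function \<open>f\<close> stands for \<open>\<Sum>\<^sub>i f\<^sub>i x\<^sup>i\<close>, with coefficients on the left, and
  \<open>(r x\<^sup>i) (s x\<^sup>j) = r \<alpha>\<^sup>i(s) x\<^sup>i\<^sup>+\<^sup>j\<close>.
\<close>

definition skew_laurent_mult ::
    "('r \<Rightarrow> 'r) \<Rightarrow> (int \<Rightarrow>\<^sub>0 'r::ring_1) \<Rightarrow> (int \<Rightarrow>\<^sub>0 'r) \<Rightarrow> (int \<Rightarrow>\<^sub>0 'r)" where
  "skew_laurent_mult \<alpha> f g =
    (\<Sum>i\<in>Poly_Mapping.keys f. \<Sum>j\<in>Poly_Mapping.keys g.
      Poly_Mapping.single (i + j)
        (Poly_Mapping.lookup f i * int_funpow \<alpha> i (Poly_Mapping.lookup g j)))"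

definition S1 :: "('f::field, int \<Rightarrow>\<^sub>0 'f poly) module" where
  "S1 =
    \<lparr>carrier = UNIV,
     monoid.mult = skew_laurent_mult (\<lambda>q. pcompose q [:1, 1:]),
     one = Poly_Mapping.single 0 1,
     ring.zero = 0,
     add = (+),
     module.smult = (\<lambda>c. Poly_Mapping.map (Polynomial.smult c))\<rparr>"

definition S1_x :: "int \<Rightarrow>\<^sub>0 'f::field poly" where
  "S1_x = Poly_Mapping.single 1 1"

definition S1_y :: "int \<Rightarrow>\<^sub>0 'f::field poly" where
  "S1_y = Poly_Mapping.single 0 [:0, 1:]"

definition fixed_subalgebra :: "('f, 'a) module \<Rightarrow> ('a \<Rightarrow> 'a) \<Rightarrow> ('f, 'a) module" where
  "fixed_subalgebra A \<theta> = A\<lparr>carrier := {a \<in> carrier A. \<theta> a = a}\<rparr>"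


subsection \<open>\<open>S\<^sub>1\<close> is a ring and has the automorphism \<open>x \<mapsto> x\<^sup>-\<^sup>1\<close>, \<open>y \<mapsto> -y\<close>\<close>

abbreviation S1_mult :: "(int \<Rightarrow>\<^sub>0 'f::field poly) \<Rightarrow> _" where
  "S1_mult \<equiv> skew_laurent_mult (\<lambda>q. pcompose q [:1, 1:])"

lemma inv_shift:
  "inv_into UNIV (\<lambda>q::'f::field poly. pcompose q [:1, 1:]) = (\<lambda>q. pcompose q [:-1, 1:])"
proof (rule inv_unique_comp)
  show "(\<lambda>q::'f poly. pcompose q [:1, 1:]) \<circ> (\<lambda>q. pcompose q [:-1, 1:]) = id"
    by (rule ext) (simp add: pcompose_assoc[symmetric] pcompose_pCons)
  show "(\<lambda>q. pcompose q [:-1, 1:]) \<circ> (\<lambda>q::'f poly. pcompose q [:1, 1:]) = id"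
    by (rule ext) (simp add: pcompose_assoc[symmetric] pcompose_pCons)
qed

lemma funpow_shift:
  "((\<lambda>q::'f::field poly. pcompose q [:a, 1:]) ^^ n) q = pcompose q [:of_nat n * a, 1:]"
  by (induction n) (simp_all add: pcompose_assoc[symmetric] pcompose_pCons algebra_simps)

lemma int_funpow_shift:
  "int_funpow (\<lambda>q::'f::field poly. pcompose q [:1, 1:]) i q = pcompose q [:of_int i, 1:]"
  by (auto simp: int_funpow_def inv_shift funpow_shift)

lemma poly_mapping_expand:
  "f = (\<Sum>i\<in>Poly_Mapping.keys f. Poly_Mapping.single i (Poly_Mapping.lookup f i))"
  by (rule poly_mapping_eqI)
     (auto simp: lookup_sum lookup_single when_def sum.delta in_keys_iff)

lemma poly_mapping_add_induct [case_names zero single add]: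
  fixes f :: "'a \<Rightarrow>\<^sub>0 'b::comm_monoid_add"
  assumes "P 0" "\<And>i a. P (Poly_Mapping.single i a)" "\<And>f g. P f \<Longrightarrow> P g \<Longrightarrow> P (f + g)"
  shows "P f"
proof -
  have "P (\<Sum>i\<in>A. Poly_Mapping.single i (h i))" for A and h
    by (induction A rule: infinite_finite_induct) (auto intro: assms)
  then show ?thesis using poly_mapping_expand[of f] by metis
qed

lemma S1_mult_superset:
  assumes "finite A" "finite B" "Poly_Mapping.keys f \<subseteq> A" "Poly_Mapping.keys g \<subseteq> B"
  shows "S1_mult f g = (\<Sum>i\<in>A. \<Sum>j\<in>B. Poly_Mapping.single (i + j)
     (Poly_Mapping.lookup f i * pcompose (Poly_Mapping.lookup g j) [:of_int i, 1:]))"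
proof -
  have "S1_mult f g = (\<Sum>i\<in>Poly_Mapping.keys f. \<Sum>j\<in>B. Poly_Mapping.single (i + j)
     (Poly_Mapping.lookup f i * pcompose (Poly_Mapping.lookup g j) [:of_int i, 1:]))"
    unfolding skew_laurent_mult_def int_funpow_shift
    by (intro sum.cong refl sum.mono_neutral_left) (use assms in \<open>auto simp: in_keys_iff\<close>)
  also have "\<dots> = (\<Sum>i\<in>A. \<Sum>j\<in>B. Poly_Mapping.single (i + j)
     (Poly_Mapping.lookup f i * pcompose (Poly_Mapping.lookup g j) [:of_int i, 1:]))"
    by (intro sum.mono_neutral_left) (use assms in \<open>auto simp: in_keys_iff\<close>)
  finally show ?thesis .
qed

lemma S1_mult_add_left: "S1_mult (f + g) h = S1_mult f h + S1_mult g h"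
proof -
  let ?A = "Poly_Mapping.keys f \<union> Poly_Mapping.keys g" and ?B = "Poly_Mapping.keys h"
  have "Poly_Mapping.keys (f + g) \<subseteq> ?A" by (rule Poly_Mapping.keys_add)
  then show ?thesis
    by (simp add: S1_mult_superset[of ?A ?B] lookup_add ring_distribs single_add sum.distrib)
qed

lemma S1_mult_add_right: "S1_mult h (f + g) = S1_mult h f + S1_mult h g"
proof -
  let ?A = "Poly_Mapping.keys f \<union> Poly_Mapping.keys g" and ?B = "Poly_Mapping.keys h"
  have "Poly_Mapping.keys (f + g) \<subseteq> ?A" by (rule Poly_Mapping.keys_add)
  then show ?thesis
    by (simp add: S1_mult_superset[of ?B ?A] lookup_add ring_distribs single_add sum.distrib pcompose_add)
qed

lemma S1_mult_single: "S1_mult (Poly_Mapping.single i a) (Poly_Mapping.single j b) =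
   Poly_Mapping.single (i + j) (a * pcompose b [:of_int i, 1:])"
  by (subst S1_mult_superset[of "{i}" "{j}"]) auto

lemma S1_mult_0 [simp]: "S1_mult 0 f = 0" "S1_mult f 0 = 0"
  by (simp_all add: skew_laurent_mult_def)

lemma S1_mult_assoc: "S1_mult (S1_mult f g) h = S1_mult f (S1_mult g h)"
proof (induction f rule: poly_mapping_add_induct)
  case (single i a)
  show ?case
  proof (induction g rule: poly_mapping_add_induct)
    case (single j b)
    show ?case
    proof (induction h rule: poly_mapping_add_induct)
      case (single k c)
      show ?case
        by (simp add: S1_mult_single pcompose_mult pcompose_assoc[symmetric] pcompose_pCons algebra_simps)
    qed (simp_all add: S1_mult_add_right)
  qed (simp_all add: S1_mult_add_left S1_mult_add_right)
qed (simp_all add: S1_mult_add_left)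

lemma S1_mult_1: "S1_mult 1 f = f" "S1_mult f 1 = f"
  unfolding single_one[symmetric]
  by (induction f rule: poly_mapping_add_induct;
      simp add: S1_mult_add_left S1_mult_add_right S1_mult_single pcompose_1 del: single_one)+

lemma ring_S1: "ring S1"
proof (rule ringI)
  show "abelian_group S1"
    by (rule abelian_groupI) (auto simp: S1_def algebra_simps intro: exI[of _ "- x" for x])
  show "Group.monoid S1"
    by (rule monoidI) (auto simp: S1_def S1_mult_assoc S1_mult_1)
qed (auto simp: S1_def S1_mult_add_left S1_mult_add_right)

lemma S1_relation: "S1_x \<otimes>\<^bsub>S1\<^esub> S1_y \<ominus>\<^bsub>S1\<^esub> S1_y \<otimes>\<^bsub>S1\<^esub> S1_x =
    (S1_x :: int \<Rightarrow>\<^sub>0 'f::field poly)"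
proof -
  interpret ring "S1 :: ('f, _) module" by (rule ring_S1)
  have c: "a \<in> carrier S1" for a :: "int \<Rightarrow>\<^sub>0 'f poly"
    by (simp add: S1_def)
  have "1 + [:0, 1:] = [:1, 1 :: 'f:]"
    unfolding one_pCons[where 'a = 'f] by (simp only: add_pCons add_0_left add_0_right)
  then have "pcompose [:0, 1:] [:1, 1 :: 'f:] = 1 + [:0, 1:]"
    by (simp add: pcompose_pCons)
  then have *: "S1_x \<otimes>\<^bsub>S1\<^esub> S1_y = (S1_x :: int \<Rightarrow>\<^sub>0 'f poly) \<oplus>\<^bsub>S1\<^esub> S1_y \<otimes>\<^bsub>S1\<^esub> S1_x"
    by (simp add: S1_def S1_x_def S1_y_def S1_mult_single pcompose_1 single_add)
  show ?thesis
    by (simp only: * a_minus_def a_assoc[OF c c a_inv_closed[OF c]] r_neg[OF c] r_zero[OF c])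
qed

definition S1_flip :: "(int \<Rightarrow>\<^sub>0 'f::field poly) \<Rightarrow> (int \<Rightarrow>\<^sub>0 'f poly)" where
  "S1_flip f =
    (\<Sum>i\<in>Poly_Mapping.keys f.
      Poly_Mapping.single (- i) (pcompose (Poly_Mapping.lookup f i) [:0, -1:]))"

lemma S1_flip_superset:
  assumes "finite A" "Poly_Mapping.keys f \<subseteq> A"
  shows "S1_flip f = (\<Sum>i\<in>A. Poly_Mapping.single (- i) (pcompose (Poly_Mapping.lookup f i) [:0, -1:]))"
  unfolding S1_flip_def by (intro sum.mono_neutral_left) (use assms in \<open>auto simp: in_keys_iff\<close>)

lemma S1_flip_add: "S1_flip (f + g) = S1_flip f + S1_flip g"
proof -
  let ?A = "Poly_Mapping.keys f \<union> Poly_Mapping.keys g"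
  have "Poly_Mapping.keys (f + g) \<subseteq> ?A" by (rule Poly_Mapping.keys_add)
  then show ?thesis
    by (simp add: S1_flip_superset[of ?A] lookup_add single_add sum.distrib pcompose_add)
qed

lemma S1_flip_single:
  "S1_flip (Poly_Mapping.single i a) = Poly_Mapping.single (- i) (pcompose a [:0, -1:])"
  by (subst S1_flip_superset[of "{i}"]) auto

lemma S1_flip_0: "S1_flip 0 = 0" by (simp add: S1_flip_def)

lemma S1_flip_1: "S1_flip 1 = 1"
  using S1_flip_single[of 0 1] by (simp add: pcompose_1)

lemma S1_flip_flip: "S1_flip (S1_flip f) = f"
  by (induction f rule: poly_mapping_add_induct)
    (simp_all add: S1_flip_0 S1_flip_add S1_flip_single pcompose_assoc[symmetric] pcompose_pCons)

lemma S1_flip_mult: "S1_flip (S1_mult f g) = S1_mult (S1_flip f) (S1_flip g)"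
proof (induction f rule: poly_mapping_add_induct)
  case (single i a)
  show ?case
    by (induction g rule: poly_mapping_add_induct)
     (simp_all add: S1_flip_0 S1_flip_add S1_mult_add_right S1_flip_single S1_mult_single pcompose_mult
        pcompose_assoc[symmetric] pcompose_pCons)
qed (simp_all add: S1_flip_0 S1_flip_add S1_mult_add_left)

lemma map_smult_add:
  fixes f g :: "'b \<Rightarrow>\<^sub>0 'a::comm_semiring_0 poly"
  shows "Poly_Mapping.map (Polynomial.smult c) (f + g) =
    Poly_Mapping.map (Polynomial.smult c) f + Poly_Mapping.map (Polynomial.smult c) g"
proof (rule poly_mapping_eqI)
  fix k
  have "Poly_Mapping.lookup (Poly_Mapping.map (Polynomial.smult c) h) k =
      Polynomial.smult c (Poly_Mapping.lookup h k)" for h :: "'b \<Rightarrow>\<^sub>0 'a poly"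
    by (simp add: Poly_Mapping.map.rep_eq when_def)
  then show "Poly_Mapping.lookup (Poly_Mapping.map (Polynomial.smult c) (f + g)) k =
      Poly_Mapping.lookup
        (Poly_Mapping.map (Polynomial.smult c) f + Poly_Mapping.map (Polynomial.smult c) g) k"
    by (simp add: lookup_add smult_add_right)
qed

lemma S1_flip_smult:
  fixes f :: "int \<Rightarrow>\<^sub>0 'a::field poly"
  shows "S1_flip (Poly_Mapping.map (Polynomial.smult c) f) =
    Poly_Mapping.map (Polynomial.smult c) (S1_flip f)"
proof (induction f rule: poly_mapping_add_induct)
  case zero
  have "Poly_Mapping.map (Polynomial.smult c) 0 = (0 :: int \<Rightarrow>\<^sub>0 'a poly)"
    by (rule poly_mapping_eqI) (simp add: Poly_Mapping.map.rep_eq)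
  then show ?case
    by (simp add: S1_flip_0)
next
  case (single i a)
  have "Poly_Mapping.map (Polynomial.smult c) (Poly_Mapping.single k b) =
      Poly_Mapping.single k (Polynomial.smult c b)" for k :: int and b
    by (rule poly_mapping_eqI)
       (simp add: Poly_Mapping.map.rep_eq lookup_single when_def)
  then show ?case
    by (simp add: S1_flip_single pcompose_smult)
next
  case (add f g)
  then show ?case
    by (simp add: S1_flip_add map_smult_add)
qed

lemma S1_theta_exists:
  "\<exists>\<theta>\<in>algebra_iso S1 S1. \<theta> S1_x = inv\<^bsub>S1\<^esub> S1_x \<and> \<theta> (S1_y :: int \<Rightarrow>\<^sub>0 'f::field poly) = \<ominus>\<^bsub>S1\<^esub> S1_y"
proof (intro bexI conjI)
  interpret ring "S1 :: ('f, _) module" by (rule ring_S1)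
  have c: "a \<in> carrier S1" for a :: "int \<Rightarrow>\<^sub>0 'f poly" by (simp add: S1_def)
  have "inj S1_flip" "surj S1_flip" by (metis injI S1_flip_flip, metis surjI S1_flip_flip)
  then show "(S1_flip :: _ \<Rightarrow> int \<Rightarrow>\<^sub>0 'f poly) \<in> algebra_iso S1 S1"
    by (auto simp: algebra_iso_def ring_iso_def ring_hom_def S1_def S1_flip_add S1_flip_mult S1_flip_smult
         S1_flip_1 bij_betw_def inj_def)
  show "S1_flip S1_x = inv\<^bsub>S1\<^esub> (S1_x :: int \<Rightarrow>\<^sub>0 'f poly)"
    by (rule inv_char[OF c c, symmetric])
       (simp_all add: S1_def S1_x_def S1_flip_single S1_mult_single pcompose_1)
  have "S1_flip S1_y \<oplus>\<^bsub>S1\<^esub> (S1_y :: int \<Rightarrow>\<^sub>0 'f poly) = \<zero>\<^bsub>S1\<^esub>"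
    by (simp add: S1_def S1_y_def S1_flip_single pcompose_pCons single_add[symmetric])
  then show "S1_flip S1_y = \<ominus>\<^bsub>S1\<^esub> (S1_y :: int \<Rightarrow>\<^sub>0 'f poly)"
    by (rule minus_equality[OF _ c c, symmetric])
qed


section \<open>Free algebras and the algebra \<open>T\<^sub>1\<close>\<close>

text \<open>
  Words, written additively, so that \<open>'x word \<Rightarrow>\<^sub>0 'f\<close> with its convolution product is the free
  associative algebra on \<open>'x\<close>.
\<close>

datatype 'x word = Word "'x list"

instantiation word :: (type) monoid_add
begin

definition zero_word :: "'a word" where "0 = Word []"

fun plus_word :: "'a word \<Rightarrow> 'a word \<Rightarrow> 'a word" where
  "Word u + Word v = Word (u @ v)"

instance
proof
  fix a b c :: "'a word"
  show "a + b + c = a + (b + c)"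
    by (cases a; cases b; cases c) simp
  show "0 + a = a" "a + 0 = a"
    by (cases a; simp add: zero_word_def)+
qed

end

definition free_algebra :: "('f::field, 'x word \<Rightarrow>\<^sub>0 'f) module" where
  "free_algebra =
    \<lparr>carrier = UNIV,
     monoid.mult = (*),
     one = 1,
     ring.zero = 0,
     add = (+),
     module.smult = (\<lambda>c a. Poly_Mapping.single 0 c * a)\<rparr>"

definition free_gen :: "'x \<Rightarrow> 'x word \<Rightarrow>\<^sub>0 'f::field" where
  "free_gen g = Poly_Mapping.single (Word [g]) 1"

datatype gen = G1 | G2 | G3

abbreviation X1 :: "gen word \<Rightarrow>\<^sub>0 'f::field" where "X1 \<equiv> free_gen G1"
abbreviation X2 :: "gen word \<Rightarrow>\<^sub>0 'f::field" where "X2 \<equiv> free_gen G2"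
abbreviation X3 :: "gen word \<Rightarrow>\<^sub>0 'f::field" where "X3 \<equiv> free_gen G3"

definition T1_ideal :: "(gen word \<Rightarrow>\<^sub>0 'f::field) set" where
  "T1_ideal = Idl\<^bsub>free_algebra\<^esub>
    {X1 * X3 - (X3 * X1 - X3 - 2 * X2),
     X2 * X3 - (X3 * X2 - X3 ^ 2 + 4),
     X1 * X2 - (X2 * X1 - 2 * X3 * X1 + 3 * X2 + 2 * X3)}"

definition T1 :: "('f::field, (gen word \<Rightarrow>\<^sub>0 'f) set) module" where
  "T1 = free_algebra AQuot T1_ideal"

definition T1_of :: "(gen word \<Rightarrow>\<^sub>0 'f::field) \<Rightarrow> (gen word \<Rightarrow>\<^sub>0 'f) set" where
  "T1_of w = T1_ideal +>\<^bsub>free_algebra\<^esub> w"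

definition T1_p :: "(gen word \<Rightarrow>\<^sub>0 'f::field) set" where
  "T1_p = T1_of ((4 - X3 ^ 2) * X1 + X2 ^ 2 + 3 * X3 * X2 + X3 ^ 2 + 4)"

text \<open>
  The copy of the field in \<open>T\<^sub>1\<close> is the range of \<open>T1_scalar\<close>, provided this map is injective.
  Where \<open>T\<^sub>1\<close> is said to be an iterated skew polynomial ring over the field, injectivity has to be
  stated as well: it excludes the zero ring, which is trivially a skew polynomial ring over itself.
\<close>

definition T1_scalar :: "'f::field \<Rightarrow> (gen word \<Rightarrow>\<^sub>0 'f) set" where
  "T1_scalar c = c \<odot>\<^bsub>T1\<^esub> \<one>\<^bsub>T1\<^esub>"

definition T1_mod_p :: "('f::field, (gen word \<Rightarrow>\<^sub>0 'f) set set) module" where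
  "T1_mod_p = T1 AQuot (T1_p <#\<^bsub>T1\<^esub> carrier T1)"

end

(* T_1 maps to S_1 by x_1 -> y^2, x_2 -> y (x - 1/x), x_3 -> x + 1/x.

   That the ordered monomials x_3^i x_2^j x_1^k are independent is seen in a module over
   F[[X]][b][t]: x_3 acts as X, x_2 as b + (4 - X^2) d/dX, and x_1 is obtained by solving p = t, which is
   possible because 4 - X^2 is a unit of F[[X]] when char F is not 2.  As p acts by the variable t, it
   is central.

   Modulo p, every element of T_1 is a combination of x_3^n x_1^k and x_3^n (x_2 + x_3) x_1^k.  Their
   images have top coefficients (y+n)^(2k) x^n and (y+n+1)^(2k+1) x^(n+1), so they are independent and
   the kernel is p T_1; an element fixed by theta_1 is reduced to an even polynomial in y by cancelling
   its extreme powers of x.  The quotient T_1 / p T_1 is a domain since it embeds in S_1. *)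

theory Submission
  imports Defs "HOL-Computational_Algebra.Polynomial_FPS"
begin

section \<open>Modules over the free algebra\<close>

text \<open>The relation p has its origin in 4 - (x + 1/x)^2 = -(x - 1/x)^2: in the images, (4 -
  x_3^2) x_1 and x_2^2 cancel up to lower order, and the remaining terms of p correct for
  non-commutativity.

  Independence of the ordered monomials needs a vector with zero annihilator. The ring S_1 cannot
  supply one, because p acts on it as zero. In the replacement the commutator of x_2 and x_3 forces
  the derivation (4 - X^2) d/dX. That derivation alone would not do: in positive characteristic its
  powers are dependent over F[[X]]. The free variable b repairs this, since x_2 raises the degree in
  b by exactly one; in the same way x_1 raises the degree in t by exactly one.

  The maps \<sigma> and \<delta>_1 are never defined by formulas on all of F[x_3][x_2; \<delta>].
  Elements can be moved past x_1 in both directions, and uniqueness of coefficients turns these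
  existence statements into maps with all required properties. For the kernel the obstacle is that
  two monomials can share a power of x; they are then told apart by parity in the shifted variable y
  + n.\<close>

locale word_action =
  fixes sc :: "'f::field \<Rightarrow> 'm::ab_group_add \<Rightarrow> 'm" and g :: "'x \<Rightarrow> 'm \<Rightarrow> 'm"
  assumes sc_add_left: "sc (a + b) m = sc a m + sc b m"
    and sc_add_right: "sc a (m + n) = sc a m + sc a n"
    and sc_mult: "sc (a * b) m = sc a (sc b m)"
    and sc_one: "sc 1 m = m"
    and g_add: "g x (m + n) = g x m + g x n"
    and g_sc: "g x (sc a m) = sc a (g x m)"
begin

primrec act_word :: "'x word \<Rightarrow> 'm \<Rightarrow> 'm" where
  "act_word (Word l) = foldr g l"

text \<open>A module over a free algebra is a vector space with one arbitrary linear endomorphism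
  per generator. Working with bare functions on a type lets the same construction serve for S_1 and
  for the power series module.\<close>

definition act :: "('x word \<Rightarrow>\<^sub>0 'f) \<Rightarrow> 'm \<Rightarrow> 'm" where
  "act w m = (\<Sum>k\<in>Poly_Mapping.keys w. sc (Poly_Mapping.lookup w k) (act_word k m))"

lemma sc_0_left [simp]: "sc 0 m = 0"
  using sc_add_left[of 0 0 m] by simp

lemma sc_0_right [simp]: "sc a 0 = 0"
  using sc_add_right[of a 0 0] by simp

lemma act_word_add: "act_word k (m + n) = act_word k m + act_word k n"
proof (cases k)
  case (Word l)
  then show ?thesis by (induction l arbitrary: k) (simp_all add: g_add)
qed

lemma act_word_sc: "act_word k (sc a m) = sc a (act_word k m)"
proof (cases k)
  case (Word l)
  then show ?thesis by (induction l arbitrary: k) (simp_all add: g_sc)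
qed

lemma act_word_plus: "act_word (k + l) m = act_word k (act_word l m)"
  by (cases k; cases l) simp

lemma act_superset:
  assumes "finite A" "Poly_Mapping.keys w \<subseteq> A"
  shows "act w m = (\<Sum>k\<in>A. sc (Poly_Mapping.lookup w k) (act_word k m))"
  unfolding act_def by (intro sum.mono_neutral_left) (use assms in \<open>auto simp: in_keys_iff\<close>)

lemma act_single: "act (Poly_Mapping.single k c) m = sc c (act_word k m)"
  by (subst act_superset[of "{k}"]) auto

lemma act_0 [simp]: "act 0 m = 0"
  by (simp add: act_def)

lemma act_add_left: "act (v + w) m = act v m + act w m"
proof -
  let ?A = "Poly_Mapping.keys v \<union> Poly_Mapping.keys w"
  have "Poly_Mapping.keys (v + w) \<subseteq> ?A" by (rule Poly_Mapping.keys_add)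
  then show ?thesis
    by (simp add: act_superset[of ?A] lookup_add sc_add_left sum.distrib)
qed

lemma act_add_right: "act w (m + n) = act w m + act w n"
  by (simp add: act_def act_word_add sc_add_right sum.distrib)

lemma act_0_right [simp]: "act w 0 = 0"
  using act_add_right[of w 0 0] by simp

lemma act_minus_left: "act (- w) m = - act w m"
  using act_add_left[of "- w" w m] by (simp add: eq_neg_iff_add_eq_0)

lemma act_diff_left: "act (v - w) m = act v m - act w m"
  using act_add_left[of v "- w" m] by (simp add: act_minus_left)

lemma act_mult: "act (v * w) m = act v (act w m)"
proof (induction v rule: poly_mapping_add_induct)
  case (single i a)
  show ?case
    by (induction w rule: poly_mapping_add_induct)
       (simp_all add: distrib_left act_add_left act_add_right mult_single act_single
         act_word_plus act_word_sc sc_mult)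
qed (simp_all add: distrib_right act_add_left)

lemma act_scalar: "act (Poly_Mapping.single 0 c) m = sc c m"
  by (simp add: act_single zero_word_def)

lemma act_1 [simp]: "act 1 m = m"
  using act_scalar[of 1 m] by (simp add: sc_one)

lemma act_gen [simp]: "act (free_gen x) m = g x m"
  by (simp add: free_gen_def act_single sc_one)

text \<open>The module is only an additive group, so integers act as repeated sums; the relations
  assumed in \<open>T1_action\<close> are written out in the same form.\<close>

lemma act_2 [simp]: "act 2 m = m + m"
proof -
  have "(2 :: 'x word \<Rightarrow>\<^sub>0 'f) = 1 + 1" by simp
  then show ?thesis by (simp only: act_add_left act_1)
qed

lemma act_3 [simp]: "act 3 m = m + m + m"
proof -
  have "(3 :: 'x word \<Rightarrow>\<^sub>0 'f) = 2 + 1" by simp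
  then show ?thesis by (simp only: act_add_left act_2 act_1)
qed

lemma act_4 [simp]: "act 4 m = m + m + m + m"
proof -
  have "(4 :: 'x word \<Rightarrow>\<^sub>0 'f) = 2 + 2" by simp
  then show ?thesis by (simp only: act_add_left act_2 add.assoc)
qed

end

section \<open>The algebra \<open>T\<^sub>1\<close> as a type\<close>

lemma ring_free_algebra: "ring (free_algebra :: ('f::field, 'x word \<Rightarrow>\<^sub>0 'f) module)"
proof (rule ringI)
  show "abelian_group (free_algebra :: ('f::field, 'x word \<Rightarrow>\<^sub>0 'f) module)"
    by (rule abelian_groupI) (auto simp: free_algebra_def algebra_simps intro: exI[of _ "- x" for x])
  show "Group.monoid (free_algebra :: ('f::field, 'x word \<Rightarrow>\<^sub>0 'f) module)"
    by (rule monoidI) (auto simp: free_algebra_def mult.assoc)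
qed (auto simp: free_algebra_def distrib_left distrib_right)

lemma free_algebra_simps [simp]:
  "carrier free_algebra = UNIV" "x \<otimes>\<^bsub>free_algebra\<^esub> y = x * y" "x \<oplus>\<^bsub>free_algebra\<^esub> y = x + y"
  "\<zero>\<^bsub>free_algebra\<^esub> = 0" "\<one>\<^bsub>free_algebra\<^esub> = 1" "c \<odot>\<^bsub>free_algebra\<^esub> x = Poly_Mapping.single 0 c * x"
  by (simp_all add: free_algebra_def)

lemma free_algebra_minus [simp]: "\<ominus>\<^bsub>free_algebra\<^esub> x = - x"
  by (rule abelian_group.minus_equality[OF ring.is_abelian_group[OF ring_free_algebra]]) auto

definition T1_relators :: "(gen word \<Rightarrow>\<^sub>0 'f::field) set" where
  "T1_relators = {X1 * X3 - (X3 * X1 - X3 - 2 * X2),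
     X2 * X3 - (X3 * X2 - X3 ^ 2 + 4),
     X1 * X2 - (X2 * X1 - 2 * X3 * X1 + 3 * X2 + 2 * X3)}"

lemma T1_ideal_relators: "T1_ideal = Idl\<^bsub>free_algebra\<^esub> T1_relators"
  by (simp add: T1_ideal_def T1_relators_def)

lemma ideal_T1: "ideal T1_ideal free_algebra"
  unfolding T1_ideal_def by (rule ring.genideal_ideal[OF ring_free_algebra]) simp

lemma relators_subset: "T1_relators \<subseteq> T1_ideal"
  unfolding T1_ideal_relators by (rule ring.genideal_self[OF ring_free_algebra]) simp

lemma T1_ideal_closed:
  "0 \<in> T1_ideal"
  "a \<in> T1_ideal \<Longrightarrow> b \<in> T1_ideal \<Longrightarrow> a + b \<in> T1_ideal"
  "a \<in> T1_ideal \<Longrightarrow> - a \<in> T1_ideal"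
  "a \<in> T1_ideal \<Longrightarrow> w * a \<in> T1_ideal"
  "a \<in> T1_ideal \<Longrightarrow> a * w \<in> T1_ideal"
proof -
  interpret ideal T1_ideal free_algebra by (rule ideal_T1)
  show "0 \<in> T1_ideal"
    using additive_subgroup.zero_closed[OF additive_subgroup_axioms] by simp
  show "a \<in> T1_ideal \<Longrightarrow> b \<in> T1_ideal \<Longrightarrow> a + b \<in> T1_ideal"
    using additive_subgroup.a_closed[OF additive_subgroup_axioms, of a b] by simp
  show "a \<in> T1_ideal \<Longrightarrow> - a \<in> T1_ideal"
    using I_l_closed[of a "- 1"] by simp
  show "a \<in> T1_ideal \<Longrightarrow> w * a \<in> T1_ideal" "a \<in> T1_ideal \<Longrightarrow> a * w \<in> T1_ideal"
    using I_l_closed[of a w] I_r_closed[of a w] by simp_all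
qed

lemma T1_ideal_diff: "a \<in> T1_ideal \<Longrightarrow> b \<in> T1_ideal \<Longrightarrow> a - b \<in> T1_ideal"
  using T1_ideal_closed(2)[OF _ T1_ideal_closed(3), of a b] by simp

lemma T1_ideal_minimal:
  assumes "ideal J free_algebra" "T1_relators \<subseteq> J"
  shows "T1_ideal \<subseteq> J"
  unfolding T1_ideal_relators by (rule ring.genideal_minimal[OF ring_free_algebra assms])

locale T1_action = word_action sc g
  for sc :: "'f::field \<Rightarrow> 'm::ab_group_add \<Rightarrow> 'm" and g :: "gen \<Rightarrow> 'm \<Rightarrow> 'm" +
  assumes rel13: "g G1 (g G3 m) = g G3 (g G1 m) - g G3 m - (g G2 m + g G2 m)"
    and rel23: "g G2 (g G3 m) = g G3 (g G2 m) - g G3 (g G3 m) + (m + m + m + m)"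
    and rel12: "g G1 (g G2 m) = g G2 (g G1 m) - (g G3 (g G1 m) + g G3 (g G1 m)) +
      (g G2 m + g G2 m + g G2 m) + (g G3 m + g G3 m)"
begin

lemma act_relator:
  assumes "w \<in> T1_relators"
  shows "act w m = 0"
  using assms
  by (auto simp: T1_relators_def act_diff_left act_add_left act_mult
      power2_eq_square rel13 rel23 rel12 mult.assoc g_add)

text \<open>The annihilator of the whole module is a two-sided ideal and contains the relators. The
  annihilator of a single vector would only be a left ideal, hence the quantifier over m inside the
  set.\<close>

lemma act_T1_ideal:
  assumes "w \<in> T1_ideal"
  shows "act w m = 0"
proof -
  have "ideal {w. \<forall>m. act w m = 0} free_algebra"
  proof (rule idealI[OF ring_free_algebra])
    interpret ring "free_algebra :: ('f, gen word \<Rightarrow>\<^sub>0 'f) module" by (rule ring_free_algebra)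
    show "subgroup {w. \<forall>m. act w m = 0} (add_monoid free_algebra)"
      by (intro add.subgroupI) (auto simp: act_add_left act_minus_left intro: exI[of _ 0])
  qed (simp_all add: act_mult)
  then show ?thesis
    using T1_ideal_minimal[of "{w. \<forall>m. act w m = 0}"] act_relator assms by blast
qed

end

section \<open>The action on \<open>S\<^sub>1\<close>\<close>

abbreviation S1_smult :: "'f::field \<Rightarrow> (int \<Rightarrow>\<^sub>0 'f poly) \<Rightarrow> (int \<Rightarrow>\<^sub>0 'f poly)" where
  "S1_smult c \<equiv> Poly_Mapping.map (Polynomial.smult c)"

lemma lookup_S1_smult [simp]:
  "Poly_Mapping.lookup (S1_smult c f) i = Polynomial.smult c (Poly_Mapping.lookup f i)"
  by (simp add: Poly_Mapping.map.rep_eq when_def)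

lemma S1_smult_single: "S1_smult c (Poly_Mapping.single i a) = Poly_Mapping.single i (Polynomial.smult c a)"
  by (rule poly_mapping_eqI) (simp add: lookup_single when_def)

lemma S1_smult_0: "S1_smult c 0 = 0"
  by (rule poly_mapping_eqI) simp

lemma S1_smult_mult_left: "S1_mult (S1_smult c f) h = S1_smult c (S1_mult f h)"
proof (induction f rule: poly_mapping_add_induct)
  case (single i a)
  show ?case
    by (induction h rule: poly_mapping_add_induct)
       (simp_all add: S1_mult_add_right map_smult_add S1_smult_single S1_mult_single S1_smult_0)
qed (simp_all add: S1_mult_add_left map_smult_add S1_smult_0)

lemma S1_smult_mult_right: "S1_mult f (S1_smult c h) = S1_smult c (S1_mult f h)"
proof (induction f rule: poly_mapping_add_induct)
  case (single i a)
  show ?case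
    by (induction h rule: poly_mapping_add_induct)
       (simp_all add: S1_mult_add_right map_smult_add S1_smult_single S1_mult_single S1_smult_0
          pcompose_smult)
qed (simp_all add: S1_mult_add_left map_smult_add S1_smult_0)


text \<open>These are y^2, y (x - 1/x) and x + 1/x, with coefficients in F[y] to the left of the
  powers of x; each is fixed under x to 1/x, y to -y.\<close>

primrec S1_gen :: "gen \<Rightarrow> (int \<Rightarrow>\<^sub>0 'f::field poly)" where
  "S1_gen G1 = Poly_Mapping.single 0 [:0, 0, 1:]"
| "S1_gen G2 = Poly_Mapping.single 1 [:0, 1:] + Poly_Mapping.single (- 1) [:0, - 1:]"
| "S1_gen G3 = Poly_Mapping.single 1 1 + Poly_Mapping.single (- 1) 1"

text \<open>Both sides are explicit Laurent polynomials, so comparing coefficients leaves identities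
  in F[y], in which moving x^i past q(y) has produced q(y + i).\<close>

lemma S1_gen_relations:
  fixes e :: "gen \<Rightarrow> (int \<Rightarrow>\<^sub>0 'f::field poly)"
  defines "e \<equiv> S1_gen"
  shows "S1_mult (e G1) (e G3) = S1_mult (e G3) (e G1) - e G3 - (e G2 + e G2)"
    and "S1_mult (e G2) (e G3) = S1_mult (e G3) (e G2) - S1_mult (e G3) (e G3) + (1 + 1 + 1 + 1)"
    and "S1_mult (e G1) (e G2) = S1_mult (e G2) (e G1) - (S1_mult (e G3) (e G1) + S1_mult (e G3) (e G1)) +
      (e G2 + e G2 + e G2) + (e G3 + e G3)"
  unfolding e_def
  by (rule poly_mapping_eqI, unfold S1_gen.simps S1_mult_add_left S1_mult_add_right S1_mult_single lookup_add
     lookup_minus lookup_single lookup_one, simp add: when_def pcompose_pCons pcompose_1 one_pCons numeral_poly)+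

lemma S1_mult_diff_left: "S1_mult (f - g) h = S1_mult f h - S1_mult g h"
  using S1_mult_add_left[of "f - g" g h] by simp

interpretation S1: T1_action S1_smult "\<lambda>x. S1_mult (S1_gen x)"
proof
  fix m :: "int \<Rightarrow>\<^sub>0 'f::field poly"
  \<comment> \<open>Multiplying an identity of elements by m on the right makes it an identity of
    left multiplication operators.\<close>
  have "S1_mult m' m = S1_mult m'' m" if "m' = m''" for m' m'' :: "int \<Rightarrow>\<^sub>0 'f poly"
    using that by simp
  note rels = S1_gen_relations[THEN this]
  show "S1_mult (S1_gen G1) (S1_mult (S1_gen G3) m) = S1_mult (S1_gen G3) (S1_mult (S1_gen G1) m)
      - S1_mult (S1_gen G3) m - (S1_mult (S1_gen G2) m + S1_mult (S1_gen G2) m)"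
    using rels(1) by (simp only: S1_mult_add_left S1_mult_diff_left S1_mult_assoc)
  show "S1_mult (S1_gen G2) (S1_mult (S1_gen G3) m) = S1_mult (S1_gen G3) (S1_mult (S1_gen G2) m)
      - S1_mult (S1_gen G3) (S1_mult (S1_gen G3) m) + (m + m + m + m)"
    using rels(2) by (simp only: S1_mult_add_left S1_mult_diff_left S1_mult_assoc S1_mult_1)
  show "S1_mult (S1_gen G1) (S1_mult (S1_gen G2) m) = S1_mult (S1_gen G2) (S1_mult (S1_gen G1) m)
      - (S1_mult (S1_gen G3) (S1_mult (S1_gen G1) m) + S1_mult (S1_gen G3) (S1_mult (S1_gen G1) m)) +
      (S1_mult (S1_gen G2) m + S1_mult (S1_gen G2) m + S1_mult (S1_gen G2) m) +
      (S1_mult (S1_gen G3) m + S1_mult (S1_gen G3) m)"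
    using rels(3) by (simp only: S1_mult_add_left S1_mult_diff_left S1_mult_assoc)
qed (auto simp: map_smult_add S1_smult_mult_right S1_mult_add_right lookup_add smult_add_left
  intro!: poly_mapping_eqI)

text \<open>The class \<open>ring_1\<close> demands that 0 and 1 differ, so the quotient must be
  known to be nonzero before it can become a type of that class. The action on S_1 shows this in
  every characteristic.\<close>

lemma one_notin_T1_ideal: "(1 :: gen word \<Rightarrow>\<^sub>0 'f::field) \<notin> T1_ideal"
proof
  assume "(1 :: gen word \<Rightarrow>\<^sub>0 'f) \<in> T1_ideal"
  then have "(1 :: int \<Rightarrow>\<^sub>0 'f poly) = 0"
    using S1.act_T1_ideal[of 1 "1 :: int \<Rightarrow>\<^sub>0 'f poly"] by simp
  then show False by simp
qed

\<comment> \<open>As a type of class \<open>ring_1\<close> the algebra admits ordinary ring notation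
  and simplification. The record \<open>T1\<close> of cosets is connected to it afterwards by the
  map \<open>coset\<close>.\<close>
quotient_type (overloaded) 'f t1 = "gen word \<Rightarrow>\<^sub>0 'f::field" / "\<lambda>a b. a - b \<in> T1_ideal"
proof (rule equivpI)
  show "reflp (\<lambda>a b. a - b \<in> (T1_ideal :: (gen word \<Rightarrow>\<^sub>0 'f) set))"
    by (simp add: reflp_def T1_ideal_closed(1))
  show "symp (\<lambda>a b. a - b \<in> (T1_ideal :: (gen word \<Rightarrow>\<^sub>0 'f) set))"
  proof (rule sympI)
    fix a b :: "gen word \<Rightarrow>\<^sub>0 'f" assume "a - b \<in> T1_ideal"
    then show "b - a \<in> T1_ideal" using T1_ideal_closed(3)[of "a - b"] by simp
  qed
  show "transp (\<lambda>a b. a - b \<in> (T1_ideal :: (gen word \<Rightarrow>\<^sub>0 'f) set))"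
  proof (rule transpI)
    fix a b c :: "gen word \<Rightarrow>\<^sub>0 'f" assume "a - b \<in> T1_ideal" "b - c \<in> T1_ideal"
    then show "a - c \<in> T1_ideal" using T1_ideal_closed(2)[of "a - b" "b - c"] by simp
  qed
qed

instantiation t1 :: (field) ring_1
begin

lift_definition zero_t1 :: "'a t1" is 0 .
lift_definition one_t1 :: "'a t1" is 1 .
lift_definition plus_t1 :: "'a t1 \<Rightarrow> 'a t1 \<Rightarrow> 'a t1" is "(+)"
proof -
  fix a b c d :: "gen word \<Rightarrow>\<^sub>0 'a"
  assume "a - b \<in> T1_ideal" "c - d \<in> T1_ideal"
  then have "(a - b) + (c - d) \<in> T1_ideal" by (rule T1_ideal_closed)
  then show "a + c - (b + d) \<in> T1_ideal" by (simp add: algebra_simps)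
qed
lift_definition minus_t1 :: "'a t1 \<Rightarrow> 'a t1 \<Rightarrow> 'a t1" is "(-)"
proof -
  fix a b c d :: "gen word \<Rightarrow>\<^sub>0 'a"
  assume "a - b \<in> T1_ideal" "c - d \<in> T1_ideal"
  then have "(a - b) - (c - d) \<in> T1_ideal" by (rule T1_ideal_diff)
  then show "a - c - (b - d) \<in> T1_ideal" by (simp add: algebra_simps)
qed
lift_definition uminus_t1 :: "'a t1 \<Rightarrow> 'a t1" is uminus
proof -
  fix a b :: "gen word \<Rightarrow>\<^sub>0 'a"
  assume "a - b \<in> T1_ideal"
  then show "- a - - b \<in> T1_ideal" using T1_ideal_closed(3)[of "a - b"] by (simp add: algebra_simps)
qed
lift_definition times_t1 :: "'a t1 \<Rightarrow> 'a t1 \<Rightarrow> 'a t1" is "(*)"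
proof -
  fix a b c d :: "gen word \<Rightarrow>\<^sub>0 'a"
  assume "a - b \<in> T1_ideal" "c - d \<in> T1_ideal"
  then have "(a - b) * c + b * (c - d) \<in> T1_ideal" by (simp add: T1_ideal_closed)
  then show "a * c - b * d \<in> T1_ideal" by (simp add: algebra_simps)
qed

instance
proof
  fix a b c :: "'a t1"
  have z: "(0 :: gen word \<Rightarrow>\<^sub>0 'a) \<in> T1_ideal" by (rule T1_ideal_closed)
  show "a + b + c = a + (b + c)" "a + b = b + a" "0 + a = a" "- a + a = 0" "a - b = a + - b"
    "a * b * c = a * (b * c)" "1 * a = a" "a * 1 = a"
    "(a + b) * c = a * c + b * c" "a * (b + c) = a * b + a * c"
    by (transfer; simp add: z algebra_simps)+
  show "(0::'a t1) \<noteq> 1"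
  proof
    assume "(0::'a t1) = 1"
    then have "(0 - 1 :: gen word \<Rightarrow>\<^sub>0 'a) \<in> T1_ideal" by transfer
    then show False
      using T1_ideal_closed(3)[of "0 - 1 :: gen word \<Rightarrow>\<^sub>0 'a"] one_notin_T1_ideal[where 'f = 'a] by simp
  qed
qed

end

lemma abs_t1_eq_iff: "abs_t1 v = abs_t1 w \<longleftrightarrow> v - w \<in> T1_ideal"
  by (rule t1.abs_eq_iff)

lemmas abs_t1_hom = zero_t1.abs_eq[symmetric] one_t1.abs_eq[symmetric] plus_t1.abs_eq[symmetric]
  minus_t1.abs_eq[symmetric] uminus_t1.abs_eq[symmetric] times_t1.abs_eq[symmetric]

lemma abs_t1_numeral: "abs_t1 (numeral n) = (numeral n :: 'f::field t1)"
  by (induction n) (simp_all only: numeral.simps abs_t1_hom)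

lemma abs_t1_power: "abs_t1 (w ^ n) = (abs_t1 w) ^ n"
  by (induction n) (simp_all add: abs_t1_hom)

lemma rep_t1_diff: "rep_t1 (abs_t1 w) - w \<in> T1_ideal"
  using Quotient_abs_rep[OF Quotient_t1, of "abs_t1 w"] by (simp only: abs_t1_eq_iff)

lemma t1_exhaust:
  obtains w where "q = abs_t1 w"
  using Quotient_abs_rep[OF Quotient_t1, of q] by metis

definition t1_gen :: "gen \<Rightarrow> 'f::field t1" where
  "t1_gen x = abs_t1 (free_gen x)"

abbreviation "x1 \<equiv> t1_gen G1"
abbreviation "x2 \<equiv> t1_gen G2"
abbreviation "x3 \<equiv> t1_gen G3"

definition t1_scalar :: "'f::field \<Rightarrow> 'f t1" where
  "t1_scalar c = abs_t1 (Poly_Mapping.single 0 c)"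

definition t1_p :: "'f::field t1" where
  "t1_p = (4 - x3 ^ 2) * x1 + x2 ^ 2 + 3 * x3 * x2 + x3 ^ 2 + 4"

lemma t1_relator:
  assumes "w - v \<in> T1_relators"
  shows "abs_t1 w = (abs_t1 v :: 'f::field t1)"
  using assms relators_subset by (auto simp: abs_t1_eq_iff)

lemma rel13: "x1 * x3 = x3 * x1 - x3 - 2 * (x2 :: 'f::field t1)"
  and rel23: "x2 * x3 = x3 * x2 - x3 ^ 2 + (4 :: 'f t1)"
  and rel12: "x1 * x2 = x2 * x1 - 2 * x3 * x1 + 3 * x2 + 2 * (x3 :: 'f t1)"
  unfolding t1_gen_def abs_t1_numeral[symmetric] times_t1.abs_eq minus_t1.abs_eq plus_t1.abs_eq
    abs_t1_power[symmetric]
  by (rule t1_relator; simp add: T1_relators_def)+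

lemma t1_scalar_additive: "t1_scalar (a + b) = t1_scalar a + t1_scalar b"
  by (simp add: t1_scalar_def abs_t1_hom[symmetric] single_add)

lemma t1_scalar_mult: "t1_scalar (a * b) = t1_scalar a * t1_scalar b"
  by (simp add: t1_scalar_def abs_t1_hom[symmetric] mult_single)

lemma t1_scalar_1 [simp]: "t1_scalar 1 = 1"
  by (simp add: t1_scalar_def abs_t1_hom)

lemma single_zero_word_commute:
  "w * Poly_Mapping.single (0 :: 'x word) c = Poly_Mapping.single 0 (c :: 'f::field) * w"
  by (induction w rule: poly_mapping_add_induct)
     (simp_all add: distrib_left distrib_right mult_single mult.commute)

lemma t1_scalar_commute: "q * t1_scalar c = t1_scalar c * q"
  by (cases q rule: t1_exhaust) (simp add: t1_scalar_def abs_t1_hom[symmetric] single_zero_word_commute)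

text \<open>Every element is a sum of words with scalar coefficients, and a word grows from a scalar
  by left multiplication with generators.\<close>

lemma t1_induct [case_names scalar add gen]:
  fixes q :: "'f::field t1"
  assumes scalar: "\<And>c. P (t1_scalar c)"
    and add: "\<And>q r. P q \<Longrightarrow> P r \<Longrightarrow> P (q + r)"
    and gen: "\<And>x q. P q \<Longrightarrow> P (t1_gen x * q)"
  shows "P q"
proof (induction q rule: t1.abs_induct)
  case (1 w)
  show ?case
  proof (induction w rule: poly_mapping_add_induct)
    case zero
    show ?case using scalar[of 0] by (simp add: t1_scalar_def)
  next
    case (single k c)
    have "P (abs_t1 (Poly_Mapping.single (Word l) c))" for l
    proof (induction l)
      case Nil
      show ?case using scalar[of c] by (simp add: t1_scalar_def zero_word_def)
    next
      case (Cons x l)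
      have "Poly_Mapping.single (Word (x # l)) c = free_gen x * Poly_Mapping.single (Word l) c"
        by (simp add: free_gen_def mult_single)
      then show ?case
        using gen[OF Cons, of x] by (simp add: t1_gen_def abs_t1_hom)
    qed
    then show ?case by (cases k) simp
  next
    case (add f g)
    then show ?case using assms(2) by (simp add: abs_t1_hom)
  qed
qed

section \<open>Modules over the quotient algebra\<close>

context T1_action
begin

definition t1_act :: "'f t1 \<Rightarrow> 'm \<Rightarrow> 'm" where
  "t1_act q = act (rep_t1 q)"

lemma t1_act_abs: "t1_act (abs_t1 w) m = act w m"
  using act_T1_ideal[OF rep_t1_diff[of w], of m] by (simp add: t1_act_def act_diff_left)

lemma t1_act_add_left: "t1_act (q + r) m = t1_act q m + t1_act r m"
  by (cases q rule: t1_exhaust; cases r rule: t1_exhaust)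
     (simp add: t1_act_abs act_add_left abs_t1_hom[symmetric])

lemma t1_act_mult: "t1_act (q * r) m = t1_act q (t1_act r m)"
  by (cases q rule: t1_exhaust; cases r rule: t1_exhaust)
     (simp add: t1_act_abs act_mult abs_t1_hom[symmetric])

lemma t1_act_add_right: "t1_act q (m + n) = t1_act q m + t1_act q n"
  by (cases q rule: t1_exhaust) (simp add: t1_act_abs act_add_right)

lemma t1_act_scalar [simp]: "t1_act (t1_scalar c) m = sc c m"
  by (simp add: t1_scalar_def t1_act_abs act_scalar)

lemma t1_act_gen [simp]: "t1_act (t1_gen x) m = g x m"
  by (simp add: t1_gen_def t1_act_abs)

lemma t1_act_1 [simp]: "t1_act 1 m = m"
  using t1_act_scalar[of 1 m] by (simp add: sc_one)

lemma t1_act_0 [simp]: "t1_act 0 m = 0" "t1_act q 0 = 0"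
  using t1_act_add_left[of 0 0 m] t1_act_add_right[of q 0 0] by simp_all

lemma t1_act_diff_left: "t1_act (q - r) m = t1_act q m - t1_act r m"
  using t1_act_add_left[of "q - r" r m] by simp

lemma t1_act_numeral: "t1_act 2 m = m + m" "t1_act 3 m = m + m + m" "t1_act 4 m = m + m + m + m"
  unfolding abs_t1_numeral[symmetric] t1_act_abs by simp_all

lemma t1_act_p: "t1_act t1_p m = (g G1 m + g G1 m + g G1 m + g G1 m) - g G3 (g G3 (g G1 m))
   + g G2 (g G2 m) + (g G3 (g G2 m) + g G3 (g G2 m) + g G3 (g G2 m)) + g G3 (g G3 m) + (m + m + m + m)"
  by (simp add: t1_p_def t1_act_add_left t1_act_diff_left t1_act_mult t1_act_numeral power2_eq_square g_add)

end

section \<open>Ore polynomials in a ring\<close>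

definition ore_eval :: "('c::zero \<Rightarrow> 'r::ring_1) \<Rightarrow> 'r \<Rightarrow> 'c poly \<Rightarrow> 'r" where
  "ore_eval h z p = (\<Sum>i\<le>Polynomial.degree p. h (Polynomial.coeff p i) * z ^ i)"

lemma ore_eval_superset:
  assumes "h 0 = 0" "Polynomial.degree p \<le> n"
  shows "ore_eval h z p = (\<Sum>i\<le>n. h (Polynomial.coeff p i) * z ^ i)"
  unfolding ore_eval_def by (rule sum.mono_neutral_left) (use assms in \<open>auto simp: coeff_eq_0\<close>)

text \<open>Conditions under which the left polynomials in z over the subring \<open>range h\<close>
  form a subring. The map h is only additive: nested ordinary polynomials are used as coefficient
  lists, and their commutative product is unrelated to the product in the target. The twist appears
  as an existential, so that the automorphism may be extracted later from uniqueness.\<close>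

locale ore_ring = additive h for h :: "'c::ab_group_add \<Rightarrow> 'r::ring_1" +
  fixes z :: 'r
  assumes range_1: "1 \<in> range h"
    and range_mult: "a \<in> range h \<Longrightarrow> b \<in> range h \<Longrightarrow> a * b \<in> range h"
    and straighten: "a \<in> range h \<Longrightarrow> \<exists>b\<in>range h. z * a - b * z \<in> range h"
begin

abbreviation ev :: "'c poly \<Rightarrow> 'r" where "ev \<equiv> ore_eval h z"

lemma range_add: "a \<in> range h \<Longrightarrow> b \<in> range h \<Longrightarrow> a + b \<in> range h"
  by (auto simp: add[symmetric])

lemma range_uminus: "a \<in> range h \<Longrightarrow> - a \<in> range h"
  by (auto simp: minus[symmetric])

lemma ev_add: "ev (p + q) = ev p + ev q"
  using degree_add_le_max[of p q]
  by (simp add: ore_eval_superset[where n = "max (Polynomial.degree p) (Polynomial.degree q)"] zero add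
      distrib_right sum.distrib)

sublocale ev: additive ev
  by unfold_locales (rule ev_add)

lemma ev_pCons: "ev (pCons a p) = h a + ev p * z"
proof -
  have "ev (pCons a p) = (\<Sum>i\<le>Suc (Polynomial.degree p). h (Polynomial.coeff (pCons a p) i) * z ^ i)"
    by (rule ore_eval_superset) (simp_all add: zero degree_pCons_le)
  also have "\<dots> = h a + (\<Sum>i\<le>Polynomial.degree p. h (Polynomial.coeff p i) * z ^ i * z)"
    by (subst sum.atMost_Suc_shift) (simp add: mult.assoc power_commutes)
  finally show ?thesis
    by (simp add: ore_eval_def sum_distrib_right)
qed

lemma ev_0 [simp]: "ev 0 = 0"
  by (rule ev.zero)

lemma ev_const: "ev [:a:] = h a"
  by (simp add: ev_pCons)

lemma range_ev_const: "a \<in> range h \<Longrightarrow> a \<in> range ev"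
  by (metis ev_const rangeE rangeI)

lemma range_ev_z: "q \<in> range ev \<Longrightarrow> q * z \<in> range ev"
  using ev_pCons[of 0] by (auto simp: zero) (metis rangeI)

lemma range_ev_add: "a \<in> range ev \<Longrightarrow> b \<in> range ev \<Longrightarrow> a + b \<in> range ev"
  by (auto simp: ev.add[symmetric])

lemma range_ev_diff: "a \<in> range ev \<Longrightarrow> b \<in> range ev \<Longrightarrow> a - b \<in> range ev"
  by (auto simp: ev.diff[symmetric])

lemma range_ev_1: "1 \<in> range ev"
  by (rule range_ev_const[OF range_1])

lemma z_in_range_ev: "z \<in> range ev"
  using range_ev_z[OF range_ev_1] by simp

lemma range_ev_mult_const: "a \<in> range h \<Longrightarrow> a * ev p \<in> range ev"
proof (induction p)
  case (pCons b p)
  have "a * h b \<in> range h" "a * ev p \<in> range ev"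
    using pCons by (auto intro: range_mult)
  then have "a * h b + (a * ev p) * z \<in> range ev"
    using range_ev_add[OF range_ev_const range_ev_z] by blast
  then show ?case by (simp add: ev_pCons algebra_simps)
qed (auto intro: range_eqI[of _ _ 0])

lemma range_ev_mult_z: "z * ev p \<in> range ev"
proof (induction p)
  case (pCons b p)
  obtain c where c: "c \<in> range h" "z * h b - c * z \<in> range h"
    using straighten[of "h b"] by auto
  have "(z * h b - c * z) + c * z + (z * ev p) * z \<in> range ev"
    by (intro range_ev_add range_ev_z) (use c pCons.IH range_ev_const in auto)
  then show ?case by (simp add: ev_pCons algebra_simps)
qed (auto intro: range_eqI[of _ _ 0])

text \<open>In (a + P z) Q the factor z is first moved into Q, where z Q is again a left polynomial;
  the induction on the left factor therefore needs Q arbitrary.\<close>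

lemma range_ev_mult:
  assumes "a \<in> range ev" "b \<in> range ev"
  shows "a * b \<in> range ev"
proof -
  have "ev p * ev q \<in> range ev" for p q
  proof (induction p arbitrary: q)
    case (pCons a p)
    obtain r where "z * ev q = ev r" using range_ev_mult_z[of q] by auto
    then have "h a * ev q + ev p * ev r \<in> range ev"
      by (intro range_ev_add range_ev_mult_const pCons.IH) auto
    then show ?case by (simp add: ev_pCons algebra_simps \<open>z * ev q = ev r\<close>)
  qed (auto intro: range_eqI[of _ _ 0])
  then show ?thesis using assms by auto
qed

text \<open>The left polynomials are the subring generated by \<open>range h\<close> and z, so a
  property stable under sums and products need only be checked on these generators.\<close>

lemma range_ev_induct [consumes 1, case_names const z add mult]:
  assumes "b \<in> range ev"
    and "\<And>a. a \<in> range h \<Longrightarrow> P a" "P z"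
    and "\<And>a b. a \<in> range ev \<Longrightarrow> b \<in> range ev \<Longrightarrow> P a \<Longrightarrow> P b \<Longrightarrow> P (a + b)"
    and "\<And>a b. a \<in> range ev \<Longrightarrow> b \<in> range ev \<Longrightarrow> P a \<Longrightarrow> P b \<Longrightarrow> P (a * b)"
  shows "P b"
proof -
  have "P (ev p)" for p
  proof (induction p)
    case 0
    show ?case using assms(2)[of "h 0"] by (simp only: ev_0 zero rangeI[of h 0, unfolded zero])
  next
    case (pCons a p)
    have "P (h a)" "h a \<in> range ev" "P (ev p * z)" "ev p * z \<in> range ev"
      using assms(2)[of "h a"] assms(5)[of "ev p" z] pCons.IH assms(3)
      by (simp_all add: range_ev_const range_ev_z z_in_range_ev)
    then show ?case
      unfolding ev_pCons by (intro assms(4))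
  qed
  then show ?thesis using assms(1) by auto
qed

end

section \<open>The coset ring \<open>T\<^sub>1\<close>\<close>

text \<open>The identification of the type \<open>'f t1\<close> with the carrier of the record
  \<open>T1\<close>; ring operations, powers and finite sums are transported along it.\<close>

definition coset :: "'f::field t1 \<Rightarrow> (gen word \<Rightarrow>\<^sub>0 'f) set" where
  "coset q = T1_of (rep_t1 q)"

lemma T1_of_eq_iff: "T1_of v = T1_of w \<longleftrightarrow> v - w \<in> T1_ideal"
proof
  interpret ideal T1_ideal free_algebra by (rule ideal_T1)
  assume "T1_of v = T1_of w"
  moreover have "v \<in> T1_of v"
    unfolding T1_of_def by (rule a_rcos_self) simp
  ultimately obtain i where "i \<in> T1_ideal" "v = i + w"
    by (auto simp: T1_of_def a_r_coset_def')
  then show "v - w \<in> T1_ideal" by simp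
next
  assume *: "v - w \<in> T1_ideal"
  have "i + v \<in> T1_of w" if "i \<in> T1_ideal" for i
    using T1_ideal_closed(2)[OF that *]
    by (auto simp: T1_of_def a_r_coset_def' intro!: bexI[of _ "i + (v - w)"])
  moreover have "i + w \<in> T1_of v" if "i \<in> T1_ideal" for i
    using T1_ideal_diff[OF that *]
    by (auto simp: T1_of_def a_r_coset_def' intro!: bexI[of _ "i - (v - w)"])
  ultimately show "T1_of v = T1_of w"
    by (auto simp: T1_of_def a_r_coset_def')
qed

lemma coset_abs: "coset (abs_t1 w) = T1_of w"
  unfolding coset_def T1_of_eq_iff by (rule rep_t1_diff)

lemma coset_eq_iff [simp]: "coset q = coset r \<longleftrightarrow> q = r"
  by (cases q rule: t1_exhaust; cases r rule: t1_exhaust) (simp add: coset_abs T1_of_eq_iff abs_t1_eq_iff)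

lemma inj_coset: "inj coset"
  by (rule injI) simp

lemma carrier_T1: "carrier T1 = range coset"
proof -
  have "carrier (T1 :: ('f::field, _) module) = range T1_of"
    by (auto simp: T1_def algebra_quotient_def FactRing_def A_RCOSETS_def' T1_of_def)
  also have "\<dots> = range coset"
    by (metis coset_abs coset_def image_cong rangeI image_subset_iff subset_antisym)
  finally show ?thesis .
qed

lemma T1_mult: "coset q \<otimes>\<^bsub>T1\<^esub> coset r = coset (q * r)"
proof -
  interpret ideal T1_ideal free_algebra by (rule ideal_T1)
  show ?thesis
    by (cases q rule: t1_exhaust; cases r rule: t1_exhaust)
       (use rcoset_mult_add in \<open>simp add: coset_abs abs_t1_hom[symmetric] T1_of_def T1_def
          algebra_quotient_def FactRing_def\<close>)
qed

lemma T1_add: "coset q \<oplus>\<^bsub>T1\<^esub> coset r = coset (q + r)"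
proof -
  interpret ideal T1_ideal free_algebra by (rule ideal_T1)
  show ?thesis
    by (cases q rule: t1_exhaust; cases r rule: t1_exhaust)
       (use a_rcos_sum in \<open>simp add: coset_abs abs_t1_hom[symmetric] T1_of_def T1_def
          algebra_quotient_def FactRing_def\<close>)
qed

lemma T1_one: "\<one>\<^bsub>T1\<^esub> = coset 1"
  by (simp add: abs_t1_hom[symmetric] coset_abs T1_of_def T1_def algebra_quotient_def FactRing_def
      one_t1.abs_eq)

lemma T1_of_0: "T1_of 0 = T1_ideal"
  by (auto simp: T1_of_def a_r_coset_def')

lemma T1_zero: "\<zero>\<^bsub>T1\<^esub> = coset 0"
  by (simp add: zero_t1.abs_eq coset_abs T1_of_0 T1_def algebra_quotient_def FactRing_def)

lemma T1_smult: "c \<odot>\<^bsub>T1\<^esub> coset q = coset (t1_scalar c * q)"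
proof (cases q rule: t1_exhaust)
  case (1 w)
  \<comment> \<open>Scalar multiplication in the quotient is a union over all representatives; it
    collapses to one coset because the ideal absorbs scalars.\<close>
  have "T1_of (Poly_Mapping.single 0 c * v) = T1_of (Poly_Mapping.single 0 c * w)" if "v \<in> T1_of w" for v
  proof -
    from that have "v - w \<in> T1_ideal"
      by (auto simp: T1_of_def a_r_coset_def')
    then show ?thesis
      using T1_ideal_closed(4) by (auto simp: T1_of_eq_iff right_diff_distrib[symmetric])
  qed
  moreover have "w \<in> T1_of w"
    using T1_ideal_closed(1) by (auto simp: T1_of_def a_r_coset_def' intro: bexI[of _ 0])
  ultimately have "(\<Union>v\<in>T1_of w. T1_of (Poly_Mapping.single 0 c * v)) = T1_of (Poly_Mapping.single 0 c * w)"
    by blast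
  then show ?thesis
    by (simp add: 1 t1_scalar_def coset_abs abs_t1_hom[symmetric])
       (simp add: T1_def algebra_quotient_def T1_of_def)
qed

lemma ring_T1: "ring (T1 :: ('f::field, _) module)"
proof (rule ringI)
  show "abelian_group (T1 :: ('f, _) module)"
  proof (rule abelian_groupI)
    fix a :: "(gen word \<Rightarrow>\<^sub>0 'f) set" assume "a \<in> carrier T1"
    then obtain q where "a = coset q" by (auto simp: carrier_T1)
    then show "\<exists>b\<in>carrier T1. b \<oplus>\<^bsub>T1\<^esub> a = \<zero>\<^bsub>T1\<^esub>"
      by (auto simp: carrier_T1 T1_add T1_zero intro: exI[of _ "- q"])
  qed (auto simp: carrier_T1 T1_add T1_zero algebra_simps)
  show "Group.monoid (T1 :: ('f, _) module)"
    by (rule monoidI) (auto simp: carrier_T1 T1_mult T1_one mult.assoc)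
qed (auto simp: carrier_T1 T1_add T1_mult distrib_left distrib_right)

lemma T1_of_gen: "T1_of (free_gen x) = coset (t1_gen x)"
  by (simp add: t1_gen_def coset_abs)

lemma T1_scalar_eq: "T1_scalar c = coset (t1_scalar c)"
  by (simp add: T1_scalar_def T1_one T1_smult)

lemma T1_p_eq: "T1_p = coset t1_p"
  unfolding T1_p_def coset_abs[symmetric] t1_p_def t1_gen_def
  by (simp only: abs_t1_hom abs_t1_power abs_t1_numeral)

section \<open>Skew polynomial structures in \<open>T\<^sub>1\<close>\<close>

lemma subring_T1:
  assumes "1 \<in> R" "R \<subseteq> R'" "\<And>a. a \<in> R \<Longrightarrow> - a \<in> R" "\<And>a b. a \<in> R \<Longrightarrow> b \<in> R \<Longrightarrow> a + b \<in> R"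
    "\<And>a b. a \<in> R \<Longrightarrow> b \<in> R \<Longrightarrow> a * b \<in> R" "ring (T1\<lparr>carrier := coset ` R'\<rparr>)"
  shows "subring (coset ` R) (T1\<lparr>carrier := coset ` R'\<rparr> :: ('f::field, _) module)"
proof -
  let ?S = "T1\<lparr>carrier := coset ` R'\<rparr> :: ('f, _) module"
  interpret ring ?S by (rule assms(6))
  show ?thesis
  proof (rule subringI)
    fix h assume "h \<in> coset ` R"
    then obtain q where q: "h = coset q" "q \<in> R" by auto
    have "\<ominus>\<^bsub>?S\<^esub> h = coset (- q)"
      by (rule minus_equality) (use q assms(2,3) in \<open>auto simp: T1_add T1_zero\<close>)
    then show "\<ominus>\<^bsub>?S\<^esub> h \<in> coset ` R" using q assms(3) by simp
  qed (use assms in \<open>auto simp: T1_one T1_mult T1_add\<close>)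
qed

lemma T1_carrier_UNIV: "T1\<lparr>carrier := range coset\<rparr> = T1"
  by (simp add: carrier_T1[symmetric])

lemma subset_closed_under_diff:
  fixes R :: "'a::ab_group_add set"
  assumes "u \<in> R" "\<And>a b. a \<in> R \<Longrightarrow> b \<in> R \<Longrightarrow> a - b \<in> R"
  shows "a \<in> R \<Longrightarrow> - a \<in> R" "a \<in> R \<Longrightarrow> b \<in> R \<Longrightarrow> a + b \<in> R"
proof -
  have m: "- a \<in> R" if "a \<in> R" for a
    using assms(2)[OF assms(2)[OF that that] that] by simp
  then show "a \<in> R \<Longrightarrow> - a \<in> R" .
  show "a \<in> R \<Longrightarrow> b \<in> R \<Longrightarrow> a + b \<in> R"
    using assms(2)[of a "- b"] m by simp
qed

lemma ring_T1_coset: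
  assumes "1 \<in> R" "\<And>a b. a \<in> R \<Longrightarrow> b \<in> R \<Longrightarrow> a - b \<in> R" "\<And>a b. a \<in> R \<Longrightarrow> b \<in> R \<Longrightarrow> a * b \<in> R"
  shows "ring (T1\<lparr>carrier := coset ` R\<rparr> :: ('f::field, _) module)"
proof -
  have "subring (coset ` R) (T1\<lparr>carrier := range coset\<rparr>)"
    by (rule subring_T1)
       (use assms subset_closed_under_diff[OF assms(1,2)] in \<open>auto simp: T1_carrier_UNIV ring_T1\<close>)
  then show ?thesis
    by (simp add: T1_carrier_UNIV ring.subring_is_ring[OF ring_T1])
qed

lemma T1_sub_pow:
  fixes R :: "'f::field t1 set"
  assumes "ring (T1\<lparr>carrier := coset ` R\<rparr>)"
  shows "coset q [^]\<^bsub>T1\<lparr>carrier := coset ` R\<rparr>\<^esub> (n :: nat) = coset (q ^ n)"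
proof -
  interpret ring "T1\<lparr>carrier := coset ` R\<rparr>" by (rule assms)
  show ?thesis
    by (induction n) (simp_all add: T1_one T1_mult power_commutes)
qed

lemma T1_sub_finsum:
  fixes R :: "'f::field t1 set"
  assumes "ring (T1\<lparr>carrier := coset ` R\<rparr>)" "finite A" "\<And>n. n \<in> A \<Longrightarrow> f n \<in> R"
  shows "(\<Oplus>\<^bsub>T1\<lparr>carrier := coset ` R\<rparr>\<^esub>n\<in>A. coset (f n)) = coset (sum f A)"
proof -
  interpret ring "T1\<lparr>carrier := coset ` R\<rparr>" by (rule assms)
  show ?thesis using assms(2,3)
  proof (induction A rule: finite_induct)
    case (insert x A)
    then show ?case
      by (subst finsum_insert) (auto simp: T1_add)
  qed (simp add: T1_zero)
qed

lemma (in ore_ring) range_ev_power: "z ^ n \<in> range ev"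
  by (induction n) (auto intro: range_ev_1 range_ev_mult z_in_range_ev)

lemma (in additive) zero_iff: "inj f \<Longrightarrow> f a = 0 \<longleftrightarrow> a = 0"
  using inj_eq[of f a 0] by (simp add: zero)

text \<open>Transfers a skew polynomial structure from the type to the record of cosets. Existence
  of an expansion is membership in the range of \<open>ore_eval\<close>, uniqueness is its
  injectivity. The maps \<sigma>' and \<delta>' act on cosets and are tied to \<sigma> and \<delta>
  only on the coefficient ring.\<close>

lemma is_skew_polynomial_ring_T1:
  fixes h :: "'c::ab_group_add \<Rightarrow> 'f::field t1" and z :: "'f t1"
  assumes ore: "ore_ring h z" and inj: "inj h" "inj (ore_eval h z)"
    and \<sigma>': "\<And>r. r \<in> range h \<Longrightarrow> \<sigma>' (coset r) = coset (\<sigma> r)"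
    and \<delta>': "\<And>r. r \<in> range h \<Longrightarrow> \<delta>' (coset r) = coset (\<delta> r)"
    and \<sigma>: "bij_betw \<sigma> (range h) (range h)" "\<sigma> 1 = 1"
      "\<And>r s. r \<in> range h \<Longrightarrow> s \<in> range h \<Longrightarrow> \<sigma> (r + s) = \<sigma> r + \<sigma> s"
      "\<And>r s. r \<in> range h \<Longrightarrow> s \<in> range h \<Longrightarrow> \<sigma> (r * s) = \<sigma> r * \<sigma> s"
    and \<delta>: "\<And>r. r \<in> range h \<Longrightarrow> \<delta> r \<in> range h"
      "\<And>r s. r \<in> range h \<Longrightarrow> s \<in> range h \<Longrightarrow> \<delta> (r + s) = \<delta> r + \<delta> s"
      "\<And>r s. r \<in> range h \<Longrightarrow> s \<in> range h \<Longrightarrow> \<delta> (r * s) = \<sigma> r * \<delta> s + \<delta> r * s"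
    and comm: "\<And>r. r \<in> range h \<Longrightarrow> z * r = \<sigma> r * z + \<delta> r"
  shows "is_skew_polynomial_ring (T1\<lparr>carrier := coset ` range (ore_eval h z)\<rparr>) (coset ` range h)
    (coset z) \<sigma>' \<delta>'"
proof -
  interpret ore_ring h z by (rule ore)
  define S :: "('f, (gen word \<Rightarrow>\<^sub>0 'f) set) module" where "S = T1\<lparr>carrier := coset ` range ev\<rparr>"
  have carrier_S: "carrier S = coset ` range ev" by (simp add: S_def)
  have S_simps [simp]: "coset a \<otimes>\<^bsub>S\<^esub> coset b = coset (a * b)" "coset a \<oplus>\<^bsub>S\<^esub> coset b = coset (a + b)"
    "\<zero>\<^bsub>S\<^esub> = coset 0" "\<one>\<^bsub>S\<^esub> = coset 1" for a b
    by (simp_all add: S_def T1_mult T1_add T1_one T1_zero)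
  have ring_S: "ring S"
    unfolding S_def by (rule ring_T1_coset[OF range_ev_1 range_ev_diff range_ev_mult])
  have sub: "subring (coset ` range h) S"
    unfolding S_def
    by (rule subring_T1[OF range_1 _ range_uminus range_add range_mult ring_S[unfolded S_def]])
       (auto intro: range_ev_const)
  have \<sigma>_range: "\<sigma> r \<in> range h" if "r \<in> range h" for r
    using \<sigma>(1) that by (auto simp: bij_betw_def)
  have "bij_betw \<sigma>' (coset ` range h) (coset ` range h)"
  proof -
    have "inj_on \<sigma>' (coset ` range h)"
      using \<sigma>(1) by (auto simp: bij_betw_def inj_on_def \<sigma>')
    moreover have "\<sigma>' ` coset ` range h = coset ` \<sigma> ` range h"
      by (simp add: image_image \<sigma>')
    ultimately show ?thesis
      using \<sigma>(1) by (simp add: bij_betw_def)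
  qed
  then have iso: "\<sigma>' \<in> ring_iso (S\<lparr>carrier := coset ` range h\<rparr>) (S\<lparr>carrier := coset ` range h\<rparr>)"
    using range_1
    by (auto simp: ring_iso_def ring_hom_def \<sigma>' \<sigma>_range \<sigma> range_mult range_add)
  have der: "skew_derivation (S\<lparr>carrier := coset ` range h\<rparr>) \<sigma>' \<delta>'"
    by (auto simp: skew_derivation_def \<sigma>' \<delta>' \<delta> range_mult range_add)
  have expand: "(\<Oplus>\<^bsub>S\<^esub>n\<in>A. coset (h (b n)) \<otimes>\<^bsub>S\<^esub> (coset z [^]\<^bsub>S\<^esub> n)) = coset (\<Sum>n\<in>A. h (b n) * z ^ n)"
    if "finite A" for A :: "nat set" and b
    unfolding S_def
    by (simp add: T1_sub_pow[OF ring_S[unfolded S_def]] T1_mult)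
       (intro T1_sub_finsum ring_S[unfolded S_def] that range_ev_mult range_ev_power range_ev_const rangeI)
  have unique: "\<exists>!c :: nat \<Rightarrow> _. range c \<subseteq> coset ` range h \<and> finite {n. c n \<noteq> \<zero>\<^bsub>S\<^esub>} \<and>
      s = (\<Oplus>\<^bsub>S\<^esub>n\<in>{n. c n \<noteq> \<zero>\<^bsub>S\<^esub>}. c n \<otimes>\<^bsub>S\<^esub> (coset z [^]\<^bsub>S\<^esub> (n :: nat)))" if s: "s \<in> carrier S" for s
  proof -
    obtain p where p: "s = coset (ev p)" using s by (auto simp: carrier_S)
    define C where "C q n = coset (h (Polynomial.coeff q n))" for q n
    \<comment> \<open>Injectivity of h makes the support of the sequence of cosets equal to the
      support of the polynomial.\<close>
    have supp: "{n. C q n \<noteq> \<zero>\<^bsub>S\<^esub>} = {n. Polynomial.coeff q n \<noteq> 0}" for q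
      by (simp add: C_def zero_iff[OF inj(1)])
    have fin: "finite {n. Polynomial.coeff q n \<noteq> 0}" for q :: "'c poly"
      by (rule finite_subset[of _ "{..Polynomial.degree q}"]) (auto intro: le_degree)
    have eval: "(\<Oplus>\<^bsub>S\<^esub>n\<in>{n. C q n \<noteq> \<zero>\<^bsub>S\<^esub>}. C q n \<otimes>\<^bsub>S\<^esub> (coset z [^]\<^bsub>S\<^esub> n)) = coset (ev q)" for q
    proof -
      have "(\<Sum>n | Polynomial.coeff q n \<noteq> 0. h (Polynomial.coeff q n) * z ^ n) = ev q"
        unfolding ore_eval_def
        by (rule sum.mono_neutral_left) (auto intro: le_degree simp: zero)
      then show ?thesis
        unfolding supp by (simp add: C_def expand[OF fin])
    qed
    show ?thesis
    proof (rule ex1I[of _ "C p"])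
      show "range (C p) \<subseteq> coset ` range h \<and> finite {n. C p n \<noteq> \<zero>\<^bsub>S\<^esub>} \<and>
          s = (\<Oplus>\<^bsub>S\<^esub>n\<in>{n. C p n \<noteq> \<zero>\<^bsub>S\<^esub>}. C p n \<otimes>\<^bsub>S\<^esub> (coset z [^]\<^bsub>S\<^esub> n))"
        unfolding eval unfolding supp using fin p by (auto simp: C_def)
    next
      fix c :: "nat \<Rightarrow> (gen word \<Rightarrow>\<^sub>0 'f) set"
      assume c: "range c \<subseteq> coset ` range h \<and> finite {n. c n \<noteq> \<zero>\<^bsub>S\<^esub>} \<and>
          s = (\<Oplus>\<^bsub>S\<^esub>n\<in>{n. c n \<noteq> \<zero>\<^bsub>S\<^esub>}. c n \<otimes>\<^bsub>S\<^esub> (coset z [^]\<^bsub>S\<^esub> n))"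
      then have "\<forall>n. \<exists>a. c n = coset (h a)" by blast
      then obtain b where b: "\<And>n. c n = coset (h (b n))" by metis
      have "finite {n. b n \<noteq> 0}"
        using c by (simp add: b zero_iff[OF inj(1)])
      \<comment> \<open>A finitely supported sequence is the coefficient sequence of a polynomial,
        so an arbitrary competitor c is \<open>C\<close> of some polynomial with the same
        value.\<close>
      then have "Polynomial.coeff (Abs_poly b) = b"
        by (intro Abs_poly_inverse) (simp add: MOST_iff_cofinite)
      then have cC: "c = C (Abs_poly b)"
        by (auto simp: C_def b)
      then have "s = coset (ev (Abs_poly b))"
        using c eval by simp
      then show "c = C p"
        using p inj(2) cC by (simp add: inj_eq)
    qed
  qed
  show ?thesis
    unfolding is_skew_polynomial_ring_def S_def[symmetric]
  proof (intro conjI ballI)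
    show "coset z \<in> carrier S" using z_in_range_ev by (simp add: carrier_S)
    fix s assume "s \<in> coset ` range h"
    then obtain r where "s = coset r" "r \<in> range h" by blast
    then show "coset z \<otimes>\<^bsub>S\<^esub> s = \<sigma>' s \<otimes>\<^bsub>S\<^esub> coset z \<oplus>\<^bsub>S\<^esub> \<delta>' s"
      by (simp add: \<sigma>' \<delta>' comm)
  qed (fact ring_S sub iso der unique)+
qed

section \<open>Isomorphism theorem for algebras\<close>

lemma algebra_quotient_simps:
  "carrier (A AQuot I) = carrier (A Quot I)"
  "monoid.mult (A AQuot I) = monoid.mult (A Quot I)"
  "one (A AQuot I) = one (A Quot I)"
  "ring.zero (A AQuot I) = ring.zero (A Quot I)"
  "add (A AQuot I) = add (A Quot I)"
  "module.smult (A AQuot I) c C = (\<Union>a\<in>C. I +>\<^bsub>A\<^esub> (c \<odot>\<^bsub>A\<^esub> a))"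
  unfolding algebra_quotient_def
  by (simp_all only: partial_object.select_convs monoid.select_convs ring.select_convs module.select_convs)

text \<open>The two quotients share all ring operations but are records of different types, so the
  ring axioms are carried over one by one.\<close>

lemma ring_algebra_quotient:
  assumes "ring (A Quot I)"
  shows "ring (A AQuot I)"
proof -
  interpret Q: ring "A Quot I" by (rule assms)
  show ?thesis
  proof (rule ringI)
    show "abelian_group (A AQuot I)"
    proof (rule abelian_groupI)
      fix x assume "x \<in> carrier (A AQuot I)"
      then show "\<exists>y\<in>carrier (A AQuot I). y \<oplus>\<^bsub>A AQuot I\<^esub> x = \<zero>\<^bsub>A AQuot I\<^esub>"
        using Q.l_neg[of x] Q.a_inv_closed[of x] by (auto simp: algebra_quotient_simps)
    qed (simp_all add: algebra_quotient_simps Q.a_ac)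
    show "Group.monoid (A AQuot I)"
      by (rule monoidI) (simp_all add: algebra_quotient_simps Q.m_assoc)
  qed (simp_all add: algebra_quotient_simps Q.l_distr Q.r_distr)
qed

locale algebra_surjection = ring_hom_ring A B h
  for A :: "('f, 'a) module" and B :: "('f, 'b) module" and h +
  assumes surj: "h ` carrier A = carrier B"
    and smult_closed: "a \<in> carrier A \<Longrightarrow> c \<odot>\<^bsub>A\<^esub> a \<in> carrier A"
    and smult_hom: "a \<in> carrier A \<Longrightarrow> h (c \<odot>\<^bsub>A\<^esub> a) = c \<odot>\<^bsub>B\<^esub> h a"
begin

lemma coset_eqI:
  assumes "a \<in> carrier A" "b \<in> carrier A" "h a = h b"
  shows "a_kernel A B h +>\<^bsub>A\<^esub> a = a_kernel A B h +>\<^bsub>A\<^esub> b"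
proof (rule the_elem_inj)
  show "a_kernel A B h +>\<^bsub>A\<^esub> a \<in> carrier (A Quot (a_kernel A B h))" "a_kernel A B h +>\<^bsub>A\<^esub> b \<in> carrier (A Quot (a_kernel A B h))"
    using assms by (auto simp: FactRing_def A_RCOSETS_def')
qed (use assms in simp)

text \<open>Representatives of one coset have the same image under h, and h respects scalars, so
  their scalar multiples lie in one coset as well. Stability of the kernel under scalars is thereby
  obtained from \<open>smult_hom\<close>.\<close>

lemma quotient_smult:
  assumes a: "a \<in> carrier A"
  shows "c \<odot>\<^bsub>A AQuot (a_kernel A B h)\<^esub> (a_kernel A B h +>\<^bsub>A\<^esub> a) = a_kernel A B h +>\<^bsub>A\<^esub> (c \<odot>\<^bsub>A\<^esub> a)"
proof -
  interpret K: ideal "a_kernel A B h" A by (rule kernel_is_ideal)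
  show ?thesis
    unfolding algebra_quotient_simps
  proof (rule SUP_eq_const)
    show "a_kernel A B h +>\<^bsub>A\<^esub> a \<noteq> {}"
      using K.a_rcos_self[OF a] by blast
    fix b assume "b \<in> a_kernel A B h +>\<^bsub>A\<^esub> a"
    then obtain i where i: "i \<in> a_kernel A B h" "b = i \<oplus>\<^bsub>A\<^esub> a"
      unfolding a_r_coset_def' by blast
    then have "i \<in> carrier A" "h i = \<zero>\<^bsub>B\<^esub>"
      unfolding a_kernel_def' by blast+
    with a have "b \<in> carrier A" "h b = h a" unfolding i(2) by simp_all
    with a show "a_kernel A B h +>\<^bsub>A\<^esub> (c \<odot>\<^bsub>A\<^esub> b) = a_kernel A B h +>\<^bsub>A\<^esub> (c \<odot>\<^bsub>A\<^esub> a)"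
      by (intro coset_eqI smult_closed) (simp_all only: smult_hom)
  qed
qed

text \<open>The isomorphism induced by h runs from the quotient to B; the direction wanted here is
  its inverse, which sends h a to the coset of a.\<close>

theorem first_isomorphism: "\<exists>k. k \<in> algebra_iso B (A AQuot (a_kernel A B h))"
proof
  define k where "k C = the_elem (h ` C)" for C
  have iso: "k \<in> ring_iso (A Quot (a_kernel A B h)) B"
    unfolding k_def by (rule FactRing_iso_set[OF surj])
  have inv: "inv_into (carrier (A Quot (a_kernel A B h))) k \<in> ring_iso B (A Quot (a_kernel A B h))"
    by (rule ring_iso_set_sym[OF ideal.quotient_is_ring[OF kernel_is_ideal] iso])
  have inv_h: "inv_into (carrier (A Quot (a_kernel A B h))) k (h a) = a_kernel A B h +>\<^bsub>A\<^esub> a" if "a \<in> carrier A" for a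
  proof -
    have "a_kernel A B h +>\<^bsub>A\<^esub> a \<in> carrier (A Quot (a_kernel A B h))"
      using that by (auto simp: FactRing_def A_RCOSETS_def')
    moreover have "k (a_kernel A B h +>\<^bsub>A\<^esub> a) = h a"
      using that by (simp add: k_def)
    ultimately show ?thesis
      using iso inv_into_f_f[of k "carrier (A Quot (a_kernel A B h))" "a_kernel A B h +>\<^bsub>A\<^esub> a"]
      by (simp add: ring_iso_def bij_betw_def)
  qed
  have "inv_into (carrier (A Quot (a_kernel A B h))) k (c \<odot>\<^bsub>B\<^esub> b) = c \<odot>\<^bsub>A AQuot (a_kernel A B h)\<^esub> inv_into (carrier (A Quot (a_kernel A B h))) k b"
    if b: "b \<in> carrier B" for b c
  proof -
    obtain a where a: "a \<in> carrier A" "b = h a" using b surj by auto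
    show ?thesis
      unfolding a(2) smult_hom[OF a(1), symmetric] inv_h[OF a(1)] inv_h[OF smult_closed[OF a(1)]]
      by (rule quotient_smult[OF a(1), symmetric])
  qed
  moreover have "inv_into (carrier (A Quot (a_kernel A B h))) k \<in> ring_iso B (A AQuot (a_kernel A B h))"
    using inv by (simp add: ring_iso_def ring_hom_def algebra_quotient_simps)
  ultimately show "inv_into (carrier (A Quot (a_kernel A B h))) k \<in> algebra_iso B (A AQuot (a_kernel A B h))"
    by (simp add: algebra_iso_def)
qed

text \<open>The map induced by h is injective and multiplicative, so a vanishing product of cosets
  gives a vanishing product in B.\<close>

lemma nc_domain_quotient:
  assumes "nc_domain B"
  shows "nc_domain (A AQuot (a_kernel A B h))"
proof -
  interpret K: ideal "a_kernel A B h" A by (rule kernel_is_ideal)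
  have zero: "\<zero>\<^bsub>A AQuot (a_kernel A B h)\<^esub> = a_kernel A B h +>\<^bsub>A\<^esub> \<zero>\<^bsub>A\<^esub>"
    using K.a_rcos_const[OF K.zero_closed] by (simp add: algebra_quotient_simps FactRing_def)
  have eq: "a_kernel A B h +>\<^bsub>A\<^esub> a = a_kernel A B h +>\<^bsub>A\<^esub> b \<longleftrightarrow> h a = h b" if "a \<in> carrier A" "b \<in> carrier A" for a b
  proof
    assume "a_kernel A B h +>\<^bsub>A\<^esub> a = a_kernel A B h +>\<^bsub>A\<^esub> b"
    then show "h a = h b"
      using the_elem_simp[OF that(1)] the_elem_simp[OF that(2)] by simp
  qed (rule coset_eqI[OF that])
  show ?thesis
    unfolding nc_domain_def
  proof (intro conjI ballI impI)
    show "ring (A AQuot (a_kernel A B h))"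
      by (rule ring_algebra_quotient[OF K.quotient_is_ring])
    show "\<one>\<^bsub>A AQuot (a_kernel A B h)\<^esub> \<noteq> \<zero>\<^bsub>A AQuot (a_kernel A B h)\<^esub>"
      using assms unfolding zero
      by (simp add: algebra_quotient_simps(3) FactRing_def eq nc_domain_def)
  next
    fix C D
    assume "C \<in> carrier (A AQuot (a_kernel A B h))" "D \<in> carrier (A AQuot (a_kernel A B h))"
      and CD: "C \<otimes>\<^bsub>A AQuot (a_kernel A B h)\<^esub> D = \<zero>\<^bsub>A AQuot (a_kernel A B h)\<^esub>"
    then obtain a b where ab: "a \<in> carrier A" "C = a_kernel A B h +>\<^bsub>A\<^esub> a" "b \<in> carrier A" "D = a_kernel A B h +>\<^bsub>A\<^esub> b"
      by (auto simp: algebra_quotient_simps FactRing_def A_RCOSETS_def')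
    have "C \<otimes>\<^bsub>A AQuot (a_kernel A B h)\<^esub> D = a_kernel A B h +>\<^bsub>A\<^esub> (a \<otimes>\<^bsub>A\<^esub> b)"
      using ab K.rcoset_mult_add by (simp add: algebra_quotient_simps FactRing_def)
    with CD ab have "h a \<otimes>\<^bsub>B\<^esub> h b = \<zero>\<^bsub>B\<^esub>"
      unfolding zero by (simp add: eq)
    then have "h a = \<zero>\<^bsub>B\<^esub> \<or> h b = \<zero>\<^bsub>B\<^esub>"
      using assms ab by (simp add: nc_domain_def)
    then show "C = \<zero>\<^bsub>A AQuot (a_kernel A B h)\<^esub> \<or> D = \<zero>\<^bsub>A AQuot (a_kernel A B h)\<^esub>"
      unfolding zero using ab by (simp add: eq)
  qed
qed

end

section \<open>Ordered monomials span \<open>T\<^sub>1\<close>\<close>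

text \<open>The ranges are F[x_3], the subring generated by x_3 and x_2, and all of T_1. In the
  nested polynomials the outermost variable stands for the rightmost generator.\<close>

abbreviation evA :: "'f::field poly \<Rightarrow> 'f t1" where "evA \<equiv> ore_eval t1_scalar x3"
abbreviation evB :: "'f::field poly poly \<Rightarrow> 'f t1" where "evB \<equiv> ore_eval evA x2"
abbreviation evT :: "'f::field poly poly poly \<Rightarrow> 'f t1" where "evT \<equiv> ore_eval evB x1"

text \<open>The commutator with z is a derivation, so it maps a subring into a larger or equal
  subring as soon as it does so on generators.\<close>

lemma commutator_mult:
  fixes a b z :: "'a::ring"
  shows "z * (a * b) - (a * b) * z = (z * a - a * z) * b + a * (z * b - b * z)"
  by (simp add: algebra_simps)

interpretation A: ore_ring "t1_scalar :: 'f::field \<Rightarrow> 'f t1" x3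
proof
  show "t1_scalar (a + b) = t1_scalar a + t1_scalar b" for a b :: 'f
    by (rule t1_scalar_additive)
  show one: "1 \<in> range t1_scalar"
    by (metis t1_scalar_1 rangeI)
  show "a * b \<in> range t1_scalar" if "a \<in> range t1_scalar" "b \<in> range t1_scalar" for a b :: "'f t1"
    using that by (auto simp: t1_scalar_mult[symmetric])
  show "\<exists>b\<in>range t1_scalar. x3 * a - b * x3 \<in> range t1_scalar" if "a \<in> range t1_scalar" for a :: "'f t1"
  proof (rule bexI[OF _ that])
    have "x3 * a - a * x3 = t1_scalar 0"
      using that t1_scalar_additive[of 0 0] by (auto simp: t1_scalar_commute)
    then show "x3 * a - a * x3 \<in> range t1_scalar" by simp
  qed
qed

lemma A_numeral: "numeral n \<in> range (evA :: 'f::field poly \<Rightarrow> _)"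
proof (induction n)
  case One
  show ?case using A.range_ev_1 by simp
next
  case (Bit0 n)
  show ?case unfolding numeral.simps by (intro A.range_ev_add Bit0)
next
  case (Bit1 n)
  show ?case unfolding numeral.simps by (intro A.range_ev_add A.range_ev_1 Bit1)
qed

lemma x2_commutator_A:
  assumes "a \<in> range evA"
  shows "x2 * a - a * x2 \<in> range (evA :: 'f::field poly \<Rightarrow> _)"
  using assms
proof (induction a rule: A.range_ev_induct)
  case (const a)
  then show ?case
    using A.range_ev_const[of 0] by (auto simp: t1_scalar_commute A.zero intro: range_eqI[of _ _ 0])
next
  case z
  have "x2 * x3 - x3 * x2 = 4 - x3 * (x3 :: 'f t1)"
    by (simp add: rel23 power2_eq_square)
  then show ?case
    by (simp only: A.range_ev_diff A_numeral A.range_ev_mult A.z_in_range_ev)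
next
  case (add a b)
  then have "(x2 * a - a * x2) + (x2 * b - b * x2) \<in> range evA" by (intro A.range_ev_add)
  then show ?case by (simp add: algebra_simps)
next
  case (mult a b)
  then show ?case
    unfolding commutator_mult by (intro A.range_ev_add A.range_ev_mult)
qed

interpretation B: ore_ring "evA :: 'f::field poly \<Rightarrow> 'f t1" x2
  by unfold_locales (use A.range_ev_1 A.range_ev_mult x2_commutator_A in blast)+

lemma A_subset_B: "a \<in> range evA \<Longrightarrow> a \<in> range evB"
  by (rule B.range_ev_const)

lemma x3_in_B: "x3 \<in> range evB"
  by (rule A_subset_B[OF A.z_in_range_ev])

lemma B_numeral: "numeral n \<in> range evB"
  by (rule A_subset_B[OF A_numeral])

lemmas B_closed = B.range_ev_add B.range_ev_diff B.range_ev_mult x3_in_B B.z_in_range_ev B_numeral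

lemma x1_commutator_A:
  assumes "a \<in> range evA"
  shows "x1 * a - a * x1 \<in> range (evB :: 'f::field poly poly \<Rightarrow> _)"
  using assms
proof (induction a rule: A.range_ev_induct)
  case (const a)
  then show ?case
    by (auto simp: t1_scalar_commute intro: range_eqI[of _ _ 0])
next
  case z
  \<comment> \<open>The term -x_3 is written as x_3 - 2 x_3 because the closure rules in
    \<open>B_closed\<close> contain differences but no negation. The occurrence of x_2 shows why x_1
    must be adjoined after x_2.\<close>
  have "x1 * x3 - x3 * x1 = (x3 - 2 * x3) - 2 * (x2 :: 'f t1)"
    by (simp add: rel13 mult_2)
  then show ?case by (simp only: B_closed)
next
  case (add a b)
  then have "(x1 * a - a * x1) + (x1 * b - b * x1) \<in> range evB" by (intro B.range_ev_add)
  then show ?case by (simp add: algebra_simps)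
next
  case (mult a b)
  then show ?case
    unfolding commutator_mult by (simp only: B.range_ev_add B.range_ev_mult A_subset_B)
qed

text \<open>The element b is \<sigma>(a), where \<sigma> fixes x_3 and sends x_2 to x_2 - 2 x_3.
  Products are handled by the twisted Leibniz rule.\<close>

lemma x1_straighten_left:
  assumes "a \<in> range evB"
  shows "\<exists>b\<in>range evB. x1 * a - b * x1 \<in> range (evB :: 'f::field poly poly \<Rightarrow> _)"
  using assms
proof (induction a rule: B.range_ev_induct)
  case (const a)
  then show ?case using x1_commutator_A A_subset_B by blast
next
  case z
  have "x1 * x2 - (x2 - 2 * x3) * x1 = 3 * x2 + 2 * (x3 :: 'f t1)"
    by (simp add: rel12 algebra_simps)
  then show ?case
    by (intro bexI[of _ "x2 - 2 * x3"]) (simp_all only: B_closed)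
next
  case (add a b)
  then obtain a' b' where "a' \<in> range evB" "b' \<in> range evB"
    "x1 * a - a' * x1 \<in> range evB" "x1 * b - b' * x1 \<in> range evB" by blast
  moreover have "x1 * (a + b) - (a' + b') * x1 = (x1 * a - a' * x1) + (x1 * b - b' * x1)"
    by (simp add: algebra_simps)
  ultimately show ?case
    by (intro bexI[of _ "a' + b'"]) (simp_all only: B.range_ev_add)
next
  case (mult a b)
  then obtain a' b' where "a' \<in> range evB" "b' \<in> range evB"
    "x1 * a - a' * x1 \<in> range evB" "x1 * b - b' * x1 \<in> range evB" by blast
  moreover have "x1 * (a * b) - (a' * b') * x1 = (x1 * a - a' * x1) * b + a' * (x1 * b - b' * x1)"
    by (simp add: algebra_simps)
  ultimately show ?case
    using mult by (intro bexI[of _ "a' * b'"]) (simp_all only: B.range_ev_add B.range_ev_mult)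
qed

text \<open>The mirror image, with b the preimage of a under \<sigma>, so that x_2 is met by x_2 + 2
  x_3. It supplies the surjectivity of \<sigma>.\<close>

lemma x1_straighten_right:
  assumes "a \<in> range evB"
  shows "\<exists>b\<in>range evB. a * x1 - x1 * b \<in> range (evB :: 'f::field poly poly \<Rightarrow> _)"
  using assms
proof (induction a rule: B.range_ev_induct)
  case (const a)
  have "a * x1 - x1 * a = (x2 - x2) - (x1 * a - a * x1)" by simp
  also have "\<dots> \<in> range evB"
    using x1_commutator_A[OF const] by (simp only: B_closed)
  finally show ?case using A_subset_B[OF const] by blast
next
  case z
  have "x2 * x1 - x1 * (x2 + 2 * x3) = (x2 :: 'f t1)"
  proof -
    have "(4 :: 'f t1) = 3 + 1" by simp
    then have four: "4 * x2 = 3 * x2 + (x2 :: 'f t1)" by (simp only: distrib_right mult_1)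
    have "x1 * (2 * x3) = 2 * (x1 * (x3 :: 'f t1))"
      by (simp only: mult_2 distrib_left)
    also have "\<dots> = 2 * x3 * x1 - 2 * x3 - 4 * x2"
      by (simp add: rel13 right_diff_distrib mult.assoc)
    finally show ?thesis
      unfolding distrib_left rel12 four by (simp add: algebra_simps)
  qed
  then show ?case
    by (intro bexI[of _ "x2 + 2 * x3"]) (simp_all only: B_closed)
next
  case (add a b)
  then obtain a' b' where "a' \<in> range evB" "b' \<in> range evB"
    "a * x1 - x1 * a' \<in> range evB" "b * x1 - x1 * b' \<in> range evB" by blast
  moreover have "(a + b) * x1 - x1 * (a' + b') = (a * x1 - x1 * a') + (b * x1 - x1 * b')"
    by (simp add: algebra_simps)
  ultimately show ?case
    by (intro bexI[of _ "a' + b'"]) (simp_all only: B.range_ev_add)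
next
  case (mult a b)
  then obtain a' b' where "a' \<in> range evB" "b' \<in> range evB"
    "a * x1 - x1 * a' \<in> range evB" "b * x1 - x1 * b' \<in> range evB" by blast
  moreover have "(a * b) * x1 - x1 * (a' * b') = (a * x1 - x1 * a') * b' + a * (b * x1 - x1 * b')"
    by (simp add: algebra_simps)
  ultimately show ?case
    using mult by (intro bexI[of _ "a' * b'"]) (simp_all only: B.range_ev_add B.range_ev_mult)
qed

interpretation T: ore_ring "evB :: 'f::field poly poly \<Rightarrow> 'f t1" x1
  by unfold_locales (use B.range_ev_1 B.range_ev_mult x1_straighten_left in blast)+

lemma range_evT: "range evT = UNIV"
proof -
  have "q \<in> range evT" for q :: "'f::field t1"
  proof (induction q rule: t1_induct)
    case (scalar c)
    show ?case by (intro T.range_ev_const B.range_ev_const A.range_ev_const rangeI)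
  next
    case (add q r)
    then show ?case by (rule T.range_ev_add)
  next
    case (gen x q)
    have "t1_gen x \<in> range (evT :: 'f poly poly poly \<Rightarrow> _)"
      by (cases x) (simp_all only: T.z_in_range_ev T.range_ev_const x3_in_B B.z_in_range_ev)
    then show ?case using gen by (rule T.range_ev_mult)
  qed
  then show ?thesis by blast
qed

section \<open>A faithful module for \<open>T\<^sub>1\<close>\<close>

text \<open>Applying a derivation to the coefficients is the extension that kills the variable. Used
  twice, it extends a derivation of F[[X]] to F[[X]][b][t].\<close>

lemma map_poly_derivation:
  fixes d :: "'a::comm_ring_1 \<Rightarrow> 'a"
  assumes "\<And>a b. d (a + b) = d a + d b" "\<And>a b. d (a * b) = d a * b + a * d b"
  shows "map_poly d (p + q) = map_poly d p + map_poly d q"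
    and "map_poly d (p * q) = map_poly d p * q + p * map_poly d q"
proof -
  interpret d: additive d by unfold_locales (rule assms)
  show "map_poly d (p + q) = map_poly d p + map_poly d q"
    by (rule poly_eqI) (simp add: coeff_map_poly d.zero d.add)
  show "map_poly d (p * q) = map_poly d p * q + p * map_poly d q"
    by (rule poly_eqI) (simp add: coeff_map_poly d.zero coeff_mult d.sum assms(2) sum.distrib)
qed

text \<open>The inner polynomial variable is b, the outer one is t.\<close>

type_synonym 'f model = "'f fps poly poly"

definition fps_der :: "'f::field fps \<Rightarrow> 'f fps" where
  "fps_der f = (4 - fps_X ^ 2) * fps_deriv f"

definition model_der :: "'f::field model \<Rightarrow> 'f model" where
  "model_der = map_poly (map_poly fps_der)"

lemma fps_der_add: "fps_der (f + g) = fps_der f + fps_der g"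
  and fps_der_mult: "fps_der (f * g) = fps_der f * g + f * fps_der g"
  by (simp_all add: fps_der_def algebra_simps)

lemmas model_der_add = map_poly_derivation(1)[where d = "map_poly fps_der",
    OF map_poly_derivation[OF fps_der_add fps_der_mult], folded model_der_def]
lemmas model_der_mult = map_poly_derivation(2)[where d = "map_poly fps_der",
    OF map_poly_derivation[OF fps_der_add fps_der_mult], folded model_der_def]

interpretation model_der: additive model_der
  by unfold_locales (rule model_der_add)

interpretation fps_der: additive fps_der
  by unfold_locales (rule fps_der_add)

lemma fps_der_1: "fps_der 1 = 0" and fps_der_X: "fps_der fps_X = 4 - fps_X ^ 2"
  and fps_der_const: "fps_der (fps_const c) = 0"
  by (simp_all add: fps_der_def)

definition mC :: "'f::field fps \<Rightarrow> 'f model" where "mC f = [:[:f:]:]"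

lemma mC_hom: "mC (f + g) = mC f + mC g" "mC (f - g) = mC f - mC g" "mC (f * g) = mC f * mC g" "mC 1 = 1"
    "mC 0 = 0" "mC (numeral n) = numeral n"
  by (simp_all add: mC_def one_pCons numeral_poly)

lemma model_der_const: "model_der (mC f) = mC (fps_der f)"
  by (simp add: model_der_def mC_def map_poly_pCons fps_der.zero)

definition mS :: "'f::field model" where "mS = mC fps_X"
definition mU :: "'f::field model" where "mU = mC (4 - fps_X ^ 2)"
definition mV :: "'f::field model" where "mV = mC (inverse (4 - fps_X ^ 2))"
definition mB :: "'f::field model" where "mB = [:[:0, 1:]:]"
definition mT :: "'f::field model" where "mT = [:0, 1:]"

lemma model_der_1 [simp]: "model_der 1 = 0"
  using model_der_const[of 1] by (simp add: fps_der_1 mC_hom)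

lemma model_der_numeral [simp]: "model_der (numeral n) = 0"
  by (induction n) (simp_all only: numeral.simps model_der_add model_der_1 add_0_left)

lemma model_der_S: "model_der mS = mU" and model_der_T: "model_der mT = 0"
  by (simp_all add: mS_def mU_def model_der_const fps_der_X)
     (simp_all add: mT_def model_der_def map_poly_pCons fps_der.zero map_poly_1 fps_der_1)

lemma mU_eq: "mU = 4 - mS * mS"
  by (simp add: mU_def mS_def mC_hom power2_eq_square)

lemma model_der_U: "model_der mU = - (2 * mS * mU)"
  unfolding mU_eq model_der.diff by (simp add: model_der_mult model_der_S mU_eq algebra_simps)

definition model_sc :: "'f::field \<Rightarrow> 'f model \<Rightarrow> 'f model" where
  "model_sc c m = mC (fps_const c) * m"

definition model_x2 :: "'f::field model \<Rightarrow> 'f model" where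
  "model_x2 m = mB * m + model_der m"

primrec model_gen :: "gen \<Rightarrow> 'f::field model \<Rightarrow> 'f model" where
  "model_gen G1 m = mV * (mT * m - model_x2 (model_x2 m) - 3 * mS * model_x2 m - mS * mS * m - 4 * m)"
| "model_gen G2 m = model_x2 m"
| "model_gen G3 m = mS * m"

lemma model_x2_add: "model_x2 (m + n) = model_x2 m + model_x2 n"
  by (simp add: model_x2_def model_der_add algebra_simps)

lemma model_x2_diff: "model_x2 (m - n) = model_x2 m - model_x2 n"
  by (simp add: model_x2_def model_der.diff algebra_simps)

lemma model_x2_mult: "model_x2 (a * m) = a * model_x2 m + model_der a * m"
  by (simp add: model_x2_def model_der_mult algebra_simps)

lemma model_x2_sc: "model_x2 (model_sc c m) = model_sc c (model_x2 m)"
  by (simp add: model_sc_def model_x2_mult model_der_const fps_der_const mC_hom)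

text \<open>The argument \<open>field_type\<close> fixes the field type for which 2 is assumed to be
  nonzero.\<close>

locale char_not_2 =
  fixes field_type :: "'f::field itself"
  assumes two_nonzero: "(2 :: 'f) \<noteq> 0"
begin

lemma mU_mV: "mU * (mV * m) = (m :: 'f model)"
proof -
  have "(2 :: 'f) * 2 \<noteq> 0" using two_nonzero by (intro no_zero_divisors)
  then have "fps_nth (4 - fps_X ^ 2 :: 'f fps) 0 \<noteq> 0"
    by (simp add: fps_numeral_nth)
  then have "inverse (4 - fps_X ^ 2 :: 'f fps) * (4 - fps_X ^ 2) = 1"
    by (rule inverse_mult_eq_1)
  then have "mU * mV = (1 :: 'f model)"
    by (simp add: mU_def mV_def mult.commute flip: mC_hom)
  then show ?thesis by (simp add: mult.assoc[symmetric])
qed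

text \<open>Relations involving x_1 are checked after multiplication by 4 - X^2, which clears the
  denominator in the action of x_1.\<close>

lemma mU_cancel: "mU * m = mU * n \<Longrightarrow> m = (n :: 'f model)"
  by (metis mU_mV mult.left_commute)

lemma mU_gen_G1: "mU * model_gen G1 m =
    mT * m - model_x2 (model_x2 m) - 3 * mS * model_x2 m - mS * mS * m - 4 * (m :: 'f model)"
  by (simp add: mU_mV)

sublocale model: T1_action "model_sc :: 'f \<Rightarrow> 'f model \<Rightarrow> 'f model" model_gen
proof
  fix a b :: 'f and m n :: "'f model" and x
  show "model_sc (a + b) m = model_sc a m + model_sc b m"
    by (simp add: model_sc_def distrib_right mC_hom flip: fps_const_add)
  show "model_sc a (m + n) = model_sc a m + model_sc a n"
    by (simp add: model_sc_def distrib_left)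
  show "model_sc (a * b) m = model_sc a (model_sc b m)"
    by (simp add: model_sc_def mC_hom mult.assoc flip: fps_const_mult)
  show "model_sc 1 m = m"
    by (simp add: model_sc_def mC_hom)
  show "model_gen x (m + n) = model_gen x m + model_gen x n"
    by (cases x) (simp_all add: model_x2_add algebra_simps)
  show "model_gen x (model_sc a m) = model_sc a (model_gen x m)"
    by (cases x) (simp_all add: model_x2_sc, simp_all add: model_sc_def algebra_simps)
  show "model_gen G1 (model_gen G3 m) = model_gen G3 (model_gen G1 m) - model_gen G3 m -
      (model_gen G2 m + model_gen G2 m)"
  proof (rule mU_cancel)
    define a b where "a = model_x2 m" and "b = model_x2 a"
    have 1: "model_x2 (mS * m) = mS * a + mU * m"
      by (simp only: model_x2_mult model_der_S a_def)
    have 2: "model_x2 (mS * a + mU * m) = mS * b + mU * a + (mU * a + - (2 * mS * mU) * m)"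
      by (simp only: model_x2_mult model_x2_add model_der_S model_der_U a_def b_def)
    have "mU * model_gen G1 (model_gen G3 m) = mT * (mS * m) - (mS * b + mU * a + (mU * a + - (2 * mS * mU) * m))
        - 3 * mS * (mS * a + mU * m) - mS * mS * (mS * m) - 4 * (mS * m)"
      by (simp only: mU_gen_G1 model_gen.simps(2,3) 1 2)
    also have "\<dots> = mS * (mT * m - b - 3 * mS * a - mS * mS * m - 4 * m) - mU * (mS * m) - mU * (a + a)"
      by (simp add: algebra_simps)
    also have "\<dots> = mU * (model_gen G3 (model_gen G1 m) - model_gen G3 m - (model_gen G2 m + model_gen G2 m))"
      unfolding a_def b_def mU_gen_G1[symmetric] model_gen.simps(2,3) right_diff_distrib
      by (simp only: mult.left_commute)
    finally show "mU * model_gen G1 (model_gen G3 m) = mU * (model_gen G3 (model_gen G1 m) - model_gen G3 m -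
      (model_gen G2 m + model_gen G2 m))" .
  qed
  show "model_gen G2 (model_gen G3 m) = model_gen G3 (model_gen G2 m) - model_gen G3 (model_gen G3 m) +
      (m + m + m + m)"
    by (simp add: model_x2_mult model_der_S mU_eq algebra_simps)
  show "model_gen G1 (model_gen G2 m) = model_gen G2 (model_gen G1 m) -
      (model_gen G3 (model_gen G1 m) + model_gen G3 (model_gen G1 m)) +
      (model_gen G2 m + model_gen G2 m + model_gen G2 m) + (model_gen G3 m + model_gen G3 m)"
  proof (rule mU_cancel)
    define a b c w where "a = model_x2 m" and "b = model_x2 a" and "c = model_x2 b" and "w = model_gen G1 m"
    have w: "mU * w = mT * m - b - 3 * mS * a - mS * mS * m - 4 * m"
      unfolding w_def mU_gen_G1 a_def b_def ..
    \<comment> \<open>The Leibniz rule explains the constants of the third relation: differentiating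
      4 - X^2 on the left gives -2 x_3 x_1, while differentiating 3 X and X^2 on the right gives 3
      x_2 and 2 x_3, each up to the factor 4 - X^2.\<close>
    have "model_x2 (mU * w) = mT * a - c - (3 * mS * b + 3 * mU * a) - (mS * mS * a + (mU * mS + mS * mU) * m) - 4 * a"
      unfolding w
      by (simp add: model_x2_diff model_x2_mult model_der_mult model_der_T model_der_S a_def b_def c_def)
    then have 1: "mU * model_x2 w = mT * a - c - (3 * mS * b + 3 * mU * a)
        - (mS * mS * a + (mU * mS + mS * mU) * m) - 4 * a + 2 * mS * mU * w"
      by (simp add: model_x2_mult model_der_U algebra_simps)
    have "mU * model_gen G1 (model_gen G2 m) = mT * a - c - 3 * mS * b - mS * mS * a - 4 * a"
      unfolding mU_gen_G1 a_def b_def c_def by simp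
    also have "\<dots> = mU * model_x2 w - mU * (mS * w + mS * w) + mU * (a + a + a) + mU * (mS * m + mS * m)"
      unfolding 1 by (simp add: algebra_simps)
    finally show "mU * model_gen G1 (model_gen G2 m) = mU * (model_gen G2 (model_gen G1 m) -
      (model_gen G3 (model_gen G1 m) + model_gen G3 (model_gen G1 m)) +
      (model_gen G2 m + model_gen G2 m + model_gen G2 m) + (model_gen G3 m + model_gen G3 m))"
      unfolding right_diff_distrib distrib_left model_gen.simps(2,3) w_def a_def .
  qed
qed

abbreviation "act \<equiv> model.t1_act"

lemma act_t1_scalar: "act (t1_scalar c) m = mC (fps_const c) * m"
  by (simp only: model.t1_act_scalar) (simp only: model_sc_def)

lemma act_evA: "act (evA q) m = mC (fps_of_poly q) * m"
proof (induction q arbitrary: m)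
  case 0
  show ?case by (simp add: mC_hom)
next
  case (pCons a q)
  show ?case
    by (simp add: A.ev_pCons model.t1_act_add_left model.t1_act_mult pCons.IH act_t1_scalar mS_def
        fps_of_poly_pCons mC_hom algebra_simps del: model.t1_act_scalar)
qed

section \<open>Leading coefficients in b and t\<close>

definition inner_x2 :: "'f fps poly \<Rightarrow> 'f fps poly" where
  "inner_x2 n = [:0, 1:] * n + map_poly fps_der n"

lemma coeff_mC_mult: "Polynomial.coeff (mC f * m) k = [:f:] * Polynomial.coeff m k"
  by (simp add: mC_def)

lemma coeff_model_x2: "Polynomial.coeff (model_x2 m) k = inner_x2 (Polynomial.coeff m k)"
  by (simp add: model_x2_def inner_x2_def mB_def model_der_def coeff_map_poly)

lemma inner_x2_0: "inner_x2 0 = 0"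
  by (simp add: inner_x2_def)

text \<open>Multiplication by b raises the degree by one and keeps the top coefficient; the
  derivation acts on coefficients and cannot raise the degree in b.\<close>

lemma coeff_inner_x2:
  assumes "Polynomial.degree n \<le> j"
  shows "Polynomial.degree (inner_x2 n) \<le> Suc j"
    and "Polynomial.coeff (inner_x2 n) (Suc j) = Polynomial.coeff n j"
proof -
  have *: "Polynomial.coeff (inner_x2 n) i = (case i of 0 \<Rightarrow> 0 | Suc i \<Rightarrow> Polynomial.coeff n i) +
      fps_der (Polynomial.coeff n i)" for i
    by (cases i) (simp_all add: inner_x2_def coeff_map_poly fps_der.zero coeff_pCons)
  show "Polynomial.coeff (inner_x2 n) (Suc j) = Polynomial.coeff n j"
    using assms by (simp add: * coeff_eq_0 fps_der.zero)
  show "Polynomial.degree (inner_x2 n) \<le> Suc j"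
    by (rule degree_le) (use assms in \<open>auto simp: * coeff_eq_0 fps_der.zero split: nat.split\<close>)
qed

lemma coeff_act_evB_zero:
  assumes "Polynomial.coeff m k = 0"
  shows "Polynomial.coeff (act (evB q) m) k = 0"
  using assms
proof (induction q arbitrary: m)
  case (pCons a q)
  then show ?case
    by (simp add: B.ev_pCons model.t1_act_add_left model.t1_act_mult act_evA coeff_mC_mult
        coeff_model_x2 inner_x2_0)
qed simp

text \<open>Each x_2 raises the degree in b by one with unchanged top coefficient, so only the
  leading coefficient of q reaches the position deg q + j.\<close>

lemma coeff_act_evB:
  assumes "Polynomial.degree (Polynomial.coeff m k) \<le> j"
  shows "Polynomial.coeff (Polynomial.coeff (act (evB q) m) k) (Polynomial.degree q + j) =
    fps_of_poly (Polynomial.lead_coeff q) * Polynomial.coeff (Polynomial.coeff m k) j"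
  using assms
proof (induction q arbitrary: m j)
  case (pCons a q)
  show ?case
  proof (cases "q = 0")
    case True
    then show ?thesis
      by (simp add: B.ev_const act_evA coeff_mC_mult)
  next
    case False
    have deg: "Polynomial.degree (Polynomial.coeff (model_x2 m) k) \<le> Suc j"
      using coeff_inner_x2(1)[OF pCons.prems] by (simp add: coeff_model_x2)
    have "Polynomial.coeff (Polynomial.coeff m k) (Suc (Polynomial.degree q + j)) = 0"
      using pCons.prems by (intro coeff_eq_0) simp
    then show ?thesis
      using False pCons.IH[OF deg] coeff_inner_x2(2)[OF pCons.prems]
      by (simp add: B.ev_pCons model.t1_act_add_left model.t1_act_mult act_evA coeff_mC_mult
          coeff_model_x2)
  qed
qed simp

lemma coeff_mT_mult: "Polynomial.coeff (mT * m) k = (case k of 0 \<Rightarrow> 0 | Suc k \<Rightarrow> Polynomial.coeff m k)"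
  by (cases k) (simp_all add: mT_def coeff_pCons)

lemma coeff_numeral_mult: "Polynomial.coeff (numeral n * m) k = numeral n * Polynomial.coeff m k"
  for m :: "'f model"
  by (simp add: numeral_poly)

text \<open>In the action of x_1 only the summand with t raises the degree in t; the others act on
  each coefficient of t separately.\<close>

lemma coeff_model_gen_G1:
  fixes m :: "'f model"
  assumes "Polynomial.coeff m (Suc k) = 0"
  shows "Polynomial.coeff (model_gen G1 m) (Suc k) =
    [:inverse (4 - fps_X ^ 2):] * Polynomial.coeff m k"
  using assms
  by (simp only: model_gen.simps mV_def mS_def mult.assoc coeff_mC_mult Polynomial.coeff_diff coeff_mT_mult
      coeff_model_x2 coeff_numeral_mult nat.case inner_x2_0 mult_zero_right diff_zero)

lemma inverse_nonzero: "inverse (4 - fps_X ^ 2 :: 'f fps) \<noteq> 0"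
proof
  assume "inverse (4 - fps_X ^ 2 :: 'f fps) = 0"
  then have "mV = (0 :: 'f model)" by (simp only: mV_def mC_hom)
  then show False using mU_mV[of 1] by simp
qed

text \<open>The invariant is that the top coefficient of m in t is a nonzero constant in b. Under
  x_1 the degree in t rises by one and this constant is divided by 4 - X^2, so the shape persists.
  At the end the leading coefficient of P acts on such a constant and shows its own leading
  term.\<close>

lemma coeff_act_evT:
  assumes "P \<noteq> 0" "w \<noteq> 0" "Polynomial.coeff m j = [:w:]" "\<And>k. k > j \<Longrightarrow> Polynomial.coeff m k = 0"
  shows "Polynomial.coeff (Polynomial.coeff (act (evT P) m) (Polynomial.degree P + j))
    (Polynomial.degree (Polynomial.lead_coeff P)) \<noteq> 0"
  using assms
proof (induction P arbitrary: m j w)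
  case (pCons q P)
  show ?case
  proof (cases "P = 0")
    case True
    then have "q \<noteq> 0" using pCons.hyps by simp
    moreover have "Polynomial.degree (Polynomial.coeff m j) \<le> 0"
      using pCons.prems(3) by simp
    ultimately show ?thesis
      using True coeff_act_evB[of m j 0 q] pCons.prems(2,3)
      by (simp add: T.ev_const)
  next
    case False
    have "Polynomial.coeff (model_gen G1 m) (Suc k) = [:inverse (4 - fps_X ^ 2):] * Polynomial.coeff m k" if "k \<ge> j" for k
      using that pCons.prems(4) by (intro coeff_model_gen_G1) simp
    then have "Polynomial.coeff (model_gen G1 m) (Suc j) = [:inverse (4 - fps_X ^ 2) * w:]"
      "\<And>k. k > Suc j \<Longrightarrow> Polynomial.coeff (model_gen G1 m) k = 0"
      using pCons.prems(3,4) by (simp, metis Suc_less_eq2 less_imp_le mult_zero_right)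
    then have "Polynomial.coeff (Polynomial.coeff (act (evT P) (model_gen G1 m)) (Polynomial.degree P + Suc j))
        (Polynomial.degree (Polynomial.lead_coeff P)) \<noteq> 0"
      using False inverse_nonzero pCons.prems(2) by (intro pCons.IH) auto
    moreover have "Polynomial.coeff (act (evB q) m) (Suc (Polynomial.degree P + j)) = 0"
      using pCons.prems(4) by (intro coeff_act_evB_zero) simp
    ultimately show ?thesis
      using False by (simp add: T.ev_pCons model.t1_act_add_left model.t1_act_mult del: model_gen.simps)
  qed
qed simp

lemma act_evT_eq_0:
  assumes "act (evT P) 1 = 0"
  shows "P = 0"
proof (rule ccontr)
  assume "P \<noteq> 0"
  then have "Polynomial.coeff (Polynomial.coeff (act (evT P) 1) (Polynomial.degree P + 0))
    (Polynomial.degree (Polynomial.lead_coeff P)) \<noteq> 0"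
    by (rule coeff_act_evT[where w = 1]) (auto simp: one_pCons coeff_pCons split: nat.splits)
  with assms show False by simp
qed

text \<open>The vector 1 has zero annihilator, so identities in T_1 may be tested on it.\<close>

lemma act_faithful:
  assumes "act q 1 = 0"
  shows "q = 0"
proof -
  obtain P where "q = evT P" using range_evT by blast
  with assms show ?thesis using act_evT_eq_0[of P] by simp
qed

lemma inj_evT: "inj (evT :: 'f poly poly poly \<Rightarrow> _)"
proof (rule injI)
  fix P Q :: "'f poly poly poly" assume "evT P = evT Q"
  then have "act (evT (P - Q)) 1 = 0" by (simp add: T.ev.diff)
  then show "P = Q" using act_evT_eq_0[of "P - Q"] by simp
qed

lemma inj_evB: "inj (evB :: 'f poly poly \<Rightarrow> _)"
  by (rule injI) (metis T.ev_const inj_evT injD pCons_eq_iff)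

lemma inj_evA: "inj (evA :: 'f poly \<Rightarrow> _)"
  by (rule injI) (metis B.ev_const inj_evB injD pCons_eq_iff)

lemma inj_t1_scalar: "inj (t1_scalar :: 'f \<Rightarrow> _)"
  by (rule injI) (metis A.ev_const inj_evA injD pCons_eq_iff)

lemma act_p: "act t1_p m = mT * m"
proof -
  have "act t1_p m = mU * model_gen G1 m + model_x2 (model_x2 m) + 3 * mS * model_x2 m + mS * mS * m + 4 * m"
    unfolding model.t1_act_p mU_eq by (simp add: algebra_simps del: model_gen.simps(1))
  then show ?thesis by (simp only: mU_gen_G1) simp
qed

text \<open>The derivation kills t, so multiplication by t commutes with the action of every
  generator.\<close>

lemma p_central: "t1_p * q = q * (t1_p :: 'f t1)"
proof (induction q rule: t1_induct)
  case (scalar c)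
  show ?case by (rule t1_scalar_commute)
next
  case (add q r)
  then show ?case by (simp add: algebra_simps)
next
  case (gen x q)
  have "model_x2 (mT * m) = mT * model_x2 m" for m :: "'f model"
    by (simp add: model_x2_mult model_der_T)
  then have "model_gen x (mT * m) = mT * model_gen x m" for m :: "'f model"
    by (cases x) (simp_all only: model_gen.simps, simp_all add: algebra_simps)
  then have "act (t1_p * t1_gen x - t1_gen x * t1_p) 1 = 0"
    by (simp only: model.t1_act_diff_left model.t1_act_mult model.t1_act_gen act_p) simp
  then have "t1_p * t1_gen x = t1_gen x * (t1_p :: 'f t1)"
    using act_faithful by fastforce
  then show ?case by (metis gen mult.assoc)
qed

section \<open>The automorphism and the skew derivation belonging to x_1\<close>

lemma x1_mult_in_B_imp_0:
  fixes r :: "'f t1"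
  assumes "r \<in> range evB" "x1 * r \<in> range evB"
  shows "r = 0"
proof -
  obtain q q' where q: "r = evB q" and q': "x1 * r = evB q'" using assms by blast
  \<comment> \<open>Elements of \<open>range evB\<close> keep the vector 1 in degree 0 in t, whereas
    x_1 r has the t-coefficient of r 1 divided by 4 - X^2.\<close>
  have "Polynomial.coeff (act (x1 * r) 1) (Suc 0) = 0"
    unfolding q' by (rule coeff_act_evB_zero) simp
  moreover have "Polynomial.coeff (act r 1) (Suc 0) = 0"
    unfolding q by (rule coeff_act_evB_zero) simp
  ultimately have "[:inverse (4 - fps_X ^ 2):] * Polynomial.coeff (act r 1) 0 = 0"
    using coeff_model_gen_G1[of "act r 1" 0] by (simp add: model.t1_act_mult del: model_gen.simps)
  then have "Polynomial.coeff (act r 1) 0 = 0"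
    using inverse_nonzero by simp
  then have "q = 0"
    using coeff_act_evB[of 1 0 0 q] by (simp add: q)
  then show ?thesis by (simp add: q)
qed

text \<open>Since \<open>evT\<close> is injective, x_1 r is s x_1 + t for exactly one pair s, t from
  \<open>range evB\<close>. This defines \<sigma> r and \<delta> r, and comparing the two expansions
  of x_1 (r + s) and x_1 (r s) gives additivity, multiplicativity and the twisted Leibniz
  rule.\<close>

lemma x1_skew:
  obtains \<sigma> \<delta> :: "'f t1 \<Rightarrow> 'f t1" where
    "bij_betw \<sigma> (range evB) (range evB)" "\<sigma> 1 = 1"
    "\<And>r s. r \<in> range evB \<Longrightarrow> s \<in> range evB \<Longrightarrow> \<sigma> (r + s) = \<sigma> r + \<sigma> s"
    "\<And>r s. r \<in> range evB \<Longrightarrow> s \<in> range evB \<Longrightarrow> \<sigma> (r * s) = \<sigma> r * \<sigma> s"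
    "\<And>r. r \<in> range evB \<Longrightarrow> \<delta> r \<in> range evB"
    "\<And>r s. r \<in> range evB \<Longrightarrow> s \<in> range evB \<Longrightarrow> \<delta> (r + s) = \<delta> r + \<delta> s"
    "\<And>r s. r \<in> range evB \<Longrightarrow> s \<in> range evB \<Longrightarrow> \<delta> (r * s) = \<sigma> r * \<delta> s + \<delta> r * s"
    "\<And>r. r \<in> range evB \<Longrightarrow> x1 * r = \<sigma> r * x1 + \<delta> r"
proof -
  let ?B = "range (evB :: 'f poly poly \<Rightarrow> _)"
  have unique: "a = a' \<and> b = b'" if eq: "a * x1 + b = a' * x1 + b'" and mem: "a \<in> ?B" "b \<in> ?B" "a' \<in> ?B" "b' \<in> ?B"
    for a b a' b'
  proof -
    obtain p q p' q' where *: "a = evB p" "b = evB q" "a' = evB p'" "b' = evB q'" using mem by blast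
    then have "evT [:q, p:] = evT [:q', p':]"
      using eq by (simp add: T.ev_pCons add.commute)
    then have "[:q, p:] = [:q', p':]" by (rule injD[OF inj_evT])
    then show ?thesis using * by simp
  qed
  have "\<forall>r\<in>?B. \<exists>s t. s \<in> ?B \<and> t \<in> ?B \<and> x1 * r = s * x1 + t"
  proof
    fix r assume "r \<in> ?B"
    then obtain s where "s \<in> ?B" "x1 * r - s * x1 \<in> ?B" using x1_straighten_left by blast
    then show "\<exists>s t. s \<in> ?B \<and> t \<in> ?B \<and> x1 * r = s * x1 + t"
      by (intro exI[of _ s] exI[of _ "x1 * r - s * x1"]) simp
  qed
  then obtain \<sigma> \<delta> where \<sigma>: "\<And>r. r \<in> ?B \<Longrightarrow> \<sigma> r \<in> ?B" and \<delta>: "\<And>r. r \<in> ?B \<Longrightarrow> \<delta> r \<in> ?B"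
    and comm: "\<And>r. r \<in> ?B \<Longrightarrow> x1 * r = \<sigma> r * x1 + \<delta> r"
    by metis
  have eqI: "\<sigma> r = s \<and> \<delta> r = t" if "r \<in> ?B" "s \<in> ?B" "t \<in> ?B" "x1 * r = s * x1 + t" for r s t
    using unique[of "\<sigma> r" "\<delta> r" s t] comm[OF that(1)] \<sigma>[OF that(1)] \<delta>[OF that(1)] that by simp
  have one: "\<sigma> 1 = 1"
  proof -
    have "0 \<in> ?B" by (rule range_eqI[of _ _ 0]) simp
    then show ?thesis using eqI[OF B.range_ev_1 B.range_ev_1, of 0] by simp
  qed
  have add: "\<sigma> (r + s) = \<sigma> r + \<sigma> s \<and> \<delta> (r + s) = \<delta> r + \<delta> s" if "r \<in> ?B" "s \<in> ?B" for r s
    by (rule eqI)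
       (use that in \<open>simp_all only: B.range_ev_add \<sigma> \<delta> distrib_left comm distrib_right add_ac\<close>)
  have mult: "\<sigma> (r * s) = \<sigma> r * \<sigma> s \<and> \<delta> (r * s) = \<sigma> r * \<delta> s + \<delta> r * s" if "r \<in> ?B" "s \<in> ?B" for r s
  proof (rule eqI)
    have "x1 * (r * s) = (\<sigma> r * x1 + \<delta> r) * s"
      using comm[OF that(1)] by (simp only: mult.assoc[symmetric])
    also have "\<dots> = \<sigma> r * (\<sigma> s * x1 + \<delta> s) + \<delta> r * s"
      using comm[OF that(2)] by (simp only: distrib_right mult.assoc)
    finally show "x1 * (r * s) = \<sigma> r * \<sigma> s * x1 + (\<sigma> r * \<delta> s + \<delta> r * s)"
      by (simp add: algebra_simps)
  qed (use that in \<open>simp_all only: B.range_ev_add B.range_ev_mult \<sigma> \<delta>\<close>)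
  have "inj_on \<sigma> ?B"
  proof (rule inj_onI)
    \<comment> \<open>If \<sigma> r = \<sigma> s then x_1 (r - s) has no term in x_1 and lies in
      \<open>range evB\<close>, which forces r = s.\<close>
    fix r s assume rs: "r \<in> ?B" "s \<in> ?B" "\<sigma> r = \<sigma> s"
    then have "x1 * (r - s) = \<delta> r - \<delta> s"
      by (simp add: right_diff_distrib comm)
    then have "r - s = 0"
      using rs \<delta> by (intro x1_mult_in_B_imp_0) (simp_all only: B.range_ev_diff)
    then show "r = s" by simp
  qed
  moreover have "\<sigma> ` ?B = ?B"
  proof
    show "\<sigma> ` ?B \<subseteq> ?B" using \<sigma> by blast
    show "?B \<subseteq> \<sigma> ` ?B"
    proof
      fix s assume s: "s \<in> ?B"
      then obtain r where r: "r \<in> ?B" "s * x1 - x1 * r \<in> ?B" using x1_straighten_right by blast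
      have "(x2 - x2) - (s * x1 - x1 * r) \<in> ?B"
        using r(2) by (simp only: B_closed)
      then have "\<sigma> r = s"
        using eqI[OF r(1) s, of "(x2 - x2) - (s * x1 - x1 * r)"] by simp
      then show "s \<in> \<sigma> ` ?B" using r(1) by blast
    qed
  qed
  ultimately have "bij_betw \<sigma> ?B ?B" by (simp add: bij_betw_def)
  then show thesis
    using that one add mult \<delta> comm by blast
qed

end

section \<open>The homomorphism from \<open>T\<^sub>1\<close> to \<open>S\<^sub>1\<close>\<close>

definition phi :: "'f::field t1 \<Rightarrow> (int \<Rightarrow>\<^sub>0 'f poly)" where
  "phi q = S1.t1_act q 1"

text \<open>The operators of the generators commute with right multiplication, so every operator is
  left multiplication by its value at 1. This makes \<open>phi\<close> multiplicative.\<close>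

lemma S1_act_eq: "S1.t1_act q m = S1_mult (phi q) m"
proof -
  have "S1.t1_act q (S1_mult n m) = S1_mult (S1.t1_act q n) m" for n
  proof (induction q arbitrary: n rule: t1_induct)
    case (scalar c)
    show ?case by (simp add: S1_smult_mult_left)
  next
    case (add q r)
    then show ?case by (simp add: S1.t1_act_add_left S1_mult_add_left)
  next
    case (gen x q)
    then show ?case by (simp add: S1.t1_act_mult S1_mult_assoc del: S1_gen.simps)
  qed
  from this[of 1] show ?thesis by (simp add: phi_def S1_mult_1)
qed

lemma phi_add: "phi (q + r) = phi q + phi r"
  by (simp add: phi_def S1.t1_act_add_left)

interpretation phi: additive phi
  by unfold_locales (rule phi_add)

lemma phi_mult: "phi (q * r) = S1_mult (phi q) (phi r)"
  unfolding phi_def[of "q * r"] S1.t1_act_mult phi_def[of r, symmetric] by (rule S1_act_eq)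

lemma phi_1 [simp]: "phi 1 = 1"
  by (simp add: phi_def)

lemma phi_gen: "phi (t1_gen x) = S1_gen x"
  by (simp add: phi_def S1_mult_1 del: S1_gen.simps)

lemma phi_scalar_mult: "phi (t1_scalar c * q) = S1_smult c (phi q)"
  by (simp add: phi_def S1.t1_act_mult)

lemma phi_scalar: "phi (t1_scalar c) = Poly_Mapping.single 0 [:c:]"
  using phi_scalar_mult[of c 1] by (simp add: S1_smult_single flip: single_one)

lemma lookup_single_mult:
  "Poly_Mapping.lookup (S1_mult (Poly_Mapping.single i a) f) k =
    a * pcompose (Poly_Mapping.lookup f (k - i)) [:of_int i, 1:]"
proof (induction f rule: poly_mapping_add_induct)
  case (single j b)
  then show ?case
    by (auto simp: S1_mult_single lookup_single when_def)
next
  case (add f g)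
  then show ?case
    by (simp add: S1_mult_add_right lookup_add pcompose_add distrib_left)
qed simp

lemma lookup_gen_mult:
  fixes f :: "int \<Rightarrow>\<^sub>0 'f::field poly"
  shows "Poly_Mapping.lookup (S1_mult (S1_gen G1) f) k = [:0, 0, 1:] * Poly_Mapping.lookup f k"
    and "Poly_Mapping.lookup (S1_mult (S1_gen G2) f) k =
      [:0, 1:] * pcompose (Poly_Mapping.lookup f (k - 1)) [:1, 1:] -
      [:0, 1:] * pcompose (Poly_Mapping.lookup f (k + 1)) [:- 1, 1:]"
    and "Poly_Mapping.lookup (S1_mult (S1_gen G3) f) k =
      pcompose (Poly_Mapping.lookup f (k - 1)) [:1, 1:] + pcompose (Poly_Mapping.lookup f (k + 1)) [:- 1, 1:]"
proof -
  have "pcompose q [:0, 1:] = q" for q :: "'f poly"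
    using pcompose_idR[of q] by simp
  then show "Poly_Mapping.lookup (S1_mult (S1_gen G1) f) k = [:0, 0, 1:] * Poly_Mapping.lookup f k"
    by (simp add: lookup_single_mult)
qed (simp_all add: S1_mult_add_left lookup_add lookup_single_mult)

lemma phi_p: "phi t1_p = (0 :: int \<Rightarrow>\<^sub>0 'f::field poly)"
proof -
  have "phi t1_p = (S1_gen G1 + S1_gen G1 + S1_gen G1 + S1_gen G1)
      - S1_mult (S1_gen G3) (S1_mult (S1_gen G3) (S1_gen G1)) + S1_mult (S1_gen G2) (S1_gen G2)
      + (S1_mult (S1_gen G3) (S1_gen G2) + S1_mult (S1_gen G3) (S1_gen G2) + S1_mult (S1_gen G3) (S1_gen G2))
      + S1_mult (S1_gen G3) (S1_gen G3) + (1 + 1 + 1 + 1)"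
    unfolding phi_def S1.t1_act_p S1_mult_1 ..
  also have "\<dots> = 0"
    by (rule poly_mapping_eqI, unfold S1_gen.simps S1_mult_add_left S1_mult_add_right S1_mult_single
        lookup_add lookup_minus lookup_single lookup_one lookup_zero,
        simp add: when_def pcompose_pCons pcompose_1 one_pCons numeral_poly)
  finally show ?thesis .
qed

lemma flip_phi:
  fixes q :: "'f::field t1"
  shows "S1_flip (phi q) = phi q"
proof (induction q rule: t1_induct)
  case (scalar c)
  show ?case by (simp add: phi_scalar S1_flip_single pcompose_pCons)
next
  case (add q r)
  then show ?case by (simp add: phi_add S1_flip_add)
next
  case (gen x q)
  have "S1_flip (S1_gen x) = (S1_gen x :: int \<Rightarrow>\<^sub>0 'f poly)"
    by (cases x) (simp_all add: S1_flip_add S1_flip_single pcompose_pCons pcompose_1 add.commute)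
  with gen show ?case by (simp only: phi_mult phi_gen S1_flip_mult)
qed

subsection \<open>The image\<close>

lemma range_phi_closed:
  fixes a b :: "int \<Rightarrow>\<^sub>0 'f::field poly"
  shows "a \<in> range phi \<Longrightarrow> b \<in> range phi \<Longrightarrow> a + b \<in> range phi"
    and "a \<in> range phi \<Longrightarrow> b \<in> range phi \<Longrightarrow> S1_mult a b \<in> range phi"
    and "Poly_Mapping.single 0 [:c:] \<in> range (phi :: 'f t1 \<Rightarrow> _)"
    and "S1_gen x \<in> range (phi :: 'f t1 \<Rightarrow> _)"
proof -
  show "a \<in> range phi \<Longrightarrow> b \<in> range phi \<Longrightarrow> a + b \<in> range phi"
    by (auto simp only: phi_add[symmetric])
  show "a \<in> range phi \<Longrightarrow> b \<in> range phi \<Longrightarrow> S1_mult a b \<in> range phi"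
    by (auto simp only: phi_mult[symmetric])
qed (auto simp only: phi_scalar[symmetric] phi_gen[symmetric])

text \<open>Laurent polynomials with all exponents between -n and n.\<close>

definition band :: "nat \<Rightarrow> (int \<Rightarrow>\<^sub>0 'f::field poly) set" where
  "band n = {f. \<forall>k. \<bar>k\<bar> > int n \<longrightarrow> Poly_Mapping.lookup f k = 0}"

lemma band_add: "f \<in> band n \<Longrightarrow> g \<in> band n \<Longrightarrow> f + g \<in> band n"
  by (simp add: band_def lookup_add)

lemma top_coefficient_one:
  "\<exists>w\<in>range phi \<inter> band n. Poly_Mapping.lookup w (int n) = (1 :: 'f::field poly)"
proof (induction n)
  case 0
  have "phi 1 \<in> range phi \<inter> band 0"
    by (simp add: band_def lookup_one del: phi_1) (simp add: lookup_one)
  then show ?case by (intro bexI[of _ "phi 1"]) (simp_all add: lookup_one)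
next
  case (Suc n)
  then obtain w :: "int \<Rightarrow>\<^sub>0 'f poly" where w: "w \<in> range phi" "w \<in> band n" "Poly_Mapping.lookup w (int n) = 1" by blast
  have "S1_mult (S1_gen G3) w \<in> range phi \<inter> band (Suc n)"
    using w by (auto simp: band_def lookup_gen_mult simp del: S1_gen.simps intro!: range_phi_closed)
  moreover have "Poly_Mapping.lookup (S1_mult (S1_gen G3) w) (int (Suc n)) = 1"
    using w by (simp add: band_def lookup_gen_mult pcompose_1 del: S1_gen.simps)
  ultimately show ?case by blast
qed

text \<open>The coefficients of x^n attained within the band form a vector space stable under
  multiplication by y^2, through x_1. It contains 1, from x_3^n, and y, from x_2 x_3^(n-1); the
  latter is why n must be positive.\<close>

lemma top_coefficient:
  assumes "n > 0"
  shows "\<exists>w\<in>range phi \<inter> band n. Poly_Mapping.lookup w (int n) = (g :: 'f::field poly)"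
proof -
  define G where "G = {g :: 'f poly. \<exists>w\<in>range phi \<inter> band n. Poly_Mapping.lookup w (int n) = g}"
  have G_add: "g + h \<in> G" if "g \<in> G" "h \<in> G" for g h
    using that unfolding G_def by (blast intro: range_phi_closed(1) band_add lookup_add)
  have G_sq: "[:0, 0, 1:] * g \<in> G" if g: "g \<in> G" for g
  proof -
    from g obtain w :: "int \<Rightarrow>\<^sub>0 'f poly" where w: "w \<in> range phi" "w \<in> band n" "Poly_Mapping.lookup w (int n) = g"
      by (auto simp: G_def)
    have "S1_mult (S1_gen G1) w \<in> range phi \<inter> band n"
      using w by (auto simp: band_def lookup_gen_mult simp del: S1_gen.simps intro!: range_phi_closed)
    moreover have "Poly_Mapping.lookup (S1_mult (S1_gen G1) w) (int n) = [:0, 0, 1:] * g"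
      unfolding lookup_gen_mult w ..
    ultimately show ?thesis unfolding G_def by blast
  qed
  have G_smult: "Polynomial.smult c g \<in> G" if g: "g \<in> G" for c g
  proof -
    from g obtain w :: "int \<Rightarrow>\<^sub>0 'f poly" where w: "w \<in> range phi" "w \<in> band n" "Poly_Mapping.lookup w (int n) = g"
      by (auto simp: G_def)
    then obtain q where q: "w = phi q" by blast
    have "phi (t1_scalar c * q) \<in> range phi \<inter> band n"
      using w by (auto simp: q phi_scalar_mult[symmetric] band_def) (simp add: phi_scalar_mult)
    moreover have "Poly_Mapping.lookup (phi (t1_scalar c * q)) (int n) = Polynomial.smult c g"
      using w(3) by (simp add: q phi_scalar_mult)
    ultimately show ?thesis unfolding G_def by blast
  qed
  have G_1: "1 \<in> G"
    using top_coefficient_one[of n] by (simp add: G_def)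
  have G_y: "[:0, 1:] \<in> G"
  proof -
    obtain m where m: "n = Suc m" using assms by (cases n) auto
    obtain w :: "int \<Rightarrow>\<^sub>0 'f poly" where w: "w \<in> range phi" "w \<in> band m" "Poly_Mapping.lookup w (int m) = 1"
      using top_coefficient_one by blast
    have "S1_mult (S1_gen G2) w \<in> range phi \<inter> band n"
      using w by (auto simp: m band_def lookup_gen_mult simp del: S1_gen.simps intro!: range_phi_closed)
    moreover have "Poly_Mapping.lookup (S1_mult (S1_gen G2) w) (int n) = [:0, 1:]"
      using w by (simp add: m band_def lookup_gen_mult pcompose_1 del: S1_gen.simps)
    ultimately show ?thesis by (auto simp: G_def)
  qed
  \<comment> \<open>Stability is known for y^2 but not for y, so g and y g are carried through the
    induction together.\<close>
  have "g \<in> G \<and> [:0, 1:] * g \<in> G"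
  proof (induction g)
    case 0
    show ?case using G_smult[OF G_1, of 0] by simp
  next
    case (pCons a g)
    have "Polynomial.smult a 1 + [:0, 1:] * g \<in> G" "Polynomial.smult a [:0, 1:] + [:0, 0, 1:] * g \<in> G"
      using pCons.IH by (blast intro: G_add G_sq G_smult G_1 G_y)+
    moreover have "Polynomial.smult a 1 + [:0, 1:] * g = pCons a g"
      "Polynomial.smult a [:0, 1:] + [:0, 0, 1:] * g = [:0, 1:] * pCons a g" by simp_all
    ultimately show ?case by (simp only: simp_thms)
  qed
  then show ?thesis by (simp add: G_def)
qed

lemma lookup_flip: "Poly_Mapping.lookup (S1_flip f) k = pcompose (Poly_Mapping.lookup f (- k)) [:0, - 1:]"
proof (induction f rule: poly_mapping_add_induct)
  case (single i a)
  then show ?case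
    by (auto simp: S1_flip_single lookup_single when_def)
qed (simp_all add: S1_flip_0 S1_flip_add lookup_add pcompose_add)

text \<open>Even g and odd g alternate when the constant term is split off: y times an odd
  polynomial is even, and its quotient by y^2 is even again. An odd polynomial has constant term 0
  because 2 is invertible.\<close>

lemma range_phi_even:
  fixes g :: "'f::field poly"
  assumes "(2 :: 'f) \<noteq> 0"
  shows "(pcompose g [:0, - 1:] = g \<longrightarrow> Poly_Mapping.single 0 g \<in> range phi) \<and>
    (pcompose g [:0, - 1:] = - g \<longrightarrow> Poly_Mapping.single 0 (pCons 0 g) \<in> range phi)"
proof (induction g)
  case 0
  show ?case using rangeI[of phi 0] by (simp add: phi.zero)
next
  case (pCons a g)
  show ?case
  proof (intro conjI impI)
    assume "pcompose (pCons a g) [:0, - 1:] = pCons a g"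
    then have "Poly_Mapping.single 0 (pCons 0 g) \<in> range phi"
      using pCons.IH by (simp add: pcompose_pCons minus_equation_iff)
    then have "Poly_Mapping.single 0 [:a:] + Poly_Mapping.single 0 (pCons 0 g) \<in> range phi"
      by (intro range_phi_closed)
    then show "Poly_Mapping.single 0 (pCons a g) \<in> range phi"
      by (simp add: single_add[symmetric])
  next
    assume odd: "pcompose (pCons a g) [:0, - 1:] = - pCons a g"
    then have "a = - a" by (simp add: pcompose_pCons)
    then have "2 * a = 0" by (simp add: eq_neg_iff_add_eq_0)
    then have "a = 0" using assms by simp
    moreover have "Poly_Mapping.single 0 g \<in> range phi"
      using odd pCons.IH by (simp add: pcompose_pCons)
    then have "S1_mult (S1_gen G1) (Poly_Mapping.single 0 g) \<in> range phi"
      by (intro range_phi_closed)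
    ultimately show "Poly_Mapping.single 0 (pCons 0 (pCons a g)) \<in> range phi"
      using pcompose_idR[of g] by (simp add: S1_mult_single)
  qed
qed

lemma band_0_single: "f \<in> band 0 \<Longrightarrow> f = Poly_Mapping.single 0 (Poly_Mapping.lookup f 0)"
  by (rule poly_mapping_eqI) (auto simp: band_def lookup_single when_def)

lemma fixed_in_range_phi:
  fixes f :: "int \<Rightarrow>\<^sub>0 'f::field poly"
  assumes two: "(2 :: 'f) \<noteq> 0" and "S1_flip f = f"
  shows "f \<in> range phi"
proof -
  have "f \<in> range phi" if "f \<in> band n" "S1_flip f = f" for n and f :: "int \<Rightarrow>\<^sub>0 'f poly"
    using that
  proof (induction n arbitrary: f)
    case 0
    then have "pcompose (Poly_Mapping.lookup f 0) [:0, - 1:] = Poly_Mapping.lookup f 0"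
      using lookup_flip[of f 0] by simp
    then have "Poly_Mapping.single 0 (Poly_Mapping.lookup f 0) \<in> range phi"
      using range_phi_even[OF two] by blast
    then show ?case
      using band_0_single[OF 0(1)] by (simp only:)
  next
    case (Suc n)
    obtain q where q: "phi q \<in> band (Suc n)"
      "Poly_Mapping.lookup (phi q) (int (Suc n)) = Poly_Mapping.lookup f (int (Suc n))"
      using top_coefficient[of "Suc n" "Poly_Mapping.lookup f (int (Suc n))"] by blast
    define h where "h = f + - phi q"
    have flip: "S1_flip h = h"
      using flip_phi[of "- q"] by (simp only: h_def S1_flip_add Suc.prems(2) phi.minus)
    have top: "Poly_Mapping.lookup h (int (Suc n)) = 0"
      unfolding h_def lookup_add lookup_uminus q(2) by (rule right_minus)
    \<comment> \<open>The flip exchanges the coefficients at k and -k, so removing the top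
      coefficient removes the bottom one.\<close>
    have bot: "Poly_Mapping.lookup h (- int (Suc n)) = 0"
      using lookup_flip[of h "- int (Suc n)"] by (simp only: flip minus_minus top pcompose_0)
    have "Poly_Mapping.lookup h k = 0" if "\<bar>k\<bar> > int n" for k
    proof (cases "\<bar>k\<bar> > int (Suc n)")
      case True
      then show ?thesis using Suc.prems(1) q(1) unfolding h_def lookup_add lookup_uminus by (simp add: band_def)
    next
      case False
      then have "k = int (Suc n) \<or> k = - int (Suc n)" using that by linarith
      then show ?thesis using top bot by blast
    qed
    then have "h \<in> range phi"
      using flip by (intro Suc.IH) (simp_all add: band_def)
    then have "h + phi q \<in> range phi" by (intro range_phi_closed) auto
    then show ?case unfolding h_def by (simp only: add.assoc left_minus add_0_right)
  qed
  \<comment> \<open>Some band contains f; the inserted 0 gives the maximum a value when f =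
    0.\<close>
  moreover have "f \<in> band (nat (Max (insert 0 (abs ` Poly_Mapping.keys f))))"
  proof -
    have "k \<notin> Poly_Mapping.keys f" if "\<bar>k\<bar> > Max (insert 0 (abs ` Poly_Mapping.keys f))" for k
    proof
      assume "k \<in> Poly_Mapping.keys f"
      then have "\<bar>k\<bar> \<le> Max (insert 0 (abs ` Poly_Mapping.keys f))" by (intro Max_ge) auto
      with that show False by linarith
    qed
    then show ?thesis by (simp add: band_def in_keys_iff)
  qed
  ultimately show ?thesis using assms(2) by blast
qed

subsection \<open>The kernel\<close>

text \<open>Here the coefficients stand to the right of the powers, as in x_3^n a(x_1), so left
  multiplication by x_3 is a mere shift \<open>pCons 0\<close>.\<close>

definition left_eval :: "('c::zero \<Rightarrow> 'r::ring_1) \<Rightarrow> 'r \<Rightarrow> 'c poly \<Rightarrow> 'r" where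
  "left_eval h z p = (\<Sum>i\<le>Polynomial.degree p. z ^ i * h (Polynomial.coeff p i))"

lemma left_eval_pCons:
  assumes "h 0 = 0"
  shows "left_eval h z (pCons a p) = h a + z * left_eval h z p"
proof -
  have "left_eval h z (pCons a p) = (\<Sum>i\<le>Suc (Polynomial.degree p). z ^ i * h (Polynomial.coeff (pCons a p) i))"
    unfolding left_eval_def
    by (rule sum.mono_neutral_left) (use degree_pCons_le in \<open>auto simp: assms coeff_eq_0\<close>)
  also have "\<dots> = h a + (\<Sum>i\<le>Polynomial.degree p. z * (z ^ i * h (Polynomial.coeff p i)))"
    by (subst sum.atMost_Suc_shift) (simp add: mult.assoc)
  finally show ?thesis
    by (simp add: left_eval_def sum_distrib_left)
qed

lemma left_eval_0: "h 0 = 0 \<Longrightarrow> left_eval h z 0 = 0"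
  by (simp add: left_eval_def)

abbreviation ev1 :: "'f::field poly \<Rightarrow> 'f t1" where "ev1 \<equiv> ore_eval t1_scalar x1"

interpretation C: ore_ring "t1_scalar :: 'f::field \<Rightarrow> 'f t1" x1
proof unfold_locales
  show "\<exists>b\<in>range t1_scalar. x1 * a - b * x1 \<in> range t1_scalar" if "a \<in> range t1_scalar" for a :: "'f t1"
    using A.zero that by (intro bexI[OF _ that]) (auto simp: t1_scalar_commute intro: range_eqI[of _ _ 0])
qed (use A.range_1 A.range_mult in blast)+

abbreviation evC :: "'f::field poly poly \<Rightarrow> 'f t1" where
  "evC \<equiv> left_eval ev1 x3"
abbreviation evD :: "'f::field poly poly \<Rightarrow> 'f t1" where
  "evD \<equiv> left_eval (\<lambda>b. (x2 + x3) * ev1 b) x3"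

lemma evC_pCons: "evC (pCons a q) = ev1 a + x3 * evC q"
  and evD_pCons: "evD (pCons a q) = (x2 + x3) * ev1 a + x3 * evD q"
  and evC_0 [simp]: "evC 0 = 0" and evD_0 [simp]: "evD 0 = 0"
  by (simp_all add: left_eval_pCons left_eval_0)

text \<open>
  The second family uses \<open>x\<^sub>2 + x\<^sub>3\<close> because its image is \<open>(x - x\<^sup>-\<^sup>1) y\<close>: the images of the two families
  then have even and odd powers of \<open>y\<close> to the right of all powers of \<open>x\<close>.
\<close>

inductive_set reduced :: "'f::field t1 set" where
  even: "ev1 a \<in> reduced"
| odd: "(x2 + x3) * ev1 a \<in> reduced"
| p: "t1_p * r \<in> reduced"
| add: "q \<in> reduced \<Longrightarrow> r \<in> reduced \<Longrightarrow> q + r \<in> reduced"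
| x3: "q \<in> reduced \<Longrightarrow> x3 * q \<in> reduced"

text \<open>Solving p for x_2^2 and adding x_2 x_3 makes the constants 4 cancel. What remains modulo
  p lies in the two families again, so the span is closed under left multiplication by x_2.\<close>

lemma x2_odd_straighten: "x2 * (x2 + x3) = t1_p - (4 - x3 ^ 2) * x1 - 2 * x3 * (x2 + x3)"
proof -
  have "(3 :: 'a t1) = 1 + 2" by simp
  then have "3 * x3 * x2 = x3 * x2 + 2 * x3 * (x2 :: 'a t1)"
    by (simp only: distrib_right mult_1)
  moreover have "x2 * x3 = x3 * x2 - x3 ^ 2 + (4 :: 'a t1)" by (rule rel23)
  moreover have "2 * x3 * x3 = x3 ^ 2 + x3 ^ (2 :: nat) * (1 :: 'a t1)"
    by (simp add: power2_eq_square mult.assoc mult_2 distrib_right)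
  ultimately show ?thesis
    by (simp add: t1_p_def distrib_left power2_eq_square[of x2])
qed

lemma ev1_scalar: "\<exists>b. t1_scalar c * ev1 a = ev1 b"
  using C.range_ev_mult_const[of "t1_scalar c" a] by auto

lemma reduced_scalar:
  assumes "q \<in> reduced"
  shows "t1_scalar c * q \<in> reduced"
  using assms
proof induction
  case (even a)
  then show ?case using ev1_scalar[of c a] reduced.even by metis
next
  case (odd a)
  have "t1_scalar c * ((x2 + x3) * ev1 a) = (x2 + x3) * (t1_scalar c * ev1 a)"
    by (simp only: mult.assoc[symmetric] t1_scalar_commute)
  then show ?case using ev1_scalar[of c a] reduced.odd by metis
next
  case (p r)
  have "t1_scalar c * (t1_p * r) = t1_p * (t1_scalar c * r)"
    by (simp only: mult.assoc[symmetric] t1_scalar_commute)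
  then show ?case using reduced.p by metis
next
  case (x3 q)
  have "t1_scalar c * (x3 * q) = x3 * (t1_scalar c * q)"
    by (simp only: mult.assoc[symmetric] t1_scalar_commute)
  then show ?case using reduced.x3[OF x3.IH] by simp
qed (simp add: distrib_left reduced.add)

lemma reduced_uminus: "q \<in> reduced \<Longrightarrow> - q \<in> reduced"
  using reduced_scalar[of q "- 1"] by (simp add: A.minus)

lemma reduced_diff: "q \<in> reduced \<Longrightarrow> r \<in> reduced \<Longrightarrow> q - r \<in> reduced"
  using reduced.add[OF _ reduced_uminus] by fastforce

lemma reduced_numeral: "q \<in> reduced \<Longrightarrow> numeral n * q \<in> reduced"
  by (induction n) (simp_all only: numeral.simps distrib_right mult_1 reduced.add)

lemma left_eval_add:
  assumes "additive h"
  shows "left_eval h z (p + q) = left_eval h z p + left_eval h z q"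
proof -
  interpret h: additive h by (rule assms)
  show ?thesis
  proof (induction p arbitrary: q)
    case (pCons a p)
    show ?case
    proof (cases q)
      case (pCons b q')
      then show ?thesis
        using pCons.IH[of q'] by (simp add: left_eval_pCons h.zero h.add distrib_left add_ac)
    qed
  qed (simp add: left_eval_0 h.zero)
qed

context char_not_2
begin

lemma reduced_x2:
  fixes q :: "'f t1"
  assumes "q \<in> reduced"
  shows "x2 * q \<in> reduced"
  using assms
proof induction
  case (even a)
  have "(x2 + x3) * ev1 a - x3 * ev1 a \<in> reduced"
    by (intro reduced_diff reduced.odd reduced.x3 reduced.even)
  then show ?case by (simp add: distrib_right)
next
  case (odd a)
  obtain b where b: "x1 * ev1 a = ev1 b" using C.range_ev_mult_z[of a] by auto
  have "x2 * ((x2 + x3) * ev1 a) =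
      t1_p * ev1 a - (4 * ev1 b - x3 * (x3 * ev1 b)) - 2 * (x3 * ((x2 + x3) * ev1 a))"
    by (simp only: mult.assoc[symmetric] x2_odd_straighten)
       (simp only: left_diff_distrib mult.assoc b power2_eq_square)
  also have "\<dots> \<in> reduced"
    by (intro reduced_diff reduced_numeral reduced.intros)
  finally show ?case .
next
  case (p r)
  have "x2 * (t1_p * r) = t1_p * (x2 * r)"
    by (simp only: mult.assoc[symmetric] p_central[of x2])
  then show ?case using reduced.p by metis
next
  case (add q r)
  then show ?case by (simp only: distrib_left reduced.add)
next
  case (x3 q)
  have "x2 * (x3 * q) = x3 * (x2 * q) - x3 * (x3 * q) + 4 * q"
    unfolding mult.assoc[symmetric] rel23 by (simp add: algebra_simps power2_eq_square)
  also have "\<dots> \<in> reduced"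
    using x3 by (intro reduced.add reduced_diff reduced_numeral reduced.x3)
  finally show ?case .
qed

lemma reduced_B:
  fixes b :: "'f t1"
  assumes "b \<in> range evB" "q \<in> reduced"
  shows "b * q \<in> reduced"
proof -
  have A: "a * q \<in> reduced" if "a \<in> range evA" "q \<in> reduced" for a q :: "'f t1"
    using that
    by (induction a arbitrary: q rule: A.range_ev_induct)
       (auto simp: mult.assoc distrib_right intro: reduced_scalar reduced.add reduced.x3)
  show ?thesis
    using assms
    by (induction b arbitrary: q rule: B.range_ev_induct)
       (auto simp: mult.assoc distrib_right intro: A reduced_x2 reduced.add)
qed

text \<open>Left multiplication by x_1 is avoided: in the ordered form x_1 stands on the right, each
  power x_1^k is reduced, and reduced elements are closed under left multiplication by
  \<open>range evB\<close>.\<close>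

lemma reduced_UNIV: "q \<in> (reduced :: 'f t1 set)"
proof -
  have "evT P * x1 ^ k \<in> reduced" for P :: "'f poly poly poly" and k
  proof (induction P arbitrary: k)
    case 0
    show ?case using reduced.p[of 0] by simp
  next
    case (pCons b P)
    have "x1 ^ k \<in> range (ev1 :: 'f poly \<Rightarrow> _)" by (rule C.range_ev_power)
    then have "x1 ^ k \<in> (reduced :: 'f t1 set)" using reduced.even by auto
    then have "evB b * x1 ^ k + evT P * x1 ^ Suc k \<in> reduced"
      by (intro reduced.add reduced_B pCons.IH) auto
    then show ?case
      by (simp add: T.ev_pCons distrib_right mult.assoc)
  qed
  moreover obtain P where "q = evT P" using range_evT by blast
  ultimately show ?thesis by (metis mult_1_right power_0)
qed

lemma reduced_normal_form:
  fixes q :: "'f t1"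
  assumes "q \<in> reduced"
  shows "\<exists>a b r. q = evC a + evD b + t1_p * r"
proof -
  have addC: "additive ev1" by (rule C.ev.additive_axioms)
  have addD: "additive (\<lambda>b. (x2 + x3) * ev1 b)"
    by unfold_locales (simp add: C.ev_add distrib_left)
  show ?thesis
    using assms
  proof induction
    case (even a)
    have "ev1 a = evC [:a:] + evD 0 + t1_p * 0"
      unfolding evC_pCons by simp
    then show ?case by blast
  next
    case (odd a)
    have "(x2 + x3) * ev1 a = evC 0 + evD [:a:] + t1_p * 0"
      unfolding evD_pCons by simp
    then show ?case by blast
  next
    case (p r)
    have "t1_p * r = evC 0 + evD 0 + t1_p * r" by simp
    then show ?case by blast
  next
    case (add q r)
    then obtain a b s a' b' s' where "q = evC a + evD b + t1_p * s" "r = evC a' + evD b' + t1_p * s'"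
      by blast
    then have "q + r = evC (a + a') + evD (b + b') + t1_p * (s + s')"
      by (simp add: left_eval_add[OF addC] left_eval_add[OF addD] distrib_left)
    then show ?case by blast
  next
    case (x3 q)
    then obtain a b s where "q = evC a + evD b + t1_p * s" by blast
    moreover have "x3 * (t1_p * s) = t1_p * (x3 * s)"
      by (simp only: mult.assoc[symmetric] p_central[of x3])
    ultimately have "x3 * q = evC (pCons 0 a) + evD (pCons 0 b) + t1_p * (x3 * s)"
      by (simp add: evC_pCons evD_pCons distrib_left)
    then show ?case by blast
  qed
qed

end

section \<open>Top coefficients of the images and injectivity modulo p\<close>

lemma phi_ev1: "phi (ev1 a) = Poly_Mapping.single 0 (pcompose a [:0, 0, 1:])"
proof (induction a)
  case 0
  show ?case by (simp add: phi.zero)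
next
  case (pCons c a)
  have "phi (ev1 (pCons c a)) = Poly_Mapping.single 0 [:c:] +
      S1_mult (Poly_Mapping.single 0 (pcompose a [:0, 0, 1:])) (S1_gen G1)"
    by (simp only: C.ev_pCons phi_add phi_mult phi_gen phi_scalar pCons.IH)
  then show ?case
    by (simp add: S1_mult_single single_add[symmetric] pcompose_pCons mult.commute)
qed

lemma lookup_phi_x3_mult: "Poly_Mapping.lookup (phi (x3 * q)) k =
    pcompose (Poly_Mapping.lookup (phi q) (k - 1)) [:1, 1:] + pcompose (Poly_Mapping.lookup (phi q) (k + 1)) [:- 1, 1:]"
  unfolding phi_mult phi_gen by (rule lookup_gen_mult)

lemma pcompose_shift: "pcompose (pcompose g [:a, 1:]) [:b, 1:] = pcompose g [:a + b, 1 :: 'a::comm_semiring_1:]"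
  by (simp add: pcompose_assoc[symmetric] pcompose_pCons add.commute)

text \<open>The value is a_n((y + n)^2): each of the n factors x_3 contributes x on the left and
  shifts y by one. For n above the degree this gives 0, which the induction itself uses.\<close>

lemma lookup_phi_evC:
  fixes a :: "'f::field poly poly"
  assumes "Polynomial.degree a \<le> n"
  shows "Poly_Mapping.lookup (phi (evC a)) (int n) =
    pcompose (pcompose (Polynomial.coeff a n) [:0, 0, 1:]) [:of_nat n, 1:]"
  using assms
proof (induction a arbitrary: n)
  case 0
  show ?case by (simp add: phi.zero)
next
  case (pCons b a)
  show ?case
  proof (cases n)
    case 0
    with pCons.prems have "a = 0" by (auto split: if_splits)
    then show ?thesis
      using pcompose_idR[of "pcompose b [:0, 0, 1:]"] by (simp add: 0 evC_pCons phi_ev1)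
  next
    case (Suc m)
    then have m: "Polynomial.degree a \<le> m" using pCons.prems by (auto split: if_splits)
    \<comment> \<open>The summand 1/x of x_3 would bring down the coefficient two places higher; it
      lies beyond the degree.\<close>
    have "Poly_Mapping.lookup (phi (evC a)) (int (Suc (Suc m))) = 0"
      using m pCons.IH[of "Suc (Suc m)"] by (simp add: coeff_eq_0)
    then show ?thesis
      using pCons.IH[OF m]
      by (simp add: Suc evC_pCons phi_add phi_ev1 lookup_phi_x3_mult lookup_add lookup_single pcompose_shift
          add.commute)
  qed
qed

text \<open>The factor x_2 + x_3 maps to (x - 1/x) y and already contributes one power of x, hence
  exponent and shift n + 1 and the extra odd factor.\<close>

lemma lookup_phi_evD:
  fixes a :: "'f::field poly poly"
  assumes "Polynomial.degree a \<le> n"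
  shows "Poly_Mapping.lookup (phi (evD a)) (int (Suc n)) =
    pcompose (pCons 0 (pcompose (Polynomial.coeff a n) [:0, 0, 1:])) [:of_nat (Suc n), 1:]"
  using assms
proof (induction a arbitrary: n)
  case 0
  show ?case by (simp add: phi.zero)
next
  case (pCons b a)
  have "phi ((x2 + x3) * ev1 b) = S1_mult (S1_gen G2) (Poly_Mapping.single 0 (pcompose b [:0, 0, 1:])) +
      S1_mult (S1_gen G3) (Poly_Mapping.single 0 (pcompose b [:0, 0, 1:]))"
    by (simp only: distrib_right phi_add phi_mult phi_gen phi_ev1)
  then have head: "Poly_Mapping.lookup (phi ((x2 + x3) * ev1 b)) (int (Suc m)) =
      (if m = 0 then [:1, 1:] * pcompose (pcompose b [:0, 0, 1:]) [:1, 1:] else 0)" for m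
    by (simp add: lookup_add lookup_gen_mult lookup_single when_def del: S1_gen.simps)
  show ?case
  proof (cases n)
    case 0
    with pCons.prems have "a = 0" by (auto split: if_splits)
    then show ?thesis
      using head[of 0] by (simp add: 0 evD_pCons pcompose_pCons)
  next
    case (Suc m)
    then have m: "Polynomial.degree a \<le> m" using pCons.prems by (auto split: if_splits)
    have "Poly_Mapping.lookup (phi (evD a)) (int (Suc (Suc (Suc m)))) = 0"
      using m pCons.IH[of "Suc (Suc m)"] by (simp add: coeff_eq_0)
    then show ?thesis
      using pCons.IH[OF m] head[of n]
      by (simp add: Suc evD_pCons phi_add lookup_phi_x3_mult lookup_add pcompose_shift add.commute)
  qed
qed

text \<open>If b were nonzero, the two summands would have degrees of different parity and could not
  cancel.\<close>

lemma even_plus_odd_eq_0: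
  fixes a b :: "'a::idom poly"
  assumes "pcompose a [:0, 0, 1:] + pCons 0 (pcompose b [:0, 0, 1:]) = 0"
  shows "a = 0 \<and> b = 0"
proof -
  have zero_iff: "pcompose c [:0, 0, 1:] = 0 \<longleftrightarrow> c = 0" for c :: "'a poly"
    using pcompose_eq_0[of c "[:0, 0, 1:]"] by auto
  have "b = 0"
  proof (rule ccontr)
    assume "b \<noteq> 0"
    have "pcompose a [:0, 0, 1:] = - pCons 0 (pcompose b [:0, 0, 1:])"
      using assms by (simp only: eq_neg_iff_add_eq_0)
    then have "Polynomial.degree (pcompose a [:0, 0, 1:]) = Polynomial.degree (pCons 0 (pcompose b [:0, 0, 1:]))"
      by (simp only: degree_minus)
    then have "2 * Polynomial.degree a = Suc (2 * Polynomial.degree b)"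
      using \<open>b \<noteq> 0\<close> by (simp add: zero_iff degree_pcompose)
    then show False by presburger
  qed
  then show ?thesis using assms zero_iff by simp
qed

lemma phi_inj_reduced:
  fixes a b :: "'f::field poly poly"
  assumes "phi (evC a + evD b) = 0"
  shows "a = 0 \<and> b = 0"
proof -
  have shift0: "pcompose g [:c, 1:] = 0 \<Longrightarrow> g = 0" for g :: "'f poly" and c
    using pcompose_eq_0[of g "[:c, 1:]"] by simp
  have sum0: "Poly_Mapping.lookup (phi (evC a)) k + Poly_Mapping.lookup (phi (evD b)) k = 0" for k
    using assms by (simp add: phi_add flip: lookup_add)
  show ?thesis
  proof (cases "b = 0")
    case True
    then have "pcompose (pcompose (Polynomial.lead_coeff a) [:0, 0, 1:]) [:of_nat (Polynomial.degree a), 1:] = 0"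
      using sum0[of "int (Polynomial.degree a)"] lookup_phi_evC[of a "Polynomial.degree a"]
      by (simp add: phi.zero)
    then have "pcompose (Polynomial.lead_coeff a) [:0, 0, 1:] = 0" by (rule shift0)
    then have "a = 0"
      using even_plus_odd_eq_0[of "Polynomial.lead_coeff a" 0] by simp
    then show ?thesis using True by simp
  next
    case False
    \<comment> \<open>The exponent m + 1 is the highest that can occur in either image: the maximum
      of deg a and deg b + 1, also when the subtraction truncates at 0.\<close>
    define m where "m = max (Polynomial.degree a - 1) (Polynomial.degree b)"
    have "pcompose (pcompose (Polynomial.coeff a (Suc m)) [:0, 0, 1:] +
        pCons 0 (pcompose (Polynomial.coeff b m) [:0, 0, 1:])) [:of_nat (Suc m), 1:] = 0"
      using sum0[of "int (Suc m)"] lookup_phi_evC[of a "Suc m"] lookup_phi_evD[of b m]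
      by (simp add: m_def pcompose_add)
    then have "pcompose (Polynomial.coeff a (Suc m)) [:0, 0, 1:] +
        pCons 0 (pcompose (Polynomial.coeff b m) [:0, 0, 1:]) = 0" by (rule shift0)
    then have 0: "Polynomial.coeff a (Suc m) = 0" "Polynomial.coeff b m = 0"
      using even_plus_odd_eq_0 by blast+
    \<comment> \<open>The coefficient of b at m vanishes, so the maximum is attained by a alone;
      then the leading coefficient of a vanishes, a contradiction.\<close>
    have "m \<noteq> Polynomial.degree b" using 0(2) False by auto
    then have "Suc m = Polynomial.degree a" "Polynomial.degree a \<noteq> 0" unfolding m_def by linarith+
    then show ?thesis using 0(1) by auto
  qed
qed

lemma (in char_not_2) kernel_phi:
  fixes q :: "'f t1"
  shows "phi q = 0 \<longleftrightarrow> (\<exists>r. q = t1_p * r)"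
proof
  assume q: "phi q = 0"
  obtain a b r where *: "q = evC a + evD b + t1_p * r"
    using reduced_normal_form[OF reduced_UNIV] by blast
  then have "phi (evC a + evD b) = 0"
    using q by (simp add: phi_add phi_mult phi_p)
  then have "a = 0 \<and> b = 0" by (rule phi_inj_reduced)
  then show "\<exists>r. q = t1_p * r" using * by auto
qed (auto simp: phi_mult phi_p)

section \<open>The fixed ring\<close>

lemma S1_simps:
  "carrier S1 = UNIV" "a \<otimes>\<^bsub>S1\<^esub> b = S1_mult a b" "a \<oplus>\<^bsub>S1\<^esub> b = a + b" "\<zero>\<^bsub>S1\<^esub> = 0" "\<one>\<^bsub>S1\<^esub> = 1"
  "c \<odot>\<^bsub>S1\<^esub> a = S1_smult c a"
  by (simp_all add: S1_def)

lemma S1_minus: "\<ominus>\<^bsub>S1\<^esub> a = - a"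
  by (rule abelian_group.minus_equality[OF ring.is_abelian_group[OF ring_S1]])
     (simp_all add: S1_simps)

lemma S1_inv_x: "inv\<^bsub>S1\<^esub> S1_x = Poly_Mapping.single (- 1) 1"
  by (rule monoid.inv_char[OF ring.is_monoid[OF ring_S1]])
     (simp_all add: S1_simps S1_x_def S1_mult_single pcompose_1)

text \<open>S_1 is generated as an algebra by x, 1/x and y, and the value at 1/x is forced by the
  value at x. The given automorphism may therefore be replaced by the explicit
  \<open>S1_flip\<close>.\<close>

lemma theta_eq_flip:
  fixes \<theta> :: "(int \<Rightarrow>\<^sub>0 'f::field poly) \<Rightarrow> (int \<Rightarrow>\<^sub>0 'f poly)"
  assumes iso: "\<theta> \<in> algebra_iso S1 S1" and x: "\<theta> S1_x = inv\<^bsub>S1\<^esub> S1_x" and y: "\<theta> S1_y = \<ominus>\<^bsub>S1\<^esub> S1_y"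
  shows "\<theta> = S1_flip"
proof
  have add: "\<theta> (a + b) = \<theta> a + \<theta> b" and mult: "\<theta> (S1_mult a b) = S1_mult (\<theta> a) (\<theta> b)"
    and smult: "\<theta> (S1_smult c a) = S1_smult c (\<theta> a)" and one: "\<theta> 1 = 1" for a b c
    using iso by (auto simp: algebra_iso_def ring_iso_def ring_hom_def S1_simps)
  have zero: "\<theta> 0 = 0" using add[of 0 0] by (metis add_0 add_right_cancel)
  have X: "\<theta> (Poly_Mapping.single 1 1) = Poly_Mapping.single (- 1) 1"
    using x unfolding S1_inv_x by (simp only: S1_x_def)
  have Y: "\<theta> (Poly_Mapping.single 0 [:0, 1:]) = S1_flip (Poly_Mapping.single 0 [:0, 1:])"
    using y by (simp add: S1_minus S1_y_def S1_flip_single pcompose_pCons single_uminus[symmetric])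
  have X': "\<theta> (Poly_Mapping.single (- 1) 1) = Poly_Mapping.single 1 1"
  proof -
    have "S1_mult (Poly_Mapping.single 1 1) (Poly_Mapping.single (- 1) 1) = (1 :: int \<Rightarrow>\<^sub>0 'f poly)"
      "S1_mult (Poly_Mapping.single (- 1) 1) (Poly_Mapping.single 1 1) = (1 :: int \<Rightarrow>\<^sub>0 'f poly)"
      by (simp_all add: S1_mult_single pcompose_1)
    \<comment> \<open>The image of 1/x is a right inverse of 1/x, the image of x; multiplying by x
      on the left identifies it as x.\<close>
    moreover from this(1) have "S1_mult (Poly_Mapping.single (- 1) 1) (\<theta> (Poly_Mapping.single (- 1) 1)) = 1"
      by (metis mult one X)
    ultimately show ?thesis
      by (metis S1_mult_1 S1_mult_assoc)
  qed
  have coef: "\<theta> (Poly_Mapping.single 0 a) = S1_flip (Poly_Mapping.single 0 a)" for a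
  proof (induction a)
    case (pCons c a)
    have "Poly_Mapping.single 0 (pCons c a) =
        S1_smult c 1 + S1_mult (Poly_Mapping.single 0 [:0, 1:]) (Poly_Mapping.single (0 :: int) a)"
      using pcompose_idR[of a]
      by (simp add: S1_mult_single S1_smult_single single_add[symmetric] flip: single_one)
    then show ?case
      by (simp only: add mult smult one Y pCons.IH S1_flip_add S1_flip_mult S1_flip_smult S1_flip_1)
  qed (simp add: zero S1_flip_0)
  have pow: "\<theta> (Poly_Mapping.single (s * int n) 1) = Poly_Mapping.single (- s * int n) 1"
    if s: "s = 1 \<or> s = - 1" for s n
  proof (induction n)
    case 0
    show ?case by (simp add: one)
  next
    case (Suc n)
    have "Poly_Mapping.single (s * int (Suc n)) (1 :: 'f poly) =
        S1_mult (Poly_Mapping.single s 1) (Poly_Mapping.single (s * int n) 1)"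
      by (simp add: S1_mult_single pcompose_1 algebra_simps)
    moreover have "\<theta> (Poly_Mapping.single s 1) = Poly_Mapping.single (- s) 1"
      using s X X' by auto
    ultimately show ?case
      by (simp only: mult Suc) (simp add: S1_mult_single pcompose_1 algebra_simps)
  qed
  show "\<theta> f = S1_flip f" for f
  proof (induction f rule: poly_mapping_add_induct)
    case (single i a)
    have "Poly_Mapping.single i a = S1_mult (Poly_Mapping.single 0 a) (Poly_Mapping.single i 1)"
      by (simp add: S1_mult_single pcompose_1)
    moreover have "\<theta> (Poly_Mapping.single i 1) = S1_flip (Poly_Mapping.single i 1)"
      using pow[of 1 "nat i"] pow[of "- 1" "nat (- i)"]
      by (cases "i \<ge> 0") (simp_all add: S1_flip_single pcompose_1)
    ultimately show ?case
      by (simp only: mult coef S1_flip_mult)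
  qed (simp_all add: zero add S1_flip_0 S1_flip_add)
qed

section \<open>Absence of zero divisors in S_1\<close>

lemma lookup_S1_mult_top:
  fixes f g :: "int \<Rightarrow>\<^sub>0 'f::field poly"
  defines "i \<equiv> Max (Poly_Mapping.keys f)" and "j \<equiv> Max (Poly_Mapping.keys g)"
  assumes "f \<noteq> 0" "g \<noteq> 0"
  shows "Poly_Mapping.lookup (S1_mult f g) (i + j) =
    Poly_Mapping.lookup f i * pcompose (Poly_Mapping.lookup g j) [:of_int i, 1:]"
proof -
  let ?A = "Poly_Mapping.keys f" and ?B = "Poly_Mapping.keys g"
  let ?F = "\<lambda>k l. Poly_Mapping.lookup f k * pcompose (Poly_Mapping.lookup g l) [:of_int k, 1:]"
  have ne: "?A \<noteq> {}" "?B \<noteq> {}" using assms by simp_all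
  have le: "k \<le> i" "l \<le> j" if "k \<in> ?A" "l \<in> ?B" for k l
    using that by (simp_all add: i_def j_def)
  have mem: "i \<in> ?A" "j \<in> ?B" using ne by (simp_all add: i_def j_def)
  have "Poly_Mapping.lookup (S1_mult f g) (i + j) = (\<Sum>k\<in>?A. \<Sum>l\<in>?B. if k + l = i + j then ?F k l else 0)"
    by (simp add: S1_mult_superset[of ?A ?B] lookup_sum lookup_single when_def)
  also have "\<dots> = (\<Sum>k\<in>{i}. \<Sum>l\<in>?B. if k + l = i + j then ?F k l else 0)"
  proof (rule sum.mono_neutral_right)
    show "\<forall>k\<in>?A - {i}. (\<Sum>l\<in>?B. if k + l = i + j then ?F k l else 0) = 0"
    proof
      fix k assume k: "k \<in> ?A - {i}"
      show "(\<Sum>l\<in>?B. if k + l = i + j then ?F k l else 0) = 0"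
      proof (rule sum.neutral, rule ballI)
        fix l assume "l \<in> ?B"
        then have "k + l < i + j" using k le[of k l] by auto
        then show "(if k + l = i + j then ?F k l else 0) = 0" by simp
      qed
    qed
  qed (use mem in auto)
  also have "\<dots> = ?F i j"
    using mem by (simp add: sum.delta)
  finally show ?thesis .
qed

text \<open>The product of the top coefficients is twisted only by a shift of y, which is injective,
  and F[y] is a domain.\<close>

lemma S1_no_zero_divisors:
  assumes "S1_mult f g = 0"
  shows "f = 0 \<or> g = 0"
proof (rule ccontr)
  assume "\<not> (f = 0 \<or> g = 0)"
  then have fg: "f \<noteq> 0" "g \<noteq> 0" by auto
  let ?i = "Max (Poly_Mapping.keys f)" and ?j = "Max (Poly_Mapping.keys g)"
  have "?i \<in> Poly_Mapping.keys f" "?j \<in> Poly_Mapping.keys g"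
    using fg by (simp_all add: Max_in)
  then have "Poly_Mapping.lookup f ?i \<noteq> 0" "Poly_Mapping.lookup g ?j \<noteq> 0"
    by (simp_all add: in_keys_iff)
  then have "Poly_Mapping.lookup f ?i * pcompose (Poly_Mapping.lookup g ?j) [:of_int ?i, 1:] \<noteq> 0"
    using pcompose_eq_0[of "Poly_Mapping.lookup g ?j" "[:of_int ?i, 1:]"] by auto
  then show False
    using lookup_S1_mult_top[OF fg] assms by simp
qed

abbreviation S1_fixed :: "('f::field, int \<Rightarrow>\<^sub>0 'f poly) module" where
  "S1_fixed \<equiv> fixed_subalgebra S1 S1_flip"

lemma S1_fixed_simps:
  "carrier S1_fixed = {f. S1_flip f = f}" "a \<otimes>\<^bsub>S1_fixed\<^esub> b = S1_mult a b" "a \<oplus>\<^bsub>S1_fixed\<^esub> b = a + b"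
  "\<zero>\<^bsub>S1_fixed\<^esub> = 0" "\<one>\<^bsub>S1_fixed\<^esub> = 1" "c \<odot>\<^bsub>S1_fixed\<^esub> a = S1_smult c a"
  by (simp_all add: fixed_subalgebra_def S1_simps)

lemma S1_flip_uminus: "S1_flip (- f) = - S1_flip f"
  using S1_flip_add[of "- f" f] by (simp add: S1_flip_0 eq_neg_iff_add_eq_0)

lemma ring_S1_fixed: "ring S1_fixed"
proof -
  interpret ring S1 by (rule ring_S1)
  have "subring {a \<in> carrier S1. S1_flip a = a} S1"
    by (rule subringI) (auto simp: S1_simps S1_flip_1 S1_minus S1_flip_uminus S1_flip_mult S1_flip_add)
  then show ?thesis
    unfolding fixed_subalgebra_def by (rule subring_is_ring)
qed

lemma nc_domain_S1_fixed: "nc_domain S1_fixed"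
  using ring_S1_fixed S1_no_zero_divisors by (auto simp: nc_domain_def S1_fixed_simps)

text \<open>The map \<open>phi\<close> read on cosets, so that the isomorphism theorem for records
  applies.\<close>

definition quotient_map :: "(gen word \<Rightarrow>\<^sub>0 'f::field) set \<Rightarrow> (int \<Rightarrow>\<^sub>0 'f poly)" where
  "quotient_map c = phi (the_inv coset c)"

lemma quotient_map_coset: "quotient_map (coset q) = phi q"
  by (simp add: quotient_map_def the_inv_f_f[OF inj_coset])

context char_not_2
begin

lemma algebra_surjection_quotient_map:
  "algebra_surjection (T1 :: ('f, _) module) S1_fixed quotient_map"
proof (intro algebra_surjection.intro algebra_surjection_axioms.intro)
  show "ring_hom_ring (T1 :: ('f, _) module) S1_fixed quotient_map"
    by (rule ring_hom_ringI[OF ring_T1 ring_S1_fixed])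
       (auto simp: carrier_T1 quotient_map_coset T1_mult T1_add T1_one S1_fixed_simps flip_phi phi_mult phi_add)
  have "phi ` UNIV = {f :: int \<Rightarrow>\<^sub>0 'f poly. S1_flip f = f}"
    using fixed_in_range_phi[OF two_nonzero] flip_phi by blast
  then show "quotient_map ` carrier T1 = carrier (S1_fixed :: ('f, _) module)"
    by (simp add: carrier_T1 S1_fixed_simps image_image quotient_map_coset)
  fix a :: "(gen word \<Rightarrow>\<^sub>0 'f) set" and c assume "a \<in> carrier T1"
  then obtain q where a: "a = coset q" by (auto simp: carrier_T1)
  show "c \<odot>\<^bsub>T1\<^esub> a \<in> carrier T1"
    unfolding a T1_smult carrier_T1 by (rule rangeI)
  show "quotient_map (c \<odot>\<^bsub>T1\<^esub> a) = c \<odot>\<^bsub>S1_fixed\<^esub> quotient_map a"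
    unfolding a T1_smult quotient_map_coset S1_fixed_simps by (rule phi_scalar_mult)
qed

lemma kernel_quotient_map:
  "a_kernel (T1 :: ('f, _) module) S1_fixed quotient_map = T1_p <#\<^bsub>T1\<^esub> carrier T1"
proof -
  have "a_kernel (T1 :: ('f, _) module) S1_fixed quotient_map = coset ` {q. phi q = 0}"
    by (auto simp: a_kernel_def' carrier_T1 quotient_map_coset S1_fixed_simps)
  also have "\<dots> = coset ` range (\<lambda>r. t1_p * r)"
    by (auto simp: kernel_phi)
  also have "\<dots> = T1_p <#\<^bsub>T1\<^esub> carrier T1"
    by (auto simp: l_coset_def carrier_T1 T1_p_eq T1_mult)
  finally show ?thesis .
qed

lemma iterated_skew_polynomial_ring:
  "\<exists>A B \<delta> \<sigma> \<delta>\<^sub>1.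
        is_skew_polynomial_ring (T1\<lparr>carrier := A\<rparr>) (range (T1_scalar :: 'f \<Rightarrow> _))
          (T1_of X3) (\<lambda>r. r) (\<lambda>r. \<zero>\<^bsub>T1\<^esub>) \<and>
        is_skew_polynomial_ring (T1\<lparr>carrier := B\<rparr>) A (T1_of X2) (\<lambda>r. r) \<delta> \<and>
        is_skew_polynomial_ring (T1 :: ('f, _) module) B (T1_of X1) \<sigma> \<delta>\<^sub>1"
proof -
  have scalars: "coset ` range t1_scalar = range (T1_scalar :: 'f \<Rightarrow> _)"
    by (simp add: T1_scalar_eq image_image)
  have bij_id: "bij_betw (\<lambda>r. r) S S" for S :: "'f t1 set"
    by (simp add: bij_betw_def)
  have 1: "is_skew_polynomial_ring (T1\<lparr>carrier := coset ` range evA\<rparr>) (range (T1_scalar :: 'f \<Rightarrow> _))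
      (T1_of X3) (\<lambda>r. r) (\<lambda>r. \<zero>\<^bsub>T1\<^esub>)"
    unfolding T1_of_gen scalars[symmetric] T1_zero
    by (rule is_skew_polynomial_ring_T1[OF A.ore_ring_axioms inj_t1_scalar inj_evA,
          where \<sigma> = "\<lambda>r. r" and \<delta> = "\<lambda>r. 0"])
       (auto simp: bij_id t1_scalar_commute A.zero intro: range_eqI[of _ _ 0])
  \<comment> \<open>The derivation of F[x_3] is the commutator with x_2, transported to
    cosets.\<close>
  define \<delta>' where "\<delta>' c = coset (x2 * the_inv coset c - the_inv coset c * x2)" for c :: "(gen word \<Rightarrow>\<^sub>0 'f) set"
  have 2: "is_skew_polynomial_ring (T1\<lparr>carrier := coset ` range evB\<rparr>) (coset ` range evA)
      (T1_of X2) (\<lambda>r. r) \<delta>'"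
    unfolding T1_of_gen
  proof (rule is_skew_polynomial_ring_T1[OF B.ore_ring_axioms inj_evA inj_evB,
          where \<sigma> = "\<lambda>r. r" and \<delta> = "\<lambda>r. x2 * r - r * x2"])
    show "\<delta>' (coset r) = coset (x2 * r - r * x2)" for r
      by (simp add: \<delta>'_def the_inv_f_f[OF inj_coset])
  qed (use x2_commutator_A in \<open>auto simp: bij_id algebra_simps\<close>)
  obtain \<sigma> \<delta> :: "'f t1 \<Rightarrow> 'f t1" where *:
    "bij_betw \<sigma> (range evB) (range evB)" "\<sigma> 1 = 1"
    "\<And>r s. r \<in> range evB \<Longrightarrow> s \<in> range evB \<Longrightarrow> \<sigma> (r + s) = \<sigma> r + \<sigma> s"
    "\<And>r s. r \<in> range evB \<Longrightarrow> s \<in> range evB \<Longrightarrow> \<sigma> (r * s) = \<sigma> r * \<sigma> s"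
    "\<And>r. r \<in> range evB \<Longrightarrow> \<delta> r \<in> range evB"
    "\<And>r s. r \<in> range evB \<Longrightarrow> s \<in> range evB \<Longrightarrow> \<delta> (r + s) = \<delta> r + \<delta> s"
    "\<And>r s. r \<in> range evB \<Longrightarrow> s \<in> range evB \<Longrightarrow> \<delta> (r * s) = \<sigma> r * \<delta> s + \<delta> r * s"
    "\<And>r. r \<in> range evB \<Longrightarrow> x1 * r = \<sigma> r * x1 + \<delta> r"
    using x1_skew by blast
  have "is_skew_polynomial_ring (T1\<lparr>carrier := coset ` range evT\<rparr>) (coset ` range evB)
      (T1_of X1) (coset \<circ> \<sigma> \<circ> the_inv coset) (coset \<circ> \<delta> \<circ> the_inv coset)"
    unfolding T1_of_gen
    by (rule is_skew_polynomial_ring_T1[OF T.ore_ring_axioms inj_evB inj_evT _ _ *])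
       (simp_all add: the_inv_f_f[OF inj_coset])
  then have 3: "is_skew_polynomial_ring (T1 :: ('f, _) module) (coset ` range evB)
      (T1_of X1) (coset \<circ> \<sigma> \<circ> the_inv coset) (coset \<circ> \<delta> \<circ> the_inv coset)"
    by (simp only: range_evT T1_carrier_UNIV)
  from 1 2 3 show ?thesis by blast
qed

lemma central_T1_p: "central (T1 :: ('f, _) module) T1_p"
  by (auto simp: central_def T1_p_eq carrier_T1 T1_mult p_central)

end

theorem proposition5p3:
  fixes \<theta>\<^sub>1 :: "(int \<Rightarrow>\<^sub>0 'f::field poly) \<Rightarrow> (int \<Rightarrow>\<^sub>0 'f poly)"
  assumes char: "CHAR('f) \<noteq> 2"
    and theta_aut: "\<theta>\<^sub>1 \<in> algebra_iso S1 S1"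
    and theta_x: "\<theta>\<^sub>1 S1_x = inv\<^bsub>S1\<^esub> S1_x"
    and theta_y: "\<theta>\<^sub>1 S1_y = \<ominus>\<^bsub>S1\<^esub> S1_y"
  shows
    "(inj (T1_scalar :: 'f \<Rightarrow> _) \<and>
      (\<exists>A B \<delta> \<sigma> \<delta>\<^sub>1.
        is_skew_polynomial_ring (T1\<lparr>carrier := A\<rparr>) (range (T1_scalar :: 'f \<Rightarrow> _))
          (T1_of X3) (\<lambda>r. r) (\<lambda>r. \<zero>\<^bsub>T1\<^esub>) \<and>
        is_skew_polynomial_ring (T1\<lparr>carrier := B\<rparr>) A (T1_of X2) (\<lambda>r. r) \<delta> \<and>
        is_skew_polynomial_ring (T1 :: ('f, _) module) B (T1_of X1) \<sigma> \<delta>\<^sub>1)) \<and>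
     (central (T1 :: ('f, _) module) T1_p \<and> nc_domain (T1_mod_p :: ('f, _) module)) \<and>
     algebra_iso (fixed_subalgebra S1 \<theta>\<^sub>1) (T1_mod_p :: ('f, _) module) \<noteq> {}"
proof -
  \<comment> \<open>2 vanishes in the field exactly if the characteristic divides 2; the divisor 1
    is impossible and 2 is excluded by hypothesis.\<close>
  have "\<not> CHAR('f) dvd 2"
  proof
    assume dvd: "CHAR('f) dvd 2"
    then have "CHAR('f) \<le> 2" by (rule dvd_imp_le) simp
    moreover have "CHAR('f) \<noteq> 0" using dvd by (metis dvd_0_left_iff zero_neq_numeral)
    moreover have "CHAR('f) \<noteq> 1" using CHAR_not_1[where 'a = 'f] by simp
    ultimately show False using char by linarith
  qed
  then have "(2 :: 'f) \<noteq> 0"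
    using of_nat_eq_0_iff_char_dvd[where 'a = 'f, of 2] by simp
  then interpret char_not_2 "TYPE('f)" by unfold_locales
  interpret quotient: algebra_surjection "T1 :: ('f, _) module" S1_fixed quotient_map
    by (rule algebra_surjection_quotient_map)
  have T1_mod_p: "(T1_mod_p :: ('f, _) module) = T1 AQuot a_kernel T1 S1_fixed quotient_map"
    by (simp only: T1_mod_p_def kernel_quotient_map)
  have "inj (T1_scalar :: 'f \<Rightarrow> _)"
    using inj_t1_scalar by (simp add: T1_scalar_eq inj_def)
  moreover have "nc_domain (T1_mod_p :: ('f, _) module)"
    unfolding T1_mod_p by (rule quotient.nc_domain_quotient[OF nc_domain_S1_fixed])
  moreover have "algebra_iso (fixed_subalgebra S1 \<theta>\<^sub>1) (T1_mod_p :: ('f, _) module) \<noteq> {}"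
    unfolding T1_mod_p theta_eq_flip[OF theta_aut theta_x theta_y]
    using quotient.first_isomorphism by blast
  ultimately show ?thesis
    using iterated_skew_polynomial_ring central_T1_p by blast
qed

end
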